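(* Let $B=1$. For every sufficiently large prime $p$ there is a real number $E=E_p$ such that $$E_p=2-\frac{2}{p}+O\!\left(\frac1{p^2}\right)\qquad(p\to\infty)$$ and such that there are real numbers $c_0,k_5$, not both zero, for which, with $(c_n)_{n\ge0}$ and $(k_n)_{n\ge1}$ the real sequences determined from $c_0,k_5,B,E$ by the recursion given in the context, the function $$\psi_0(x)=\begin{cases}\sum_{n=0}^{\infty}c_n|x|_p^n & \text{if }x\in\mathbb{Z}_p,\\ \sum_{n=1}^{\infty}k_n|x|_p^{-n}&\text{if }x\in\mathbb{Q}_p\setminus\mathbb{Z}_p\end{cases}$$ (with both series convergent) is a solution on $\mathbb{Q}_p$ of $D^2\Psi(x)+B|x|_p^2\Psi(x)=E\Psi(x)$. (No uniqueness of such $E$ is claimed.)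
   Context: $|\cdot|_p$ is the $p$-adic norm on $\mathbb{Q}_p$ (with $|p|_p=1/p$, and $|x|_p^0=1$ for all $x$), and $dy$ is the Haar measure on $(\mathbb{Q}_p,+)$ normalized by $\int_{\mathbb{Z}_p}dy=1$. For a real number $x\neq 0$, $\Gamma_p(x)=\frac{1-p^{x-1}}{1-p^{-x}}$. For $\alpha>0$ and a complex-valued function $f$ on $\mathbb{Q}_p$, $$D^\alpha f(x)=\frac{1}{\Gamma_p(-\alpha)}\int_{\mathbb{Q}_p}\frac{f(y)-f(x)}{|x-y|_p^{\alpha+1}}\,dy .$$ Recursion: given $B\ne0$, $E$, $c_0$, $k_5$, set $c_2=0$, $c_{2n+1}=0$ for all $n\ge 0$, and $$c_{2n+4}\frac{\Gamma_p(2n+5)}{\Gamma_p(2n+3)}+Bc_{2n}=Ec_{2n+2}\quad(n\ge 0);$$ set $k_1=k_3=0$, $k_{2n}=0$ for all $n\ge 1$, and $$k_{2n+1}\frac{\Gamma_p(-2n)}{\Gamma_p(-2n-2)}+Bk_{2n+5}=Ek_{2n+3}\quad(n\ge 1).$$ *)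

theory Defs
  imports "HOL-Analysis.Analysis" "HOL-Library.Landau_Symbols" "HOL-Computational_Algebra.Primes"
begin

section \<open>The field of p-adic numbers as a normed additive group\<close>

text \<open>
  The prime \<open>p\<close> varies inside the final statement, so \<open>Qp p\<close> is a carrier set rather than a type.
  It is the completion of the rationals for the p-adic absolute value: a p-adic number is a class
  of rational p-adic Cauchy sequences modulo p-adic null sequences. Multiplication
  is not needed below and is not defined.
\<close>

definition padic_abs_rat :: "nat \<Rightarrow> rat \<Rightarrow> real" where
  "padic_abs_rat p x =
     (if x = 0 then 0
      else real p powi (int (multiplicity (int p) (snd (quotient_of x)))
                        - int (multiplicity (int p) (fst (quotient_of x)))))"

definition padic_Cauchy :: "nat \<Rightarrow> (nat \<Rightarrow> rat) set" where
  "padic_Cauchy p = {X. \<forall>e>0. \<exists>N. \<forall>m\<ge>N. \<forall>n\<ge>N. padic_abs_rat p (X m - X n) < e}"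

definition padic_rel :: "nat \<Rightarrow> ((nat \<Rightarrow> rat) \<times> (nat \<Rightarrow> rat)) set" where
  "padic_rel p = {(X, Y). X \<in> padic_Cauchy p \<and> Y \<in> padic_Cauchy p \<and>
                          (\<lambda>n. padic_abs_rat p (X n - Y n)) \<longlonglongrightarrow> 0}"

type_synonym padic = "(nat \<Rightarrow> rat) set"

definition Qp :: "nat \<Rightarrow> padic set" where
  "Qp p = padic_Cauchy p // padic_rel p"

definition padic_add :: "nat \<Rightarrow> padic \<Rightarrow> padic \<Rightarrow> padic" where
  "padic_add p x y = (\<Union>X\<in>x. \<Union>Y\<in>y. padic_rel p `` {\<lambda>n. X n + Y n})"

definition padic_diff :: "nat \<Rightarrow> padic \<Rightarrow> padic \<Rightarrow> padic" where
  "padic_diff p x y = (\<Union>X\<in>x. \<Union>Y\<in>y. padic_rel p `` {\<lambda>n. X n - Y n})"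

definition padic_norm :: "nat \<Rightarrow> padic \<Rightarrow> real" where
  "padic_norm p x = (THE r. \<forall>X\<in>x. (\<lambda>n. padic_abs_rat p (X n)) \<longlonglongrightarrow> r)"

definition Zp :: "nat \<Rightarrow> padic set" where
  "Zp p = {x \<in> Qp p. padic_norm p x \<le> 1}"

text \<open>
  The locale \<open>Metric_space\<close> asks for nonnegativity and symmetry of the distance on the whole type,
  hence the default value outside the carrier.
\<close>

definition padic_dist :: "nat \<Rightarrow> padic \<Rightarrow> padic \<Rightarrow> real" where
  "padic_dist p x y = (if x \<in> Qp p \<and> y \<in> Qp p then padic_norm p (padic_diff p x y) else 0)"

definition padic_borel :: "nat \<Rightarrow> padic measure" where
  "padic_borel p = sigma (Qp p) {U. openin (Metric_space.mtopology (Qp p) (padic_dist p)) U}"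


section \<open>Haar measure\<close>

definition is_padic_haar :: "nat \<Rightarrow> padic measure \<Rightarrow> bool" where
  "is_padic_haar p M \<longleftrightarrow>
     space M = Qp p \<and> sets M = sets (padic_borel p) \<and>
     (\<forall>a\<in>Qp p. \<forall>A\<in>sets M. emeasure M (padic_add p a ` A) = emeasure M A) \<and>
     emeasure M (Zp p) = 1"

text \<open>
  The normalised Haar measure is unique; its existence for prime \<open>p\<close> is the lemma
  \<open>is_padic_haar_padic_haar\<close> at the end of this theory.
\<close>

definition padic_haar :: "nat \<Rightarrow> padic measure" where
  "padic_haar p = (SOME M. is_padic_haar p M)"


section \<open>The fractional derivative and the equation\<close>

definition Gamma_p :: "nat \<Rightarrow> real \<Rightarrow> real" where
  "Gamma_p p x = (1 - real p powr (x - 1)) / (1 - real p powr (- x))"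

definition vladimirov_integrand :: "nat \<Rightarrow> real \<Rightarrow> (padic \<Rightarrow> complex) \<Rightarrow> padic \<Rightarrow> padic \<Rightarrow> complex" where
  "vladimirov_integrand p \<alpha> f x y = (f y - f x) / of_real (padic_norm p (padic_diff p x y) powr (\<alpha> + 1))"

definition vladimirov :: "nat \<Rightarrow> real \<Rightarrow> (padic \<Rightarrow> complex) \<Rightarrow> padic \<Rightarrow> complex" where
  "vladimirov p \<alpha> f x =
     1 / of_real (Gamma_p p (- \<alpha>)) * integral\<^sup>L (padic_haar p) (vladimirov_integrand p \<alpha> f x)"

text \<open>
  The Bochner integral of a non-integrable function is \<open>0\<close> by convention, so being a solution
  explicitly includes that the integral defining the derivative exists at every point.
\<close>

definition solves_padic_oscillator ::
    "nat \<Rightarrow> real \<Rightarrow> real \<Rightarrow> (padic \<Rightarrow> complex) \<Rightarrow> bool" where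
  "solves_padic_oscillator p B E \<Psi> \<longleftrightarrow>
     (\<forall>x\<in>Qp p. integrable (padic_haar p) (vladimirov_integrand p 2 \<Psi> x) \<and>
        vladimirov p 2 \<Psi> x + of_real B * of_real (padic_norm p x ^ 2) * \<Psi> x = of_real E * \<Psi> x)"

definition c_recursion :: "nat \<Rightarrow> real \<Rightarrow> real \<Rightarrow> real \<Rightarrow> (nat \<Rightarrow> real) \<Rightarrow> bool" where
  "c_recursion p B E c0 c \<longleftrightarrow>
     c 0 = c0 \<and> c 2 = 0 \<and> (\<forall>n. c (2 * n + 1) = 0) \<and>
     (\<forall>n. c (2 * n + 4) * (Gamma_p p (2 * real n + 5) / Gamma_p p (2 * real n + 3))
            + B * c (2 * n) = E * c (2 * n + 2))"

text \<open>The sequence \<open>k\<close> is indexed from \<open>1\<close>; the value \<open>k 0\<close> is irrelevant and unconstrained.\<close>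

definition k_recursion :: "nat \<Rightarrow> real \<Rightarrow> real \<Rightarrow> real \<Rightarrow> (nat \<Rightarrow> real) \<Rightarrow> bool" where
  "k_recursion p B E k5 k \<longleftrightarrow>
     k 1 = 0 \<and> k 3 = 0 \<and> k 5 = k5 \<and> (\<forall>n\<ge>1. k (2 * n) = 0) \<and>
     (\<forall>n\<ge>1. k (2 * n + 1) * (Gamma_p p (- 2 * real n) / Gamma_p p (- 2 * real n - 2))
               + B * k (2 * n + 5) = E * k (2 * n + 3))"

definition psi0_converges :: "nat \<Rightarrow> (nat \<Rightarrow> real) \<Rightarrow> (nat \<Rightarrow> real) \<Rightarrow> bool" where
  "psi0_converges p c k \<longleftrightarrow>
     (\<forall>x\<in>Zp p. summable (\<lambda>n. c n * padic_norm p x ^ n)) \<and>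
     (\<forall>x\<in>Qp p - Zp p. summable (\<lambda>n. k (Suc n) * padic_norm p x powi (- int (Suc n))))"

definition psi0 :: "nat \<Rightarrow> (nat \<Rightarrow> real) \<Rightarrow> (nat \<Rightarrow> real) \<Rightarrow> padic \<Rightarrow> complex" where
  "psi0 p c k x =
     of_real (if x \<in> Zp p then \<Sum>n. c n * padic_norm p x ^ n
              else \<Sum>n. k (Suc n) * padic_norm p x powi (- int (Suc n)))"


section \<open>Existence of the Haar measure\<close>

subsection \<open>The p-adic absolute value on the rationals\<close>

context
  fixes p :: nat
  assumes p: "prime p"
begin

lemma p_gt_1: "p > 1" using p prime_gt_1_nat by blast
lemma prime_int_p: "prime (int p)" using p by simp

lemma padic_abs_rat_frac:
  assumes "a \<noteq> 0" "b \<noteq> 0"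
  shows "padic_abs_rat p (of_int a / of_int b)
           = real p powi (int (multiplicity (int p) b) - int (multiplicity (int p) a))"
proof -
  obtain n d where q: "quotient_of (of_int a / of_int b) = (n, d)" by force
  have d: "d > 0" using quotient_of_denom_pos[OF q] .
  have e: "of_int a / of_int b = (of_int n / of_int d :: rat)" using quotient_of_div[OF q] .
  have "(of_int (a * d) :: rat) = of_int (n * b)" using e d assms by (simp add: field_simps)
  hence eq: "a * d = n * b" by linarith
  have n: "n \<noteq> 0" using eq assms d by auto
  have pe: "prime_elem (int p)" using prime_int_p by simp
  have "multiplicity (int p) a + multiplicity (int p) d = multiplicity (int p) n + multiplicity (int p) b"
    using prime_elem_multiplicity_mult_distrib[OF pe \<open>a \<noteq> 0\<close>, of d]
      prime_elem_multiplicity_mult_distrib[OF pe n, of b] eq d assms by simp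
  hence "int (multiplicity (int p) d) - int (multiplicity (int p) n)
           = int (multiplicity (int p) b) - int (multiplicity (int p) a)" by linarith
  thus ?thesis using assms by (simp add: padic_abs_rat_def q)
qed

lemma padic_abs_rat_0 [simp]: "padic_abs_rat p 0 = 0" by (simp add: padic_abs_rat_def)

lemma padic_abs_rat_pos: "x \<noteq> 0 \<Longrightarrow> padic_abs_rat p x > 0"
  using p_gt_1 by (simp add: padic_abs_rat_def)

lemma padic_abs_rat_nonneg [simp]: "padic_abs_rat p x \<ge> 0"
  using p_gt_1 by (simp add: padic_abs_rat_def)

lemma rat_frac:
  fixes x :: rat
  obtains a b :: int where "b > 0" "coprime a b" "x = of_int a / of_int b"
  by (metis quotient_of_div quotient_of_denom_pos quotient_of_coprime surj_pair)

lemma padic_abs_rat_mult: "padic_abs_rat p (x * y) = padic_abs_rat p x * padic_abs_rat p y"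
proof (cases "x = 0 \<or> y = 0")
  case False
  obtain a b where ab: "b > 0" "x = of_int a / of_int b" by (rule rat_frac)
  obtain c d where cd: "d > 0" "y = of_int c / of_int d" by (rule rat_frac)
  have nz: "a \<noteq> 0" "c \<noteq> 0" "b \<noteq> 0" "d \<noteq> 0" using False ab cd by auto
  have pe: "prime_elem (int p)" using prime_int_p by simp
  have nz2: "a * c \<noteq> 0" "b * d \<noteq> 0" using nz by auto
  have xy: "x * y = of_int (a * c) / of_int (b * d)" using ab cd by simp
  show ?thesis unfolding xy
    unfolding ab cd
      padic_abs_rat_frac[OF nz(1,3)] padic_abs_rat_frac[OF nz(2,4)]
      padic_abs_rat_frac[OF nz2]
    using nz p_gt_1
    by (simp add: prime_elem_multiplicity_mult_distrib[OF pe] power_int_diff power_int_add del: of_int_mult)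
qed auto

lemma padic_abs_rat_of_int: "padic_abs_rat p (of_int a) \<le> 1"
proof (cases "a = 0")
  case False
  have "padic_abs_rat p (of_int a / of_int 1) \<le> 1"
    using False p_gt_1 by (subst padic_abs_rat_frac) (auto simp: power_int_minus power_int_of_nat field_simps)
  thus ?thesis by simp
qed simp

lemma padic_abs_rat_unit:
  assumes "\<not> int p dvd a" shows "padic_abs_rat p (of_int a) = 1"
proof -
  have "padic_abs_rat p (of_int a / of_int 1) = 1"
    using assms by (subst padic_abs_rat_frac) (auto simp: not_dvd_imp_multiplicity_0)
  thus ?thesis by simp
qed

lemma padic_abs_rat_1 [simp]: "padic_abs_rat p 1 = 1"
  using padic_abs_rat_unit[of 1] p_gt_1 by simp

lemma padic_abs_rat_p: "padic_abs_rat p (of_nat p) = 1 / real p"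
proof -
  have "padic_abs_rat p (of_int (int p) / of_int 1) = 1 / real p"
    using p_gt_1 prime_int_p by (subst padic_abs_rat_frac) (auto simp: power_int_minus field_simps multiplicity_self)
  thus ?thesis by simp
qed

lemma padic_abs_rat_le_1E:
  assumes "padic_abs_rat p x \<le> 1"
  obtains a b where "b > 0" "x = of_int a / of_int b" "\<not> int p dvd b"
proof (cases "x = 0")
  case True thus ?thesis using that[of 1 0] p_gt_1 by simp
next
  case False
  obtain a b where ab: "b > 0" "coprime a b" "x = of_int a / of_int b" by (rule rat_frac)
  have "\<not> int p dvd b"
  proof
    assume d: "int p dvd b"
    hence "\<not> int p dvd a" using ab(2) prime_int_p by (meson coprime_common_divisor not_prime_unit)
    hence "multiplicity (int p) a = 0" by (simp add: not_dvd_imp_multiplicity_0)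
    moreover have "multiplicity (int p) b > 0"
      using d ab(1) prime_int_p by (simp add: prime_multiplicity_gt_zero_iff)
    ultimately have "padic_abs_rat p x > 1" using False ab p_gt_1
      by (simp add: padic_abs_rat_frac one_less_power)
    thus False using assms by simp
  qed
  thus ?thesis using that ab by blast
qed

lemma padic_abs_rat_minus [simp]: "padic_abs_rat p (- x) = padic_abs_rat p x"
proof -
  have "\<not> int p dvd -1" using p_gt_1 by (simp add: zdvd_not_zless)
  hence "padic_abs_rat p (-1) = 1" using padic_abs_rat_unit[of "-1"] by simp
  thus ?thesis using padic_abs_rat_mult[of "-1" x] by simp
qed

lemma padic_abs_rat_minus_commute: "padic_abs_rat p (x - y) = padic_abs_rat p (y - x)"
  using padic_abs_rat_minus[of "x - y"] by simp

lemma padic_abs_rat_inverse: "padic_abs_rat p (inverse x) = inverse (padic_abs_rat p x)"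
proof (cases "x = 0")
  case False
  thus ?thesis using padic_abs_rat_mult[of x "inverse x"] False padic_abs_rat_pos[of x]
    by (simp add: field_simps)
qed simp

lemma padic_abs_rat_p_powi: "padic_abs_rat p (of_nat p powi n) = real p powi (- n)"
proof -
  have *: "padic_abs_rat p (of_nat p ^ n) = inverse (real p) ^ n" for n
    by (induction n) (auto simp: padic_abs_rat_mult padic_abs_rat_p divide_inverse)
  show ?thesis
    by (auto simp: power_int_def * padic_abs_rat_inverse power_inverse)
qed

lemma padic_abs_rat_one_plus:
  assumes "padic_abs_rat p z \<le> 1" shows "padic_abs_rat p (1 + z) \<le> 1"
proof -
  obtain a b where ab: "b > 0" "z = of_int a / of_int b" "\<not> int p dvd b"
    using padic_abs_rat_le_1E[OF assms] .
  have "1 + z = of_int (a + b) * inverse (of_int b)" using ab by (simp add: field_simps)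
  thus ?thesis using padic_abs_rat_of_int[of "a + b"] padic_abs_rat_unit[OF ab(3)]
    by (simp add: padic_abs_rat_mult padic_abs_rat_inverse del: of_int_add)
qed

lemma padic_abs_rat_add: "padic_abs_rat p (x + y) \<le> max (padic_abs_rat p x) (padic_abs_rat p y)"
proof -
  have *: "padic_abs_rat p (x + y) \<le> padic_abs_rat p x"
    if "padic_abs_rat p y \<le> padic_abs_rat p x" for x y
  proof (cases "x = 0")
    case True
    thus ?thesis using that by simp
  next
    case False
    have "padic_abs_rat p (y / x) \<le> 1"
      using that padic_abs_rat_pos[OF False]
      by (simp add: divide_inverse padic_abs_rat_mult padic_abs_rat_inverse) (simp add: field_simps)
    hence "padic_abs_rat p (1 + y / x) \<le> 1" by (rule padic_abs_rat_one_plus)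
    moreover have "x + y = x * (1 + y / x)" using False by (simp add: field_simps)
    ultimately show ?thesis by (simp add: padic_abs_rat_mult mult_left_le)
  qed
  show ?thesis using *[of y x] *[of x y] by (cases "padic_abs_rat p y \<le> padic_abs_rat p x") (auto simp: add.commute)
qed

lemma padic_abs_rat_diff_le:
  "padic_abs_rat p (x - z) \<le> max (padic_abs_rat p (x - y)) (padic_abs_rat p (y - z))"
  using padic_abs_rat_add[of "x - y" "y - z"] by simp

lemma padic_abs_rat_diff_le':
  "padic_abs_rat p (x - y) \<le> max (padic_abs_rat p x) (padic_abs_rat p y)"
  using padic_abs_rat_add[of "x" "- y"] by simp

lemma padic_abs_rat_abs_diff:
  "\<bar>padic_abs_rat p x - padic_abs_rat p y\<bar> \<le> padic_abs_rat p (x - y)"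
proof -
  have *: "padic_abs_rat p x \<le> padic_abs_rat p (x - y) + padic_abs_rat p y" for x y
  proof -
    have "padic_abs_rat p x \<le> max (padic_abs_rat p (x - y)) (padic_abs_rat p y)"
      using padic_abs_rat_add[of "x - y" y] by simp
    also have "\<dots> \<le> padic_abs_rat p (x - y) + padic_abs_rat p y"
      using padic_abs_rat_nonneg[of y] padic_abs_rat_nonneg[of "x-y"] by linarith
    finally show ?thesis .
  qed
  show ?thesis using *[of x y] *[of y x] padic_abs_rat_minus_commute[of x y] by linarith
qed

lemma powi_less_Suc_imp_le:
  assumes "padic_abs_rat p x < real p powi (n + 1)" shows "padic_abs_rat p x \<le> real p powi n"
proof (cases "x = 0")
  case False
  then obtain m where m: "padic_abs_rat p x = real p powi m" by (simp add: padic_abs_rat_def) 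
  have "m < n + 1"
  proof (rule ccontr)
    assume "\<not> m < n + 1"
    hence "real p powi (n + 1) \<le> real p powi m" using p_gt_1 by (intro power_int_increasing) auto
    thus False using assms m by simp
  qed
  thus ?thesis unfolding m using p_gt_1 by (intro power_int_increasing) auto
qed (use p_gt_1 in auto)

end

subsection \<open>The p-adic numbers as an ultrametric group\<close>

definition padic_class :: "nat \<Rightarrow> (nat \<Rightarrow> rat) \<Rightarrow> padic" where
  "padic_class p X = padic_rel p `` {X}"

definition padic_of_rat :: "nat \<Rightarrow> rat \<Rightarrow> padic" where
  "padic_of_rat p q = padic_class p (\<lambda>_. q)"

context
  fixes p :: nat
  assumes p: "prime p"
begin

lemma padic_CauchyD:
  "X \<in> padic_Cauchy p \<Longrightarrow> e > 0 \<Longrightarrow> \<exists>N. \<forall>m\<ge>N. \<forall>n\<ge>N. padic_abs_rat p (X m - X n) < e"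
  by (simp add: padic_Cauchy_def)

lemma padic_Cauchy_const [simp]: "(\<lambda>_. q) \<in> padic_Cauchy p"
  by (simp add: padic_Cauchy_def padic_abs_rat_0[OF p])

lemma padic_Cauchy_diff [simp]:
  assumes "X \<in> padic_Cauchy p" "Y \<in> padic_Cauchy p"
  shows "(\<lambda>n. X n - Y n) \<in> padic_Cauchy p"
  unfolding padic_Cauchy_def
proof (intro CollectI allI impI)
  fix e :: real assume e: "e > 0"
  obtain M N where M: "\<forall>m\<ge>M. \<forall>n\<ge>M. padic_abs_rat p (X m - X n) < e"
    and N: "\<forall>m\<ge>N. \<forall>n\<ge>N. padic_abs_rat p (Y m - Y n) < e"
    using padic_CauchyD[OF assms(1) e] padic_CauchyD[OF assms(2) e] by blast
  have "padic_abs_rat p (X m - Y m - (X n - Y n)) < e" if "m \<ge> max M N" "n \<ge> max M N" for m n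
  proof -
    have "padic_abs_rat p (X m - Y m - (X n - Y n))
            \<le> max (padic_abs_rat p (X m - X n)) (padic_abs_rat p (Y m - Y n))"
      using padic_abs_rat_diff_le'[OF p, of "X m - X n" "Y m - Y n"] by (simp add: algebra_simps)
    thus ?thesis using M N that by (smt (verit) max.bounded_iff)
  qed
  thus "\<exists>N. \<forall>m\<ge>N. \<forall>n\<ge>N. padic_abs_rat p (X m - Y m - (X n - Y n)) < e" by blast
qed

lemma padic_Cauchy_add [simp]:
  assumes "X \<in> padic_Cauchy p" "Y \<in> padic_Cauchy p"
  shows "(\<lambda>n. X n + Y n) \<in> padic_Cauchy p"
  using padic_Cauchy_diff[OF assms(1) padic_Cauchy_diff[OF padic_Cauchy_const[of 0] assms(2)]] by simp

lemma padic_null_squeeze: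
  assumes "(\<lambda>n. padic_abs_rat p (X n)) \<longlonglongrightarrow> 0" "(\<lambda>n. padic_abs_rat p (Y n)) \<longlonglongrightarrow> 0"
    "\<And>n. padic_abs_rat p (Z n) \<le> max (padic_abs_rat p (X n)) (padic_abs_rat p (Y n))"
  shows "(\<lambda>n. padic_abs_rat p (Z n)) \<longlonglongrightarrow> 0"
proof (rule tendsto_sandwich[OF _ _ tendsto_const])
  show "\<forall>\<^sub>F n in sequentially. 0 \<le> padic_abs_rat p (Z n)" by (simp add: padic_abs_rat_nonneg[OF p])
  show "\<forall>\<^sub>F n in sequentially. padic_abs_rat p (Z n) \<le> max (padic_abs_rat p (X n)) (padic_abs_rat p (Y n))"
    using assms(3) by simp
  show "(\<lambda>n. max (padic_abs_rat p (X n)) (padic_abs_rat p (Y n))) \<longlonglongrightarrow> 0"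
    using tendsto_max[OF assms(1,2)] by simp
qed

lemma equiv_padic_rel: "equiv (padic_Cauchy p) (padic_rel p)"
proof (rule equivI)
  show "padic_rel p \<subseteq> padic_Cauchy p \<times> padic_Cauchy p" by (auto simp: padic_rel_def)
  show "refl_on (padic_Cauchy p) (padic_rel p)"
    by (auto simp: refl_on_def padic_rel_def padic_abs_rat_0[OF p])
  show "sym (padic_rel p)"
    by (auto simp: sym_def padic_rel_def padic_abs_rat_minus_commute[OF p])
  show "trans (padic_rel p)"
    unfolding trans_def padic_rel_def
    using padic_null_squeeze[of "\<lambda>n. X n - Y n" "\<lambda>n. Y n - Z n" "\<lambda>n. X n - Z n" for X Y Z]
      padic_abs_rat_diff_le[OF p] by auto
qed

lemma padic_class_eq_iff:
  assumes "X \<in> padic_Cauchy p" "Y \<in> padic_Cauchy p"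
  shows "padic_class p X = padic_class p Y \<longleftrightarrow> (\<lambda>n. padic_abs_rat p (X n - Y n)) \<longlonglongrightarrow> 0"
  unfolding padic_class_def using eq_equiv_class_iff[OF equiv_padic_rel assms] assms
  by (auto simp: padic_rel_def)

lemma padic_class_in [simp]: "X \<in> padic_Cauchy p \<Longrightarrow> padic_class p X \<in> Qp p"
  by (simp add: Qp_def padic_class_def quotientI)

lemma QpE:
  assumes "x \<in> Qp p" obtains X where "X \<in> padic_Cauchy p" "x = padic_class p X"
  using assms unfolding Qp_def padic_class_def by (auto elim!: quotientE)

lemma in_padic_class:
  "X \<in> padic_Cauchy p \<Longrightarrow> Y \<in> padic_class p X \<longleftrightarrow> Y \<in> padic_Cauchy p \<and> (\<lambda>n. padic_abs_rat p (X n - Y n)) \<longlonglongrightarrow> 0"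
  by (auto simp: padic_class_def padic_rel_def)

lemma padic_add_class [simp]:
  assumes "X \<in> padic_Cauchy p" "Y \<in> padic_Cauchy p"
  shows "padic_add p (padic_class p X) (padic_class p Y) = padic_class p (\<lambda>n. X n + Y n)"
  unfolding padic_add_def padic_class_def
proof (rule UN_equiv_class2[OF equiv_padic_rel equiv_padic_rel _ assms])
  show "congruent2 (padic_rel p) (padic_rel p) (\<lambda>X Y. padic_rel p `` {\<lambda>n. X n + Y n})"
  proof (rule congruent2I'[OF ])
    fix X X' Y Y' assume *: "(X, X') \<in> padic_rel p" "(Y, Y') \<in> padic_rel p"
    have "(\<lambda>n. padic_abs_rat p (X n + Y n - (X' n + Y' n))) \<longlonglongrightarrow> 0"
      by (rule padic_null_squeeze[of "\<lambda>n. X n - X' n" "\<lambda>n. Y n - Y' n"])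
         (use * padic_abs_rat_add[OF p, of "X n - X' n" "Y n - Y' n" for n] in \<open>auto simp: padic_rel_def algebra_simps\<close>)
    thus "padic_rel p `` {\<lambda>n. X n + Y n} = padic_rel p `` {\<lambda>n. X' n + Y' n}"
      using * by (intro equiv_class_eq[OF equiv_padic_rel]) (auto simp: padic_rel_def)
  qed
qed

lemma padic_diff_class [simp]:
  assumes "X \<in> padic_Cauchy p" "Y \<in> padic_Cauchy p"
  shows "padic_diff p (padic_class p X) (padic_class p Y) = padic_class p (\<lambda>n. X n - Y n)"
  unfolding padic_diff_def padic_class_def
proof (rule UN_equiv_class2[OF equiv_padic_rel equiv_padic_rel _ assms])
  show "congruent2 (padic_rel p) (padic_rel p) (\<lambda>X Y. padic_rel p `` {\<lambda>n. X n - Y n})"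
  proof (rule congruent2I'[OF ])
    fix X X' Y Y' assume *: "(X, X') \<in> padic_rel p" "(Y, Y') \<in> padic_rel p"
    have "(\<lambda>n. padic_abs_rat p (X n - Y n - (X' n - Y' n))) \<longlonglongrightarrow> 0"
      by (rule padic_null_squeeze[of "\<lambda>n. X n - X' n" "\<lambda>n. Y n - Y' n"])
         (use * padic_abs_rat_diff_le'[OF p, of "X n - X' n" "Y n - Y' n" for n] in \<open>auto simp: padic_rel_def algebra_simps\<close>)
    thus "padic_rel p `` {\<lambda>n. X n - Y n} = padic_rel p `` {\<lambda>n. X' n - Y' n}"
      using * by (intro equiv_class_eq[OF equiv_padic_rel]) (auto simp: padic_rel_def)
  qed
qed

lemma padic_norm_class:
  assumes X: "X \<in> padic_Cauchy p"
  shows "(\<lambda>n. padic_abs_rat p (X n)) \<longlonglongrightarrow> padic_norm p (padic_class p X)"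
proof -
  have "Cauchy (\<lambda>n. padic_abs_rat p (X n))"
  proof (rule metric_CauchyI)
    fix e :: real assume "e > 0"
    then obtain N where "\<forall>m\<ge>N. \<forall>n\<ge>N. padic_abs_rat p (X m - X n) < e" using padic_CauchyD[OF X] by blast
    thus "\<exists>N. \<forall>m\<ge>N. \<forall>n\<ge>N. dist (padic_abs_rat p (X m)) (padic_abs_rat p (X n)) < e"
      unfolding dist_real_def using padic_abs_rat_abs_diff[OF p] by (meson order.strict_trans1)
  qed
  then obtain r where r: "(\<lambda>n. padic_abs_rat p (X n)) \<longlonglongrightarrow> r"
    using Cauchy_convergent convergent_def by blast
  have all: "\<forall>Y\<in>padic_class p X. (\<lambda>n. padic_abs_rat p (Y n)) \<longlonglongrightarrow> r"
  proof
    fix Y assume "Y \<in> padic_class p X"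
    hence "(\<lambda>n. padic_abs_rat p (X n - Y n)) \<longlonglongrightarrow> 0" using in_padic_class[OF X] by simp
    hence "(\<lambda>n. padic_abs_rat p (X n) - padic_abs_rat p (Y n)) \<longlonglongrightarrow> 0"
      by (rule Lim_null_comparison[rotated]) (simp add: padic_abs_rat_abs_diff[OF p])
    from tendsto_diff[OF r this] show "(\<lambda>n. padic_abs_rat p (Y n)) \<longlonglongrightarrow> r" by simp
  qed
  have mem: "X \<in> padic_class p X" using in_padic_class[OF X] X by (simp add: padic_abs_rat_0[OF p])
  have "padic_norm p (padic_class p X) = r"
    unfolding padic_norm_def using all mem r by (intro the_equality) (auto intro: LIMSEQ_unique)
  thus ?thesis using r by simp
qed

lemma padic_norm_eqI:
  "X \<in> padic_Cauchy p \<Longrightarrow> (\<lambda>n. padic_abs_rat p (X n)) \<longlonglongrightarrow> r \<Longrightarrow> padic_norm p (padic_class p X) = r"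
  using padic_norm_class LIMSEQ_unique by blast

lemma padic_of_rat_in [simp]: "padic_of_rat p q \<in> Qp p"
  by (simp add: padic_of_rat_def)

lemma padic_norm_of_rat [simp]: "padic_norm p (padic_of_rat p q) = padic_abs_rat p q"
  unfolding padic_of_rat_def by (rule padic_norm_eqI) auto

lemma padic_add_in [simp]: "x \<in> Qp p \<Longrightarrow> y \<in> Qp p \<Longrightarrow> padic_add p x y \<in> Qp p"
  by (elim QpE) simp

lemma padic_diff_in [simp]: "x \<in> Qp p \<Longrightarrow> y \<in> Qp p \<Longrightarrow> padic_diff p x y \<in> Qp p"
  by (elim QpE) simp

lemma padic_norm_nonneg: assumes "x \<in> Qp p" shows "padic_norm p x \<ge> 0"
proof -
  obtain X where X: "X \<in> padic_Cauchy p" "x = padic_class p X" using QpE[OF assms] .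
  show ?thesis unfolding X(2) 
    by (rule LIMSEQ_le_const[OF padic_norm_class[OF X(1)]]) (auto simp: padic_abs_rat_nonneg[OF p])
qed

lemma padic_dist_commute: assumes "x \<in> Qp p" "y \<in> Qp p" shows "padic_dist p x y = padic_dist p y x"
proof -
  obtain X Y where X: "X \<in> padic_Cauchy p" "x = padic_class p X" and Y: "Y \<in> padic_Cauchy p" "y = padic_class p Y"
    using QpE[OF assms(1)] QpE[OF assms(2)] by metis
  have "padic_norm p (padic_class p (\<lambda>n. X n - Y n)) = padic_norm p (padic_class p (\<lambda>n. Y n - X n))"
    using padic_norm_class[of "\<lambda>n. Y n - X n"] X Y
    by (intro padic_norm_eqI) (auto simp: padic_abs_rat_minus_commute[OF p, of "X _"])
  thus ?thesis using X Y by (simp add: padic_dist_def)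
qed

lemma padic_dist_eq_0_iff:
  assumes "x \<in> Qp p" "y \<in> Qp p" shows "padic_dist p x y = 0 \<longleftrightarrow> x = y"
proof -
  obtain X Y where X: "X \<in> padic_Cauchy p" "x = padic_class p X" and Y: "Y \<in> padic_Cauchy p" "y = padic_class p Y"
    using QpE[OF assms(1)] QpE[OF assms(2)] by metis
  have "padic_norm p (padic_class p (\<lambda>n. X n - Y n)) = 0 \<longleftrightarrow> (\<lambda>n. padic_abs_rat p (X n - Y n)) \<longlonglongrightarrow> 0"
    using padic_norm_class[of "\<lambda>n. X n - Y n"] padic_norm_eqI[of "\<lambda>n. X n - Y n" 0] X Y by auto
  thus ?thesis using X Y padic_class_eq_iff by (simp add: padic_dist_def)
qed

lemma padic_dist_ultra:
  assumes "x \<in> Qp p" "y \<in> Qp p" "z \<in> Qp p"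
  shows "padic_dist p x z \<le> max (padic_dist p x y) (padic_dist p y z)"
proof -
  obtain X Y Z where X: "X \<in> padic_Cauchy p" "x = padic_class p X" and Y: "Y \<in> padic_Cauchy p" "y = padic_class p Y"
    and Z: "Z \<in> padic_Cauchy p" "z = padic_class p Z"
    using QpE[OF assms(1)] QpE[OF assms(2)] QpE[OF assms(3)] by metis
  have "padic_norm p (padic_class p (\<lambda>n. X n - Z n))
      \<le> max (padic_norm p (padic_class p (\<lambda>n. X n - Y n))) (padic_norm p (padic_class p (\<lambda>n. Y n - Z n)))"
    using X Y Z padic_abs_rat_diff_le[OF p]
    by (intro LIMSEQ_le[OF padic_norm_class tendsto_max[OF padic_norm_class padic_norm_class]]) auto
  thus ?thesis using X Y Z by (simp add: padic_dist_def)
qed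

lemma padic_dist_nonneg: "x \<in> Qp p \<Longrightarrow> y \<in> Qp p \<Longrightarrow> padic_dist p x y \<ge> 0"
  by (simp add: padic_dist_def padic_norm_nonneg)

lemma Metric_space_Qp: "Metric_space (Qp p) (padic_dist p)"
proof
  fix x y z
  show "0 \<le> padic_dist p x y" using padic_dist_nonneg[of x y] by (auto simp: padic_dist_def)
  show "padic_dist p x y = padic_dist p y x"
    using padic_dist_commute[of x y] by (auto simp: padic_dist_def)
  assume xy: "x \<in> Qp p" "y \<in> Qp p"
  thus "(padic_dist p x y = 0) = (x = y)" by (rule padic_dist_eq_0_iff)
  assume z: "z \<in> Qp p"
  show "padic_dist p x z \<le> padic_dist p x y + padic_dist p y z"
    using padic_dist_ultra[OF xy z] padic_dist_nonneg[OF xy] padic_dist_nonneg[OF xy(2) z] by linarith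
qed

lemma padic_dense:
  assumes "x \<in> Qp p" "e > 0" obtains q where "padic_dist p x (padic_of_rat p q) < e"
proof -
  obtain X where X: "X \<in> padic_Cauchy p" "x = padic_class p X" using QpE[OF assms(1)] .
  obtain N where N: "\<forall>m\<ge>N. \<forall>n\<ge>N. padic_abs_rat p (X m - X n) < e / 2"
    using padic_CauchyD[OF X(1), of "e/2"] assms by auto
  have "padic_norm p (padic_class p (\<lambda>n. X n - X N)) \<le> e / 2"
    using N X by (intro LIMSEQ_le_const2[OF padic_norm_class]) (auto intro!: exI[of _ N] less_imp_le)
  thus ?thesis using X assms by (intro that[of "X N"]) (auto simp: padic_dist_def padic_of_rat_def)
qed

lemma padic_add_dist_cancel:
  assumes "a \<in> Qp p" "x \<in> Qp p" "y \<in> Qp p"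
  shows "padic_dist p (padic_add p a x) (padic_add p a y) = padic_dist p x y"
proof -
  obtain A X Y where "A \<in> padic_Cauchy p" "a = padic_class p A" and "X \<in> padic_Cauchy p" "x = padic_class p X"
    and "Y \<in> padic_Cauchy p" "y = padic_class p Y"
    using QpE[OF assms(1)] QpE[OF assms(2)] QpE[OF assms(3)] by metis
  thus ?thesis by (simp add: padic_dist_def)
qed

lemma padic_add_inverse:
  assumes "a \<in> Qp p"
  obtains b where "b \<in> Qp p" "\<And>x. x \<in> Qp p \<Longrightarrow> padic_add p a (padic_add p b x) = x"
    "\<And>x. x \<in> Qp p \<Longrightarrow> padic_add p b (padic_add p a x) = x"
proof -
  obtain A where A: "A \<in> padic_Cauchy p" "a = padic_class p A" using QpE[OF assms] .
  have A': "(\<lambda>n. - A n) \<in> padic_Cauchy p"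
    using padic_Cauchy_diff[OF padic_Cauchy_const[of 0] A(1)] by simp
  have "padic_add p a (padic_add p (padic_class p (\<lambda>n. - A n)) x) = x \<and>
        padic_add p (padic_class p (\<lambda>n. - A n)) (padic_add p a x) = x" if x: "x \<in> Qp p" for x
  proof -
    obtain X where "X \<in> padic_Cauchy p" "x = padic_class p X" using QpE[OF x] .
    thus ?thesis using A A' by simp
  qed
  thus ?thesis using that[of "padic_class p (\<lambda>n. - A n)"] A' by auto
qed

end

subsection \<open>Integers in base p with reversed digits\<close>

fun radical_inverse :: "nat \<Rightarrow> nat \<Rightarrow> rat" where
  "radical_inverse p n =
     (if n = 0 \<or> p < 2 then 0 else (of_nat (n mod p) + radical_inverse p (n div p)) / of_nat p)"

declare radical_inverse.simps [simp del]

context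
  fixes p :: nat
  assumes p: "prime p"
begin

lemma radical_inverse_0 [simp]: "radical_inverse p 0 = 0"
  by (simp add: radical_inverse.simps)

lemma radical_inverse_rec:
  "radical_inverse p n = (of_nat (n mod p) + radical_inverse p (n div p)) / of_nat p"
proof (cases "n = 0")
  case False
  thus ?thesis using p_gt_1[OF p] by (subst radical_inverse.simps) simp
qed simp

lemma radical_inverse_bounds: "0 \<le> radical_inverse p n \<and> radical_inverse p n < 1"
proof (induction n rule: less_induct)
  case (less n)
  show ?case
  proof (cases "n = 0")
    case False
    hence IH: "0 \<le> radical_inverse p (n div p)" "radical_inverse p (n div p) < 1"
      using less p_gt_1[OF p] by auto
    have "n mod p + 1 \<le> p" using p_gt_1[OF p] by (simp add: Suc_leI)
    hence "(of_nat (n mod p) + 1 :: rat) \<le> of_nat p" by (metis of_nat_1 of_nat_add of_nat_le_iff)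
    thus ?thesis using IH p_gt_1[OF p] by (subst (1 2) radical_inverse_rec) (simp add: field_simps)
  qed simp
qed

lemma radical_inverse_inj: "radical_inverse p m = radical_inverse p n \<Longrightarrow> m = n"
proof (induction m arbitrary: n rule: less_induct)
  case (less m)
  have eq: "of_nat (m mod p) + radical_inverse p (m div p) = of_nat (n mod p) + radical_inverse p (n div p)"
    using less.prems p_gt_1[OF p] by (subst (asm) (1 2) radical_inverse_rec) simp
  have fl: "\<lfloor>of_nat k + radical_inverse p l\<rfloor> = int k" for k l
    using radical_inverse_bounds[of l] by (intro floor_unique) auto
  have md: "m mod p = n mod p" using fl[of "m mod p" "m div p"] fl[of "n mod p" "n div p"] eq by simp
  have dv: "radical_inverse p (m div p) = radical_inverse p (n div p)" using eq md by simp
  have pos: "radical_inverse p k > 0" if "k > 0" for k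
  proof (rule ccontr)
    assume "\<not> radical_inverse p k > 0"
    hence "radical_inverse p k = 0" using radical_inverse_bounds[of k] by simp
    with that show False
    proof (induction k rule: less_induct)
      case (less k)
      have "of_nat (k mod p) + radical_inverse p (k div p) = 0"
        using less.prems p_gt_1[OF p] by (subst (asm) radical_inverse_rec) simp
      hence 0: "k mod p = 0" "radical_inverse p (k div p) = 0"
        using radical_inverse_bounds[of "k div p"] by (smt (verit) of_nat_0_le_iff of_nat_eq_0_iff add_nonneg_eq_0_iff)+
      hence "k div p > 0" using less.prems by (metis div_mult_mod_eq add_0_right gr0I mult_0)
      thus False using less.IH[of "k div p"] 0 less.prems p_gt_1[OF p] by simp
    qed
  qed
  show ?case
  proof (cases "m = 0")
    case True
    thus ?thesis using less.prems pos[of n] by (cases "n = 0") auto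
  next
    case False
    hence "m div p = n div p" using less.IH[OF _ dv] p_gt_1[OF p] by simp
    thus ?thesis using md by (metis div_mult_mod_eq)
  qed
qed

lemma radical_inverse_denom: "\<exists>k a. of_nat p ^ k * radical_inverse p n = of_int a"
proof (induction n rule: less_induct)
  case (less n)
  show ?case
  proof (cases "n = 0")
    case True thus ?thesis by (auto intro: exI[of _ 0])
  next
    case False
    then obtain k a where ka: "of_nat p ^ k * radical_inverse p (n div p) = of_int a"
      using less p_gt_1[OF p] by fastforce
    have "of_nat p ^ Suc k * radical_inverse p n
        = of_nat p ^ k * of_nat (n mod p) + of_nat p ^ k * radical_inverse p (n div p)"
      using p_gt_1[OF p] by (subst radical_inverse_rec) (simp add: field_simps)
    also have "\<dots> = of_int (int (p ^ k * (n mod p)) + a)" using ka by simp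
    finally show ?thesis by blast
  qed
qed

lemma radical_inverse_unique:
  assumes "padic_abs_rat p (radical_inverse p m - radical_inverse p n) \<le> 1" shows "m = n"
proof -
  define x where "x = radical_inverse p m - radical_inverse p n"
  obtain k a where ka: "of_nat p ^ k * radical_inverse p m = of_int a" using radical_inverse_denom by blast
  obtain l b where lb: "of_nat p ^ l * radical_inverse p n = of_int b" using radical_inverse_denom by blast
  have "of_nat p ^ (k + l) * x = of_nat p ^ l * (of_nat p ^ k * radical_inverse p m) - of_nat p ^ k * (of_nat p ^ l * radical_inverse p n)"
    by (simp add: x_def power_add algebra_simps)
  also have "\<dots> = of_int (int p ^ l * a - int p ^ k * b)" by (simp add: ka lb)
  finally obtain j c where c: "of_nat p ^ j * x = of_int c" by blast
  obtain u v where uv: "v > 0" "x = of_int u / of_int v" "\<not> int p dvd v"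
    using padic_abs_rat_le_1E[OF p] assms unfolding x_def by metis
  have "(of_int (int p ^ j * u) :: rat) = of_int (c * v)" using c uv by (simp add: field_simps)
  hence e: "int p ^ j * u = c * v" by linarith
  have "coprime (int p) v" using uv(3) prime_int_p[OF p] by (simp add: prime_imp_coprime)
  hence "coprime v (int p ^ j)" by (simp add: coprime_commute)
  hence "v dvd u" using e by (metis coprime_dvd_mult_right_iff dvd_triv_right)
  then obtain w where w: "x = of_int w" using uv by (auto elim!: dvdE)
  have "\<bar>x\<bar> < 1" using radical_inverse_bounds[of m] radical_inverse_bounds[of n] by (auto simp: x_def)
  hence "x = 0" using w by simp
  thus ?thesis using radical_inverse_inj by (simp add: x_def)
qed

lemma digit_exists:
  assumes "padic_abs_rat p y \<le> 1"
  shows "\<exists>d<p. padic_abs_rat p (of_nat d - y) \<le> 1 / real p"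
proof -
  obtain a b where ab: "b > 0" "y = of_int a / of_int b" "\<not> int p dvd b"
    using padic_abs_rat_le_1E[OF p assms] by metis
  have "coprime b (int p)" using prime_imp_coprime[OF prime_int_p[OF p] ab(3)] by (simp add: coprime_commute)
  then obtain u v where uv: "u * b + v * int p = 1"
    by (metis bezout_int coprime_imp_gcd_eq_1)
  define d where "d = nat ((a * u) mod int p)"
  have d: "int d = (a * u) mod int p" "d < p" using p_gt_1[OF p] by (auto simp: d_def nat_less_iff)
  have "int p dvd int d * b - a"
  proof -
    have "(int d * b) mod int p = (a * (u * b)) mod int p" unfolding d by (simp add: mod_mult_left_eq mult.assoc)
    hence "int p dvd int d * b - a * (u * b)" by (simp only: mod_eq_dvd_iff)
    moreover have "int d * b - a = (int d * b - a * (u * b)) + int p * (- a * v)"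
    proof -
      have e: "u * b = 1 - v * int p" using uv by simp
      show ?thesis unfolding e by (simp add: algebra_simps)
    qed
    ultimately show ?thesis by (metis dvd_add dvd_triv_left)
  qed
  then obtain c where c: "int d * b - a = int p * c" by (elim dvdE)
  have "of_nat d - y = of_int (int d * b - a) / of_int b" using ab by (simp add: field_simps)
  also have "\<dots> = of_nat p * of_int c * inverse (of_int b)" using c by (simp add: divide_inverse)
  finally have "padic_abs_rat p (of_nat d - y) = 1 / real p * padic_abs_rat p (of_int c)"
    using padic_abs_rat_unit[OF p ab(3)]
    by (simp add: padic_abs_rat_mult[OF p] padic_abs_rat_inverse[OF p] padic_abs_rat_p[OF p])
  also have "\<dots> \<le> 1 / real p" using padic_abs_rat_of_int[OF p, of c] p_gt_1[OF p] by (simp add: field_simps)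
  finally show ?thesis using d by blast
qed

lemma radical_inverse_exists:
  "padic_abs_rat p q \<le> real p ^ k \<Longrightarrow> \<exists>m. padic_abs_rat p (radical_inverse p m - q) \<le> 1"
proof (induction k arbitrary: q)
  case 0
  thus ?case by (intro exI[of _ 0]) (simp add: padic_abs_rat_minus[OF p])
next
  case (Suc k)
  have "padic_abs_rat p (of_nat p * q) \<le> real p ^ k"
    using Suc.prems p_gt_1[OF p] by (simp add: padic_abs_rat_mult[OF p] padic_abs_rat_p[OF p] field_simps)
  then obtain m where m: "padic_abs_rat p (radical_inverse p m - of_nat p * q) \<le> 1" using Suc.IH by blast
  hence "padic_abs_rat p (of_nat p * q - radical_inverse p m) \<le> 1"
    by (subst padic_abs_rat_minus_commute[OF p])
  then obtain d where d: "d < p" "padic_abs_rat p (of_nat d - (of_nat p * q - radical_inverse p m)) \<le> 1 / real p"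
    using digit_exists by blast
  define M where "M = d + p * m"
  have M: "M mod p = d" "M div p = m" using d by (auto simp: M_def)
  have "of_nat p * (radical_inverse p M - q) = of_nat d - (of_nat p * q - radical_inverse p m)"
    using p_gt_1[OF p] by (subst radical_inverse_rec) (simp add: M field_simps)
  hence "padic_abs_rat p (of_nat p * (radical_inverse p M - q)) \<le> 1 / real p" using d by simp
  hence "1 / real p * padic_abs_rat p (radical_inverse p M - q) \<le> 1 / real p"
    by (simp only: padic_abs_rat_mult[OF p] padic_abs_rat_p[OF p])
  thus ?case using p_gt_1[OF p] by (intro exI[of _ M]) (simp add: divide_le_cancel)
qed

lemma radical_inverse_ex1:
  "\<exists>!m. padic_abs_rat p (of_nat p powi n * radical_inverse p m - q) \<le> real p powi (- n)"
proof -
  define q' where "q' = of_nat p powi (- n) * q"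
  have nz: "(of_nat p :: rat) \<noteq> 0" "real p > 0" using p_gt_1[OF p] by auto
  have e: "padic_abs_rat p (of_nat p powi n * radical_inverse p m - q) \<le> real p powi (- n)
           \<longleftrightarrow> padic_abs_rat p (radical_inverse p m - q') \<le> 1" for m
  proof -
    have "of_nat p powi n * radical_inverse p m - q = of_nat p powi n * (radical_inverse p m - q')"
      using nz by (simp add: q'_def power_int_minus field_simps)
    thus ?thesis using nz by (simp add: padic_abs_rat_mult[OF p] padic_abs_rat_p_powi[OF p])
  qed
  obtain k where "padic_abs_rat p q' \<le> real p ^ k"
    using real_arch_pow[of "real p" "padic_abs_rat p q'"] p_gt_1[OF p] by (auto intro: less_imp_le)
  then obtain m where m: "padic_abs_rat p (radical_inverse p m - q') \<le> 1" using radical_inverse_exists by blast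
  show ?thesis unfolding e
  proof (rule ex1I[of _ m])
    fix m' assume m': "padic_abs_rat p (radical_inverse p m' - q') \<le> 1"
    have "padic_abs_rat p (radical_inverse p m' - radical_inverse p m) \<le> 1"
      using padic_abs_rat_diff_le[OF p, of "radical_inverse p m'" "radical_inverse p m" q'] m m'
      by (simp add: padic_abs_rat_minus_commute[OF p, of q'])
    thus "m' = m" by (rule radical_inverse_unique)
  qed (rule m)
qed

end

subsection \<open>The image of Lebesgue measure\<close>

definition padic_ball :: "nat \<Rightarrow> rat \<Rightarrow> int \<Rightarrow> padic set" where
  "padic_ball p q n = {x \<in> Qp p. padic_dist p x (padic_of_rat p q) \<le> real p powi (- n)}"

definition padic_balls :: "nat \<Rightarrow> padic set set" where
  "padic_balls p = insert {} (range (\<lambda>(q, n). padic_ball p q n))"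

definition monna_trunc :: "nat \<Rightarrow> real \<Rightarrow> int \<Rightarrow> rat" where
  "monna_trunc p t n = of_nat p powi n * radical_inverse p (nat \<lfloor>t * real p powi n\<rfloor>)"

text \<open>
  Reversing the digits in base \<open>p\<close> maps the half line onto the p-adic numbers; the Haar measure
  is the image of Lebesgue measure.
\<close>

definition monna_inv :: "nat \<Rightarrow> real \<Rightarrow> padic" where
  "monna_inv p t = padic_class p (\<lambda>n. monna_trunc p t (int n))"

context
  fixes p :: nat
  assumes p: "prime p"
begin

interpretation Metric_space "Qp p" "padic_dist p"
  by (rule Metric_space_Qp[OF p])

lemma powi_pos: "real p powi n > 0" using p_gt_1[OF p] by simp

lemma powi_small:
  assumes "e > 0" obtains n where "real p powi (- n) < e"
proof -
  obtain k where "(1 / real p) ^ k < e"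
    using real_arch_pow_inv[OF assms, of "1 / real p"] p_gt_1[OF p] by auto
  thus ?thesis using that[of "int k"] by (simp add: power_int_minus power_one_over inverse_eq_divide)
qed

lemma powi_big: obtains k :: nat where "x < real p powi (int k)"
  using real_arch_pow[of "real p" x] p_gt_1[OF p] by auto

lemma padic_ball_subset_or_disjoint:
  assumes "m \<le> n"
  shows "padic_ball p q n \<subseteq> padic_ball p r m \<or> padic_ball p q n \<inter> padic_ball p r m = {}"
proof -
  have le: "real p powi (- n) \<le> real p powi (- m)" using assms p_gt_1[OF p] by (intro power_int_increasing) auto
  have "x \<in> padic_ball p r m" if x: "x \<in> padic_ball p q n" and y: "y \<in> padic_ball p q n" "y \<in> padic_ball p r m" for x y
  proof -
    have Q: "x \<in> Qp p" "y \<in> Qp p" using x y by (auto simp: padic_ball_def)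
    have "padic_dist p x y \<le> max (padic_dist p x (padic_of_rat p q)) (padic_dist p (padic_of_rat p q) y)"
      by (rule padic_dist_ultra[OF p]) (use Q padic_of_rat_in[OF p] in auto)
    also have "\<dots> \<le> real p powi (- m)" using x y le by (auto simp: padic_ball_def commute)
    finally have "padic_dist p x y \<le> real p powi (- m)" .
    moreover have "padic_dist p x (padic_of_rat p r) \<le> max (padic_dist p x y) (padic_dist p y (padic_of_rat p r))"
      by (rule padic_dist_ultra[OF p]) (use Q padic_of_rat_in[OF p] in auto)
    ultimately show ?thesis using x y by (auto simp: padic_ball_def)
  qed
  thus ?thesis by blast
qed

lemma Int_stable_padic_balls: "Int_stable (padic_balls p)"
proof (rule Int_stableI)
  fix A B assume "A \<in> padic_balls p" "B \<in> padic_balls p"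
  then consider "A = {} \<or> B = {}" | q n r m where "A = padic_ball p q n" "B = padic_ball p r m"
    by (auto simp: padic_balls_def)
  thus "A \<inter> B \<in> padic_balls p"
  proof cases
    case 2
    have "A \<inter> B = A \<or> A \<inter> B = B \<or> A \<inter> B = {}"
      using padic_ball_subset_or_disjoint[of m n q r] padic_ball_subset_or_disjoint[of n m r q] 2
      by (cases "m \<le> n") auto
    thus ?thesis using \<open>A \<in> _\<close> \<open>B \<in> _\<close> by (auto simp: padic_balls_def)
  qed (auto simp: padic_balls_def)
qed

lemma countable_padic_balls: "countable (padic_balls p)"
  by (simp add: padic_balls_def)

lemma padic_balls_Pow: "padic_balls p \<subseteq> Pow (Qp p)"
  by (auto simp: padic_balls_def padic_ball_def)

lemma openin_padic_ball: "openin mtopology (padic_ball p q n)"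
  unfolding openin_mtopology
proof (intro conjI allI impI)
  show "padic_ball p q n \<subseteq> Qp p" by (auto simp: padic_ball_def)
  fix x assume x: "x \<in> padic_ball p q n"
  have "mball x (real p powi (- n)) \<subseteq> padic_ball p q n"
  proof
    fix y assume y: "y \<in> mball x (real p powi (- n))"
    have "padic_dist p y (padic_of_rat p q) \<le> max (padic_dist p y x) (padic_dist p x (padic_of_rat p q))"
      by (rule padic_dist_ultra[OF p]) (use x y padic_of_rat_in[OF p] in \<open>auto simp: padic_ball_def\<close>)
    thus "y \<in> padic_ball p q n" using x y by (auto simp: padic_ball_def commute)
  qed
  thus "\<exists>r>0. mball x r \<subseteq> padic_ball p q n" using powi_pos by blast
qed

lemma padic_ball_around:
  assumes "x \<in> Qp p" obtains q where "x \<in> padic_ball p q n"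
  using padic_dense[OF p assms powi_pos, of "- n"] assms by (auto simp: padic_ball_def intro: less_imp_le)

lemma openin_union_balls:
  assumes "openin mtopology U" shows "U = \<Union>{B \<in> padic_balls p. B \<subseteq> U}"
proof (intro equalityI subsetI)
  fix x assume x: "x \<in> U"
  have "U \<subseteq> Qp p" "\<exists>r>0. mball x r \<subseteq> U" using assms x unfolding openin_mtopology by simp_all
  with x obtain r where r: "r > 0" "mball x r \<subseteq> U" and xQ: "x \<in> Qp p" by blast
  obtain n where n: "real p powi (- n) < r" using powi_small[OF r(1)] .
  obtain q where q: "x \<in> padic_ball p q n" using padic_ball_around[OF xQ] .
  have "padic_ball p q n \<subseteq> mball x r"
  proof
    fix y assume y: "y \<in> padic_ball p q n"
    have "padic_dist p x y \<le> max (padic_dist p x (padic_of_rat p q)) (padic_dist p (padic_of_rat p q) y)"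
      by (rule padic_dist_ultra[OF p]) (use y q padic_of_rat_in[OF p] in \<open>auto simp: padic_ball_def\<close>)
    also have "\<dots> \<le> real p powi (- n)" using y q by (auto simp: padic_ball_def commute)
    finally show "y \<in> mball x r" using n y q by (auto simp: padic_ball_def)
  qed
  hence "padic_ball p q n \<in> {B \<in> padic_balls p. B \<subseteq> U}"
    using r(2) unfolding padic_balls_def by (intro CollectI conjI) (rule insertI2, rule range_eqI[of _ _ "(q, n)"], simp, rule order_trans)
  thus "x \<in> \<Union>{B \<in> padic_balls p. B \<subseteq> U}" using q by (rule UnionI)
next
  fix x assume "x \<in> \<Union>{B \<in> padic_balls p. B \<subseteq> U}"
  thus "x \<in> U" by blast
qed

lemma space_padic_borel [simp]: "space (padic_borel p) = Qp p"
  unfolding padic_borel_def by (rule space_measure_of) (auto simp: openin_mtopology)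

lemma sets_padic_borel: "sets (padic_borel p) = sigma_sets (Qp p) (padic_balls p)"
proof -
  have "sets (padic_borel p) = sigma_sets (Qp p) {U. openin mtopology U}"
    unfolding padic_borel_def by (rule sets_measure_of) (auto simp: openin_mtopology)
  also have "\<dots> = sigma_sets (Qp p) (padic_balls p)"
  proof (rule sigma_sets_eqI)
    fix U assume "U \<in> {U. openin mtopology U}"
    hence "\<Union>{B \<in> padic_balls p. B \<subseteq> U} = U" by (intro openin_union_balls[symmetric]) (rule CollectD)
    moreover have "\<Union>{B \<in> padic_balls p. B \<subseteq> U} \<in> sigma_sets (Qp p) (padic_balls p)"
      by (intro sigma_sets_UNION countable_subset[OF _ countable_padic_balls]) (auto intro: sigma_sets.Basic)
    ultimately show "U \<in> sigma_sets (Qp p) (padic_balls p)" by (simp only:)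
  next
    fix B assume "B \<in> padic_balls p"
    thus "B \<in> sigma_sets (Qp p) {U. openin mtopology U}"
      using openin_padic_ball by (auto simp: padic_balls_def)
  qed
  finally show ?thesis .
qed

lemma sets_padic_borel': "sets (padic_borel p) = sets (sigma (Qp p) (padic_balls p))"
  using sets_padic_borel padic_balls_Pow by simp

lemma padic_ball_sets [measurable]: "padic_ball p q n \<in> sets (padic_borel p)"
  unfolding sets_padic_borel by (rule sigma_sets.Basic) (auto simp: padic_balls_def)

lemma measurable_padic_borelI:
  assumes "\<And>x. x \<in> space M \<Longrightarrow> f x \<in> Qp p"
    and "\<And>q n. f -` padic_ball p q n \<inter> space M \<in> sets M"
  shows "f \<in> measurable M (padic_borel p)"
proof -
  have "f \<in> measurable M (sigma (Qp p) (padic_balls p))"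
  proof (rule measurable_measure_of)
    fix B assume "B \<in> padic_balls p"
    then consider "B = {}" | q n where "B = padic_ball p q n" by (auto simp: padic_balls_def)
    thus "f -` B \<inter> space M \<in> sets M" using assms(2) by cases simp_all
  qed (use assms(1) padic_balls_Pow in auto)
  thus ?thesis by (simp only: measurable_cong_sets[OF refl sets_padic_borel'])
qed

lemma monna_trunc_step:
  assumes "t \<ge> 0"
  shows "padic_abs_rat p (monna_trunc p t (n + 1) - monna_trunc p t n) \<le> real p powi (- n)"
proof -
  define m where "m = nat \<lfloor>t * real p powi (n + 1)\<rfloor>"
  have p0: "p > 0" using p_gt_1[OF p] by simp
  have "t * real p powi n = t * real p powi (n + 1) / of_int (int p)"
    using p0 by (subst power_int_add_1) auto
  hence "\<lfloor>t * real p powi n\<rfloor> = \<lfloor>t * real p powi (n + 1) / of_int (int p)\<rfloor>" by (rule arg_cong)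
  also have "\<dots> = \<lfloor>t * real p powi (n + 1)\<rfloor> div int p"
    by (rule floor_divide_real_eq_div) simp
  finally have md: "nat \<lfloor>t * real p powi n\<rfloor> = m div p"
    by (simp add: m_def nat_div_distrib')
  have "monna_trunc p t (n + 1) - monna_trunc p t n
         = of_nat p powi (n + 1) * ((of_nat (m mod p) + radical_inverse p (m div p)) / of_nat p)
            - of_nat p powi n * radical_inverse p (m div p)"
    unfolding monna_trunc_def m_def[symmetric] md by (subst radical_inverse_rec[OF p, of m]) (rule refl)
  also have "\<dots> = of_nat p powi n * of_int (int (m mod p))"
  proof -
    have "(of_nat p :: rat) powi (n + 1) = of_nat p powi n * of_nat p" using p0 by (subst power_int_add_1) auto
    moreover have "c * x * ((d + r) / x) - c * r = c * d" if "x \<noteq> 0" for c d r x :: rat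
      using that by (simp add: field_simps)
    ultimately show ?thesis using p0 by (simp only: of_int_of_nat_eq)
  qed
  finally show ?thesis
    using padic_abs_rat_of_int[OF p, of "int (m mod p)"] powi_pos[of "-n"]
    by (simp add: padic_abs_rat_mult[OF p] padic_abs_rat_p_powi[OF p] mult_left_le)
qed

lemma monna_trunc_chain:
  assumes "t \<ge> 0" "n \<le> m"
  shows "padic_abs_rat p (monna_trunc p t m - monna_trunc p t n) \<le> real p powi (- n)"
  using assms(2)
proof (induction m rule: int_ge_induct)
  case base
  show ?case using powi_pos[of "- n"] by (simp add: padic_abs_rat_0[OF p] less_imp_le)
next
  case (step m)
  have "real p powi (- m) \<le> real p powi (- n)"
    using step p_gt_1[OF p] by (intro power_int_increasing) auto
  thus ?case using step.IH monna_trunc_step[OF assms(1), of m]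
      padic_abs_rat_diff_le[OF p, of "monna_trunc p t (m + 1)" "monna_trunc p t n" "monna_trunc p t m"]
    by linarith
qed

lemma monna_trunc_Cauchy:
  assumes "t \<ge> 0" shows "(\<lambda>n. monna_trunc p t (int n)) \<in> padic_Cauchy p"
  unfolding padic_Cauchy_def
proof (intro CollectI allI impI)
  fix e :: real assume "e > 0"
  then obtain n where n: "real p powi (- n) < e" using powi_small by blast
  have "padic_abs_rat p (monna_trunc p t (int i) - monna_trunc p t (int j)) < e" if "i \<ge> nat n" "j \<ge> nat n" for i j
  proof -
    have ij: "n \<le> int i" "n \<le> int j" using that by linarith+
    show ?thesis
      using padic_abs_rat_diff_le[OF p, of "monna_trunc p t (int i)" "monna_trunc p t (int j)" "monna_trunc p t n"]
        monna_trunc_chain[OF assms ij(1)] monna_trunc_chain[OF assms ij(2)] n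
      by (simp add: padic_abs_rat_minus_commute[OF p, of "monna_trunc p t n"])
  qed
  thus "\<exists>N. \<forall>i\<ge>N. \<forall>j\<ge>N. padic_abs_rat p (monna_trunc p t (int i) - monna_trunc p t (int j)) < e" by blast
qed

lemma monna_inv_in: "t \<ge> 0 \<Longrightarrow> monna_inv p t \<in> Qp p"
  unfolding monna_inv_def by (intro padic_class_in[OF p] monna_trunc_Cauchy)

lemma monna_inv_ball_iff:
  assumes t: "t \<ge> 0"
  shows "monna_inv p t \<in> padic_ball p q n \<longleftrightarrow> padic_abs_rat p (monna_trunc p t n - q) \<le> real p powi (- n)"
proof -
  let ?X = "\<lambda>i. monna_trunc p t (int i)"
  have C: "?X \<in> padic_Cauchy p" using monna_trunc_Cauchy[OF t] .
  have "padic_dist p (monna_inv p t) (padic_of_rat p q) = padic_norm p (padic_class p (\<lambda>i. ?X i - q))"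
    using C monna_inv_in[OF t]
    by (simp add: padic_dist_def monna_inv_def padic_of_rat_def padic_diff_class[OF p] padic_Cauchy_const[OF p] padic_class_in[OF p])
  moreover have lim: "(\<lambda>i. padic_abs_rat p (?X i - q)) \<longlonglongrightarrow> padic_norm p (padic_class p (\<lambda>i. ?X i - q))"
    using C by (intro padic_norm_class[OF p] padic_Cauchy_diff[OF p] padic_Cauchy_const[OF p])
  ultimately have lim: "(\<lambda>i. padic_abs_rat p (?X i - q)) \<longlonglongrightarrow> padic_dist p (monna_inv p t) (padic_of_rat p q)"
    by simp
  have near: "padic_abs_rat p (?X i - monna_trunc p t n) \<le> real p powi (- n)" if "i \<ge> nat n" for i
    using monna_trunc_chain[OF t, of n "int i"] that by simp
  show ?thesis
  proof
    assume "monna_inv p t \<in> padic_ball p q n"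
    hence "padic_dist p (monna_inv p t) (padic_of_rat p q) \<le> real p powi (- n)" by (simp add: padic_ball_def)
    also have "\<dots> < real p powi (- n + 1)" using p_gt_1[OF p] by (intro power_int_strict_increasing) auto
    finally have "eventually (\<lambda>i. padic_abs_rat p (?X i - q) < real p powi (- n + 1)) sequentially"
      using lim order_tendstoD(2) by blast
    then obtain N where N: "\<forall>i\<ge>N. padic_abs_rat p (?X i - q) < real p powi (- n + 1)"
      by (auto simp: eventually_sequentially)
    define i where "i = max N (nat n)"
    have "padic_abs_rat p (?X i - q) \<le> real p powi (- n)"
      using N by (intro powi_less_Suc_imp_le[OF p]) (simp add: i_def)
    thus "padic_abs_rat p (monna_trunc p t n - q) \<le> real p powi (- n)"
      using near[of i] padic_abs_rat_diff_le[OF p, of "monna_trunc p t n" q "?X i"]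
      by (simp add: i_def padic_abs_rat_minus_commute[OF p, of "monna_trunc p t n"])
  next
    assume a: "padic_abs_rat p (monna_trunc p t n - q) \<le> real p powi (- n)"
    have "padic_abs_rat p (?X i - q) \<le> real p powi (- n)" if "i \<ge> nat n" for i
      using near[OF that] a padic_abs_rat_diff_le[OF p, of "?X i" q "monna_trunc p t n"] by linarith
    hence "padic_dist p (monna_inv p t) (padic_of_rat p q) \<le> real p powi (- n)"
      by (intro LIMSEQ_le_const2[OF lim]) blast
    thus "monna_inv p t \<in> padic_ball p q n" using monna_inv_in[OF t] by (simp add: padic_ball_def)
  qed
qed

lemma monna_inv_vimage:
  "\<exists>m. monna_inv p -` padic_ball p q n \<inter> {0..} = {real m / real p powi n ..< (real m + 1) / real p powi n}"
proof -
  obtain m where m: "\<And>j. padic_abs_rat p (of_nat p powi n * radical_inverse p j - q) \<le> real p powi (- n) \<longleftrightarrow> j = m"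
  proof -
    obtain m where "padic_abs_rat p (of_nat p powi n * radical_inverse p m - q) \<le> real p powi (- n)"
      "\<forall>j. padic_abs_rat p (of_nat p powi n * radical_inverse p j - q) \<le> real p powi (- n) \<longrightarrow> j = m"
      using radical_inverse_ex1[OF p, of n q] by (elim ex1E) (rule that)
    thus ?thesis by (intro that[of m]) blast
  qed
  have "monna_inv p t \<in> padic_ball p q n \<longleftrightarrow> real m / real p powi n \<le> t \<and> t < (real m + 1) / real p powi n"
    if t: "t \<ge> 0" for t
  proof -
    have "monna_inv p t \<in> padic_ball p q n \<longleftrightarrow> nat \<lfloor>t * real p powi n\<rfloor> = m"
      unfolding monna_inv_ball_iff[OF t] monna_trunc_def m by simp
    also have "\<dots> \<longleftrightarrow> \<lfloor>t * real p powi n\<rfloor> = int m"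
    proof -
      have "\<lfloor>t * real p powi n\<rfloor> \<ge> 0" using t powi_pos[of n] by simp
      thus ?thesis by linarith
    qed
    also have "\<dots> \<longleftrightarrow> real m / real p powi n \<le> t \<and> t < (real m + 1) / real p powi n"
      unfolding floor_eq_iff pos_divide_le_eq[OF powi_pos] pos_less_divide_eq[OF powi_pos] by simp
    finally show ?thesis .
  qed
  moreover have "t \<ge> 0" if "real m / real p powi n \<le> t" for t
  proof -
    have "0 \<le> real m / real p powi n" using powi_pos[of n] by simp
    thus ?thesis using that by linarith
  qed
  ultimately have "t \<in> monna_inv p -` padic_ball p q n \<inter> {0..}
      \<longleftrightarrow> t \<in> {real m / real p powi n ..< (real m + 1) / real p powi n}" for t
    unfolding Int_iff vimage_eq atLeast_iff atLeastLessThan_iff by blast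
  thus ?thesis by blast
qed

definition haar0 :: "padic measure" where
  "haar0 = distr (restrict_space lborel {0..}) (padic_borel p) (monna_inv p)"

lemma monna_inv_measurable: "monna_inv p \<in> measurable (restrict_space lborel {0..}) (padic_borel p)"
proof (rule measurable_padic_borelI)
  fix q n
  obtain m where "monna_inv p -` padic_ball p q n \<inter> {0..} = {real m / real p powi n ..< (real m + 1) / real p powi n}"
    using monna_inv_vimage by blast
  thus "monna_inv p -` padic_ball p q n \<inter> space (restrict_space lborel {0..}) \<in> sets (restrict_space lborel {0..})"
    by (auto simp: sets_restrict_space_iff space_restrict_space)
qed (auto simp: space_restrict_space monna_inv_in)

lemma emeasure_haar0_ball: "emeasure haar0 (padic_ball p q n) = ennreal (real p powi (- n))"
proof -
  obtain m where m: "monna_inv p -` padic_ball p q n \<inter> {0..} = {real m / real p powi n ..< (real m + 1) / real p powi n}"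
    using monna_inv_vimage by blast
  have "emeasure haar0 (padic_ball p q n)
        = emeasure (restrict_space lborel {0..}) (monna_inv p -` padic_ball p q n \<inter> {0..})"
    unfolding haar0_def using monna_inv_measurable
    by (subst emeasure_distr) (auto simp: space_restrict_space padic_ball_sets)
  also have "\<dots> = emeasure lborel {real m / real p powi n ..< (real m + 1) / real p powi n}"
    using m by (subst emeasure_restrict_space) auto
  also have "\<dots> = ennreal (real p powi (- n))"
    using powi_pos[of n] by (simp add: divide_right_mono power_int_minus diff_divide_distrib[symmetric] inverse_eq_divide)
  finally show ?thesis .
qed

lemma vimage_translate_ball:
  assumes "a \<in> Qp p" shows "\<exists>r. padic_add p a -` padic_ball p q n \<inter> Qp p = padic_ball p r n"
proof -
  obtain b where b: "b \<in> Qp p" "\<And>x. x \<in> Qp p \<Longrightarrow> padic_add p a (padic_add p b x) = x"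
    "\<And>x. x \<in> Qp p \<Longrightarrow> padic_add p b (padic_add p a x) = x"
    using padic_add_inverse[OF p assms] by blast
  define c where "c = padic_add p b (padic_of_rat p q)"
  have c: "c \<in> Qp p" "padic_add p a c = padic_of_rat p q"
    using b padic_add_in[OF p] padic_of_rat_in[OF p] by (auto simp: c_def)
  have d: "padic_dist p (padic_add p a x) (padic_of_rat p q) = padic_dist p x c" if "x \<in> Qp p" for x
    using padic_add_dist_cancel[OF p assms that c(1)] c(2) by simp
  obtain r where r: "c \<in> padic_ball p r n" using padic_ball_around[OF c(1)] .
  have "padic_dist p x c \<le> real p powi (- n) \<longleftrightarrow> padic_dist p x (padic_of_rat p r) \<le> real p powi (- n)"
    if "x \<in> Qp p" for x
    using padic_dist_ultra[OF p that c(1) padic_of_rat_in[OF p, of r]]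
      padic_dist_ultra[OF p that padic_of_rat_in[OF p, of r] c(1)] r
    by (auto simp: padic_ball_def commute[of "padic_of_rat p r"])
  hence "padic_add p a -` padic_ball p q n \<inter> Qp p = padic_ball p r n"
    using d padic_add_in[OF p assms] by (auto simp: padic_ball_def)
  thus ?thesis by blast
qed

lemma translate_measurable:
  assumes "a \<in> Qp p" shows "padic_add p a \<in> measurable (padic_borel p) (padic_borel p)"
proof (rule measurable_padic_borelI)
  fix q n
  show "padic_add p a -` padic_ball p q n \<inter> space (padic_borel p) \<in> sets (padic_borel p)"
    using vimage_translate_ball[OF assms, of q n] padic_ball_sets by auto
qed (auto simp: padic_add_in[OF p] assms)

lemma distr_haar0:
  assumes "a \<in> Qp p" shows "distr haar0 (padic_borel p) (padic_add p a) = haar0"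
proof (rule measure_eqI_generator_eq[where E = "padic_balls p" and \<Omega> = "Qp p" and A = "\<lambda>i. padic_ball p 0 (- int i)"])
  have s: "sets haar0 = sets (padic_borel p)" "space haar0 = Qp p" by (auto simp: haar0_def)
  have b: "emeasure (distr haar0 (padic_borel p) (padic_add p a)) (padic_ball p q n) = ennreal (real p powi (- n))" for q n
  proof -
    obtain r where "padic_add p a -` padic_ball p q n \<inter> Qp p = padic_ball p r n"
      using vimage_translate_ball[OF assms] by blast
    thus ?thesis using translate_measurable[OF assms] measurable_cong_sets[OF s(1) refl] s
      by (subst emeasure_distr) (auto simp: padic_ball_sets emeasure_haar0_ball)
  qed
  show "emeasure (distr haar0 (padic_borel p) (padic_add p a)) X = emeasure haar0 X" if "X \<in> padic_balls p" for X
    using that b by (auto simp: padic_balls_def emeasure_haar0_ball)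
  show "emeasure (distr haar0 (padic_borel p) (padic_add p a)) (padic_ball p 0 (- int i)) \<noteq> \<infinity>" for i
    by (simp add: b)
  show "sets (distr haar0 (padic_borel p) (padic_add p a)) = sigma_sets (Qp p) (padic_balls p)"
    by (simp add: sets_padic_borel)
  show "sets haar0 = sigma_sets (Qp p) (padic_balls p)" by (simp add: s sets_padic_borel)
  show "range (\<lambda>i. padic_ball p 0 (- int i)) \<subseteq> padic_balls p" by (auto simp: padic_balls_def)
  show "(\<Union>i. padic_ball p 0 (- int i)) = Qp p"
  proof (intro equalityI subsetI)
    fix x assume x: "x \<in> Qp p"
    obtain k :: nat where "padic_dist p x (padic_of_rat p 0) < real p powi (int k)" using powi_big .
    thus "x \<in> (\<Union>i. padic_ball p 0 (- int i))" using x by (auto simp: padic_ball_def intro!: exI[of _ k])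
  qed (auto simp: padic_ball_def)
qed (use Int_stable_padic_balls padic_balls_Pow in auto)

lemma Zp_eq_ball: "Zp p = padic_ball p 0 0"
proof -
  have "padic_dist p x (padic_of_rat p 0) = padic_norm p x" if x: "x \<in> Qp p" for x
  proof -
    obtain X where "X \<in> padic_Cauchy p" "x = padic_class p X" using QpE[OF p x] .
    thus ?thesis using padic_of_rat_in[OF p, of 0] x
      by (simp add: padic_dist_def padic_of_rat_def padic_diff_class[OF p] padic_Cauchy_const[OF p])
  qed
  thus ?thesis by (auto simp: Zp_def padic_ball_def)
qed

lemma is_padic_haar_haar0: "is_padic_haar p haar0"
  unfolding is_padic_haar_def
proof (intro conjI ballI)
  show s: "space haar0 = Qp p" "sets haar0 = sets (padic_borel p)" by (auto simp: haar0_def)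
  show "emeasure haar0 (Zp p) = 1" by (simp add: Zp_eq_ball emeasure_haar0_ball)
  fix a A assume a: "a \<in> Qp p" and A: "A \<in> sets haar0"
  obtain b where b: "b \<in> Qp p" "\<And>x. x \<in> Qp p \<Longrightarrow> padic_add p a (padic_add p b x) = x"
    "\<And>x. x \<in> Qp p \<Longrightarrow> padic_add p b (padic_add p a x) = x"
    using padic_add_inverse[OF p a] by blast
  have AQ: "A \<subseteq> Qp p" using sets.sets_into_space[OF A] s by simp
  have "padic_add p a ` A = padic_add p b -` A \<inter> Qp p"
  proof (intro equalityI subsetI)
    fix x assume "x \<in> padic_add p b -` A \<inter> Qp p"
    thus "x \<in> padic_add p a ` A" using b(2)[of x] by (auto intro!: image_eqI[of x _ "padic_add p b x"])
  qed (use AQ b a padic_add_in[OF p] in auto)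
  hence "emeasure haar0 (padic_add p a ` A) = emeasure (distr haar0 (padic_borel p) (padic_add p b)) A"
    using translate_measurable[OF b(1)] measurable_cong_sets[OF s(2) refl] s A
    by (subst emeasure_distr) auto
  thus "emeasure haar0 (padic_add p a ` A) = emeasure haar0 A" using distr_haar0[OF b(1)] by simp
qed

lemma is_padic_haar_padic_haar: "is_padic_haar p (padic_haar p)"
  unfolding padic_haar_def using is_padic_haar_haar0 by (rule someI)

end

end

theory Submission
  imports Defs
begin

text \<open>
  Write \<open>P\<close> for \<open>p\<close> as a real number and \<open>u\<^sub>j\<close> for the value of a radial function on the sphere
  \<open>|x| = P^j\<close>. Where \<open>|y| = |x|\<close> the numerator \<open>f(y) - f(x)\<close> vanishes, and
  elsewhere \<open>|x - y|\<close> is the larger of the two norms, so the integral defining \<open>D\<^sup>2\<close> is a sum over spheres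
  (\<open>haar_radial_integral\<close>, \<open>vladimirov_radial\<close>). It depends only on \<open>u\<^sub>m\<close>, on the sum \<open>I\<^sub>m\<close> of
  \<open>u\<^sub>j P^j\<close> over \<open>j \<le> m\<close>, and on the sum \<open>T\<^sub>m\<close> of \<open>u\<^sub>j P^(-2j)\<close> over \<open>j > m\<close>
  (\<open>vladimirov_at_level\<close>, \<open>vladimirov_at_zero\<close>).

  For the function of the theorem these sums have closed forms, because every power of \<open>|x|\<close>
  contributes a geometric series. Each power \<open>|x|^s\<close> is thereby multiplied by
  \<open>\<Gamma>\<^sub>p(s + 1) / \<Gamma>\<^sub>p(s - 1)\<close> and lowered by two, and the two recursions say that the
  equation holds power by power. The recursions leave one power on either side: the constant term inside
  the unit ball, to which the part of the integral outside contributes, and \<open>|x|^(-3)\<close> outside,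
  to which the part inside contributes. Comparing these coefficients gives two conditions, which match
  the closed forms of \<open>T\<close> and \<open>I\<close> at the unit sphere. With \<open>c\<^sub>0 = 1\<close> the condition outside
  determines \<open>k\<^sub>5\<close> (\<open>outer_amp\<close>), and the one inside becomes a fixed point equation
  \<open>E = level P E\<close>.

  The right-hand side is easy to control for \<open>1 \<le> E \<le> 3\<close>, uniformly in \<open>E\<close>. The factor in
  front of \<open>D\<^sup>2\<close> is of size \<open>P^2\<close>. The constant \<open>c\<^sub>0\<close>, integrated against the kernel outside the
  unit ball, contributes \<open>1 - 1/P + O(P^(-2))\<close>; the coefficient \<open>c\<^sub>4\<close>, which is
  \<open>- P^(-2) + O(P^(-4))\<close> for every \<open>E\<close>, contributes the same amount; all other terms are \<open>O(P^(-2))\<close>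
  (\<open>level_estimate\<close>). So \<open>level P\<close> is a continuous map of the interval from 1 to 3 into itself for
  large \<open>P\<close>, and every fixed point in it is \<open>2 - 2/P + O(P^(-2))\<close> (\<open>level_fixed_point\<close>).
\<close>

section \<open>Haar measure of spheres\<close>

context
  fixes p :: nat
  assumes p: "prime p"
begin

interpretation Metric_space "Qp p" "padic_dist p"
  by (rule Metric_space_Qp[OF p])

lemma padic_dist_of_rat:
  "padic_dist p (padic_of_rat p a) (padic_of_rat p b) = padic_abs_rat p (a - b)"
  using padic_of_rat_in[OF p] padic_norm_of_rat[OF p, of "a - b"]
  by (simp add: padic_dist_def padic_of_rat_def padic_diff_class[OF p] padic_Cauchy_const[OF p])

lemma padic_dist_zero:
  assumes "x \<in> Qp p" shows "padic_dist p x (padic_of_rat p 0) = padic_norm p x"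
proof -
  obtain X where "X \<in> padic_Cauchy p" "x = padic_class p X" using QpE[OF p assms] .
  thus ?thesis using padic_of_rat_in[OF p, of 0] assms
    by (simp add: padic_dist_def padic_of_rat_def padic_diff_class[OF p] padic_Cauchy_const[OF p])
qed

lemma padic_ball_zero_iff:
  "x \<in> padic_ball p 0 n \<longleftrightarrow> x \<in> Qp p \<and> padic_norm p x \<le> real p powi (- n)"
  using padic_dist_zero by (auto simp: padic_ball_def)

text \<open>
  Every point of an ultrametric ball is a centre. Membership in balls thereby becomes a question
  about rational centres, where the digits in base \<open>p\<close> are at hand.
\<close>

lemma padic_ball_recentre:
  assumes "x \<in> padic_ball p r k" "n \<le> k"
  shows "x \<in> padic_ball p q n \<longleftrightarrow> padic_abs_rat p (r - q) \<le> real p powi (- n)"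
proof -
  have x: "x \<in> Qp p" using assms by (simp add: padic_ball_def)
  have "real p powi (- k) \<le> real p powi (- n)"
    using assms(2) p_gt_1[OF p] by (intro power_int_increasing) auto
  hence d: "padic_dist p x (padic_of_rat p r) \<le> real p powi (- n)"
    using assms(1) by (simp add: padic_ball_def)
  show ?thesis
    using padic_dist_ultra[OF p x padic_of_rat_in[OF p, of r] padic_of_rat_in[OF p, of q]]
      padic_dist_ultra[OF p padic_of_rat_in[OF p, of r] x padic_of_rat_in[OF p, of q]] x d
    by (auto simp: padic_ball_def padic_dist_of_rat commute[of "padic_of_rat p r" x])
qed

lemma powi_less_iff: "real p powi a < real p powi b \<longleftrightarrow> a < b"
proof -
  have less: "real p powi c < real p powi d" if "c < d" for c d
    using that p_gt_1[OF p] by (intro power_int_strict_increasing) auto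
  show ?thesis using less[of a b] less[of b a] by (cases a b rule: linorder_cases) auto
qed

lemma powi_le_iff: "real p powi a \<le> real p powi b \<longleftrightarrow> a \<le> b"
  using powi_less_iff[of b a] by linarith

lemma powi_minus_Suc: "real p powi (- (k + 1)) = real p powi (- k) / real p"
proof -
  have "real p powi (- k - 1) = real p powi (- k) / real p powi 1"
    using p_gt_1[OF p] by (intro power_int_diff) auto
  moreover have "- (k + 1) = - k - 1" by simp
  ultimately show ?thesis by (simp only: power_int_1_right)
qed

text \<open>
  Rescaling by \<open>p^n\<close> turns the choice among the balls of the next smaller radius into the choice of a
  residue modulo \<open>p\<close>. The existence of a digit then gives the decomposition \<open>padic_ball_split\<close>;
  two distinct digits differ by a unit, so the pieces are disjoint.
\<close>

lemma padic_ball_digit_iff: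
  assumes "x \<in> padic_ball p r (n + 1)"
  shows "x \<in> padic_ball p (q + of_nat d * of_nat p powi n) (n + 1)
           \<longleftrightarrow> padic_abs_rat p (of_nat d - (r - q) * of_nat p powi (- n)) \<le> 1 / real p"
proof -
  have p0: "real p > 0" "(of_nat p :: rat) \<noteq> 0" using p_gt_1[OF p] by auto
  have "r - (q + of_nat d * of_nat p powi n)
          = - (of_nat p powi n * (of_nat d - (r - q) * of_nat p powi (- n)))"
    using p0 by (simp add: power_int_minus field_simps)
  hence "padic_abs_rat p (r - (q + of_nat d * of_nat p powi n))
      = real p powi (- n) * padic_abs_rat p (of_nat d - (r - q) * of_nat p powi (- n))"
    by (simp add: padic_abs_rat_minus[OF p] padic_abs_rat_mult[OF p] padic_abs_rat_p_powi[OF p])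
  moreover have "real p powi (- (n + 1)) = real p powi (- n) * (1 / real p)"
    by (simp only: powi_minus_Suc) simp
  ultimately show ?thesis using p0 powi_pos[OF p, of "- n"]
    unfolding padic_ball_recentre[OF assms order_refl] by (simp only: mult_le_cancel_left_pos)
qed

lemma padic_ball_split:
  "padic_ball p q n = (\<Union>d<p. padic_ball p (q + of_nat d * of_nat p powi n) (n + 1))"
proof (intro set_eqI)
  fix x
  show "x \<in> padic_ball p q n \<longleftrightarrow> x \<in> (\<Union>d<p. padic_ball p (q + of_nat d * of_nat p powi n) (n + 1))"
  proof (cases "x \<in> Qp p")
    case True
    then obtain r where r: "x \<in> padic_ball p r (n + 1)" by (rule padic_ball_around[OF p])
    define y where "y = (r - q) * of_nat p powi (- n)"
    have "padic_abs_rat p y = padic_abs_rat p (r - q) / real p powi (- n)"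
      unfolding y_def padic_abs_rat_mult[OF p] padic_abs_rat_p_powi[OF p] by (simp add: power_int_minus field_simps)
    hence "x \<in> padic_ball p q n \<longleftrightarrow> padic_abs_rat p y \<le> 1"
      using padic_ball_recentre[OF r, of n q] powi_pos[OF p, of "- n"] by (simp only: pos_divide_le_eq mult_1)
    also have "\<dots> \<longleftrightarrow> (\<exists>d<p. padic_abs_rat p (of_nat d - y) \<le> 1 / real p)"
    proof
      assume "\<exists>d<p. padic_abs_rat p (of_nat d - y) \<le> 1 / real p"
      then obtain d where d: "padic_abs_rat p (of_nat d - y) \<le> 1 / real p" by blast
      have "1 / real p \<le> 1" using p_gt_1[OF p] by simp
      with d have "padic_abs_rat p (of_nat d - y) \<le> 1" by linarith
      moreover have "padic_abs_rat p (of_nat d) \<le> 1" using padic_abs_rat_of_int[OF p, of "int d"] by simp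
      ultimately show "padic_abs_rat p y \<le> 1"
        using padic_abs_rat_diff_le'[OF p, of "of_nat d" "of_nat d - y"] by simp
    qed (use digit_exists[OF p] in blast)
    finally show ?thesis unfolding UN_iff Bex_def lessThan_iff padic_ball_digit_iff[OF r] y_def by blast
  qed (auto simp: padic_ball_def)
qed

lemma disjoint_padic_ball_digits:
  "disjoint_family_on (\<lambda>d. padic_ball p (q + of_nat d * of_nat p powi n) (n + 1)) {..<p}"
unfolding disjoint_family_on_def
proof (intro ballI impI, rule ccontr)
  fix d e assume de: "d \<in> {..<p}" "e \<in> {..<p}" "d \<noteq> e"
  assume "padic_ball p (q + of_nat d * of_nat p powi n) (n + 1) \<inter> padic_ball p (q + of_nat e * of_nat p powi n) (n + 1) \<noteq> {}"
  then obtain x where x: "x \<in> padic_ball p (q + of_nat d * of_nat p powi n) (n + 1)"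
      "x \<in> padic_ball p (q + of_nat e * of_nat p powi n) (n + 1)" by blast
  have "x \<in> Qp p" using x by (simp add: padic_ball_def)
  then obtain r where r: "x \<in> padic_ball p r (n + 1)" by (rule padic_ball_around[OF p])
  have "padic_abs_rat p (of_int (int d - int e)) \<le> 1 / real p"
    using padic_abs_rat_diff_le[OF p, of "of_nat d" "of_nat e" "(r - q) * of_nat p powi (- n)"]
      x[unfolded padic_ball_digit_iff[OF r]]
    by (simp add: padic_abs_rat_minus_commute[OF p, of "_ * _" "of_nat e"])
  also have "\<dots> < 1" using p_gt_1[OF p] by simp
  finally have "int p dvd int d - int e" using padic_abs_rat_unit[OF p, of "int d - int e"] by fastforce
  moreover have "\<bar>int d - int e\<bar> < int p" "int d - int e \<noteq> 0" using de by auto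
  ultimately show False using zdvd_imp_le[of "int p" "\<bar>int d - int e\<bar>"] by auto
qed

lemma padic_ball_translate:
  "padic_add p (padic_of_rat p q) ` padic_ball p 0 n = padic_ball p q n"
proof -
  have a: "padic_of_rat p q \<in> Qp p" by (rule padic_of_rat_in[OF p])
  have z: "padic_add p (padic_of_rat p q) (padic_of_rat p 0) = padic_of_rat p q"
    by (simp add: padic_of_rat_def padic_add_class[OF p] padic_Cauchy_const[OF p])
  have d: "padic_dist p (padic_add p (padic_of_rat p q) x) (padic_of_rat p q) = padic_dist p x (padic_of_rat p 0)"
    if "x \<in> Qp p" for x
    using padic_add_dist_cancel[OF p a that padic_of_rat_in[OF p, of 0]] z by simp
  obtain b where b: "b \<in> Qp p" "\<And>x. x \<in> Qp p \<Longrightarrow> padic_add p (padic_of_rat p q) (padic_add p b x) = x"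
    using padic_add_inverse[OF p a] by metis
  show ?thesis
  proof (intro equalityI subsetI)
    fix x assume x: "x \<in> padic_ball p q n"
    hence xQ: "x \<in> Qp p" by (simp add: padic_ball_def)
    have "padic_add p b x \<in> padic_ball p 0 n"
      using x d[of "padic_add p b x"] b padic_add_in[OF p b(1) xQ] xQ by (simp add: padic_ball_def)
    thus "x \<in> padic_add p (padic_of_rat p q) ` padic_ball p 0 n"
      using b(2)[OF xQ] by (intro image_eqI[of x _ "padic_add p b x"]) auto
  qed (auto simp: padic_ball_def d padic_add_in[OF p a])
qed

lemma haar_space [simp]: "space (padic_haar p) = Qp p"
  and haar_sets: "sets (padic_haar p) = sets (padic_borel p)"
  and haar_translate: "a \<in> Qp p \<Longrightarrow> A \<in> sets (padic_borel p)
        \<Longrightarrow> emeasure (padic_haar p) (padic_add p a ` A) = emeasure (padic_haar p) A"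
  and haar_Zp: "emeasure (padic_haar p) (Zp p) = 1"
  using is_padic_haar_padic_haar[OF p] by (auto simp: is_padic_haar_def)

text \<open>
  The defining properties of the Haar measure suffice: by translation invariance balls of equal radius have
  equal measure, and a ball consists of \<open>p\<close> balls of the next smaller radius. Induction starts at the
  ring of integers and runs in both directions.
\<close>

lemma emeasure_haar_ball: "emeasure (padic_haar p) (padic_ball p q n) = ennreal (real p powi (- n))"
proof -
  have p0: "real p > 0" using p_gt_1[OF p] by simp
  have sets: "padic_ball p r k \<in> sets (padic_haar p)" for r k
    by (simp add: haar_sets padic_ball_sets[OF p])
  have centre: "emeasure (padic_haar p) (padic_ball p r k) = emeasure (padic_haar p) (padic_ball p 0 k)" for r k
    using haar_translate[OF padic_of_rat_in[OF p] padic_ball_sets[OF p], of r 0 k] by (simp add: padic_ball_translate)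
  have split: "emeasure (padic_haar p) (padic_ball p 0 k)
      = ennreal (real p) * emeasure (padic_haar p) (padic_ball p 0 (k + 1))" for k
  proof -
    have "emeasure (padic_haar p) (padic_ball p 0 k)
        = (\<Sum>d<p. emeasure (padic_haar p) (padic_ball p (0 + of_nat d * of_nat p powi k) (k + 1)))"
      unfolding padic_ball_split[of 0 k]
      by (rule sum_emeasure[symmetric]) (use sets disjoint_padic_ball_digits[of 0 k] in auto)
    also have "\<dots> = of_nat p * emeasure (padic_haar p) (padic_ball p 0 (k + 1))"
      by (subst centre) simp
    finally show ?thesis by (simp add: ennreal_of_nat_eq_real_of_nat)
  qed
  have "emeasure (padic_haar p) (padic_ball p 0 n) = ennreal (real p powi (- n))"
  proof (induction n rule: int_induct[of _ 0])
    case base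
    show ?case using haar_Zp by (simp add: Zp_eq_ball[OF p])
  next
    case (step1 k)
    have "ennreal (real p) * emeasure (padic_haar p) (padic_ball p 0 (k + 1)) = ennreal (real p powi (- k))"
      using split[of k] step1 by simp
    also have "real p powi (- k) = real p * real p powi (- (k + 1))"
      using p0 by (simp only: powi_minus_Suc) simp
    also have "ennreal \<dots> = ennreal (real p) * ennreal (real p powi (- (k + 1)))"
      using p0 by (simp add: ennreal_mult)
    finally have "ennreal (real p) * emeasure (padic_haar p) (padic_ball p 0 (k + 1))
        = ennreal (real p) * ennreal (real p powi (- (k + 1)))" .
    thus ?case using p0 unfolding ennreal_mult_cancel_left by (auto simp: ennreal_eq_0_iff)
  next
    case (step2 k)
    have "real p powi (- (k - 1)) = real p * real p powi (- k)"
      using p0 by (simp add: power_int_minus power_int_diff field_simps)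
    thus ?case using split[of "k - 1"] step2 p0 by (simp add: ennreal_mult)
  qed
  thus ?thesis using centre[of q n] by simp
qed

text \<open>
  A nonzero \<open>x\<close> has the same norm as every rational at distance less than \<open>|x|\<close> from it, so the norm
  takes only the values that it takes on the rationals.
\<close>

lemma padic_norm_cases:
  assumes "x \<in> Qp p"
  obtains "padic_norm p x = 0" | m where "padic_norm p x = real p powi m"
proof (cases "padic_norm p x = 0")
  case False
  hence "padic_norm p x > 0" using padic_norm_nonneg[OF p assms] by simp
  then obtain n where n: "real p powi (- n) < padic_norm p x" by (rule powi_small[OF p])
  obtain r where r: "x \<in> padic_ball p r n" using assms by (rule padic_ball_around[OF p])
  have r0: "padic_dist p (padic_of_rat p r) (padic_of_rat p 0) = padic_abs_rat p r"
    using padic_dist_of_rat[of r 0] by simp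
  have "padic_norm p x = padic_abs_rat p r"
    using padic_dist_ultra[OF p assms padic_of_rat_in[OF p, of r] padic_of_rat_in[OF p, of 0]]
      padic_dist_ultra[OF p padic_of_rat_in[OF p, of r] assms padic_of_rat_in[OF p, of 0]] n r
    by (auto simp: padic_ball_def padic_dist_zero assms r0 commute[of "padic_of_rat p r" x])
  thus ?thesis using False that by (auto simp: padic_abs_rat_def split: if_splits)
qed (use that in blast)

text \<open>
  For fixed \<open>x\<close> the kernel \<open>|x - y|^(-3)\<close> is therefore a function of \<open>|y|\<close> off the sphere
  \<open>|y| = |x|\<close>.
\<close>

lemma padic_norm_diff:
  assumes "x \<in> Qp p" "y \<in> Qp p" "padic_norm p x \<noteq> padic_norm p y"
  shows "padic_norm p (padic_diff p x y) = max (padic_norm p x) (padic_norm p y)"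
proof -
  have "padic_dist p x y = max (padic_norm p x) (padic_norm p y)"
    using padic_dist_ultra[OF p assms(1,2) padic_of_rat_in[OF p, of 0]]
      padic_dist_ultra[OF p assms(1) padic_of_rat_in[OF p, of 0] assms(2)]
      padic_dist_ultra[OF p assms(2,1) padic_of_rat_in[OF p, of 0]] assms
    by (auto simp: padic_dist_zero commute[of "padic_of_rat p 0" y] commute[of y x])
  thus ?thesis using assms by (simp add: padic_dist_def)
qed

text \<open>
  The value 0 belongs to this countable set, so that the norm maps all of the p-adic numbers into it and
  no null set has to be discarded; its weight in \<open>distr_haar_norm\<close> is 0.
\<close>

definition norm_values :: "real set" where
  "norm_values = insert 0 (range (\<lambda>m. real p powi m))"

lemma emeasure_haar_sphere:
  assumes "t \<in> norm_values"
  shows "{x \<in> Qp p. padic_norm p x = t} \<in> sets (padic_haar p)"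
    and "emeasure (padic_haar p) {x \<in> Qp p. padic_norm p x = t} = ennreal ((1 - 1 / real p) * t)"
proof -
  have sets: "padic_ball p 0 k \<in> sets (padic_haar p)" for k
    by (simp add: haar_sets padic_ball_sets[OF p])
  consider "t = 0" | m where "t = real p powi m" using assms by (auto simp: norm_values_def)
  hence "{x \<in> Qp p. padic_norm p x = t} \<in> sets (padic_haar p) \<and>
    emeasure (padic_haar p) {x \<in> Qp p. padic_norm p x = t} = ennreal ((1 - 1 / real p) * t)"
  proof cases
    case 1
    have eq: "{x \<in> Qp p. padic_norm p x = 0} = (\<Inter>n::int. padic_ball p 0 n)"
    proof (intro equalityI subsetI)
      fix x assume x: "x \<in> (\<Inter>n::int. padic_ball p 0 n)"
      hence xQ: "x \<in> Qp p" by (auto simp: padic_ball_def)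
      have "padic_norm p x \<le> 0"
      proof (rule ccontr)
        assume "\<not> padic_norm p x \<le> 0"
        then obtain n where "real p powi (- n) < padic_norm p x" using powi_small[OF p] by (metis not_le)
        moreover have "x \<in> padic_ball p 0 n" using x by blast
        ultimately show False by (simp add: padic_ball_zero_iff)
      qed
      thus "x \<in> {x \<in> Qp p. padic_norm p x = 0}" using xQ padic_norm_nonneg[OF p xQ] by simp
    qed (use powi_pos[OF p] in \<open>auto simp: padic_ball_zero_iff less_imp_le\<close>)
    have s: "{x \<in> Qp p. padic_norm p x = 0} \<in> sets (padic_haar p)"
      unfolding eq using sets by (intro sets.countable_INT) auto
    have le: "emeasure (padic_haar p) {x \<in> Qp p. padic_norm p x = 0} \<le> ennreal e" if "e > 0" for e
    proof -
      obtain n where "real p powi (- n) < e" using \<open>e > 0\<close> by (rule powi_small[OF p])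
      moreover have "emeasure (padic_haar p) {x \<in> Qp p. padic_norm p x = 0} \<le> emeasure (padic_haar p) (padic_ball p 0 n)"
        unfolding eq by (intro emeasure_mono sets) auto
      ultimately show ?thesis
        using ennreal_leI[of "real p powi (- n)" e] by (simp add: emeasure_haar_ball)
    qed
    have "emeasure (padic_haar p) {x \<in> Qp p. padic_norm p x = 0} \<le> 0"
      by (rule ennreal_le_epsilon) (simp only: add_0_left le)
    thus ?thesis using s 1 by simp
  next
    case (2 m)
    have lt: "real p powi (m - 1) < real p powi m" by (simp add: powi_less_iff)
    have ball: "x \<in> padic_ball p 0 (- m) - padic_ball p 0 (- (m - 1))
        \<longleftrightarrow> x \<in> Qp p \<and> padic_norm p x \<le> real p powi m \<and> real p powi (m - 1) < padic_norm p x" for x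
      unfolding Diff_iff padic_ball_zero_iff minus_minus by linarith
    have eq: "{x \<in> Qp p. padic_norm p x = real p powi m} = padic_ball p 0 (- m) - padic_ball p 0 (- (m - 1))"
    proof (intro equalityI subsetI)
      fix x assume "x \<in> {x \<in> Qp p. padic_norm p x = real p powi m}"
      thus "x \<in> padic_ball p 0 (- m) - padic_ball p 0 (- (m - 1))" unfolding ball using lt by simp
    next
      fix x assume "x \<in> padic_ball p 0 (- m) - padic_ball p 0 (- (m - 1))"
      hence xQ: "x \<in> Qp p" and xm: "padic_norm p x \<le> real p powi m" "padic_norm p x > real p powi (m - 1)"
        unfolding ball by auto
      from xQ have "padic_norm p x = real p powi m"
      proof (cases rule: padic_norm_cases)
        case 1
        thus ?thesis using xm powi_pos[OF p, of "m - 1"] by simp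
      next
        case (2 j)
        hence "j = m" using xm by (simp add: powi_le_iff powi_less_iff)
        thus ?thesis using 2 by simp
      qed
      thus "x \<in> {x \<in> Qp p. padic_norm p x = real p powi m}" using xQ by simp
    qed
    have s: "{x \<in> Qp p. padic_norm p x = real p powi m} \<in> sets (padic_haar p)"
      unfolding eq using sets by (intro sets.Diff) auto
    have "emeasure (padic_haar p) {x \<in> Qp p. padic_norm p x = real p powi m}
        = emeasure (padic_haar p) (padic_ball p 0 (- m)) - emeasure (padic_haar p) (padic_ball p 0 (- (m - 1)))"
      unfolding eq using sets
    proof (intro emeasure_Diff subsetI)
      fix x assume "x \<in> padic_ball p 0 (- (m - 1))"
      thus "x \<in> padic_ball p 0 (- m)" using lt unfolding padic_ball_zero_iff minus_minus by linarith
    qed (simp_all add: emeasure_haar_ball)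
    also have "\<dots> = ennreal (real p powi m - real p powi (m - 1))"
      using powi_pos[OF p] by (simp add: emeasure_haar_ball ennreal_minus less_imp_le)
    also have "real p powi m - real p powi (m - 1) = (1 - 1 / real p) * real p powi m"
      using p_gt_1[OF p] by (simp add: power_int_diff field_simps)
    finally show ?thesis using s 2 by simp
  qed
  thus "{x \<in> Qp p. padic_norm p x = t} \<in> sets (padic_haar p)"
    and "emeasure (padic_haar p) {x \<in> Qp p. padic_norm p x = t} = ennreal ((1 - 1 / real p) * t)" by auto
qed

lemma countable_norm_values: "countable norm_values"
  by (simp add: norm_values_def)

lemma padic_norm_in_norm_values:
  assumes "x \<in> Qp p" shows "padic_norm p x \<in> norm_values"
  using assms by (cases rule: padic_norm_cases) (simp_all add: norm_values_def)

lemma padic_norm_measurable: "padic_norm p \<in> measurable (padic_haar p) (count_space norm_values)"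
proof -
  have "padic_norm p -` {t} \<inter> space (padic_haar p) = {x \<in> Qp p. padic_norm p x = t}" for t by auto
  thus ?thesis
    unfolding measurable_count_space_eq_countable[OF countable_norm_values]
    using padic_norm_in_norm_values emeasure_haar_sphere(1) by simp
qed

text \<open>
  The sphere of radius \<open>t\<close> has measure \<open>(1 - 1/p) t\<close>, and a measure on a countable set is known from
  its points. This reduces the integration of radial functions to summation.
\<close>

lemma distr_haar_norm:
  "distr (padic_haar p) (count_space norm_values) (padic_norm p)
     = density (count_space norm_values) (\<lambda>t. ennreal ((1 - 1 / real p) * t))"
proof (rule measure_eqI_countable[OF _ _ countable_norm_values])
  fix t assume t: "t \<in> norm_values"
  have "padic_norm p -` {t} \<inter> space (padic_haar p) = {x \<in> Qp p. padic_norm p x = t}" by auto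
  hence "emeasure (distr (padic_haar p) (count_space norm_values) (padic_norm p)) {t} = ennreal ((1 - 1 / real p) * t)"
    using t by (subst emeasure_distr[OF padic_norm_measurable]) (auto simp: emeasure_haar_sphere)
  also have "\<dots> = emeasure (density (count_space norm_values) (\<lambda>t. ennreal ((1 - 1 / real p) * t))) {t}"
    using t by (simp add: point_measure_def[symmetric] emeasure_point_measure_finite2)
  finally show "emeasure (distr (padic_haar p) (count_space norm_values) (padic_norm p)) {t}
     = emeasure (density (count_space norm_values) (\<lambda>t. ennreal ((1 - 1 / real p) * t))) {t}" .
qed simp_all

end

section \<open>Radial functions\<close>

text \<open>
  The positive number \<open>- (1 - 1/p) / \<Gamma>\<^sub>p(-2)\<close>: the factor of \<open>D\<^sup>2\<close> together with the
  factor \<open>1 - 1/p\<close> in the measure of a sphere.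
\<close>

definition vladimirov_const :: "real \<Rightarrow> real" where
  "vladimirov_const P = P ^ 2 * (P ^ 2 - 1) / (P ^ 2 + P + 1)"

lemma tendsto_powi_at_bot:
  fixes b :: real assumes "b > 1"
  shows "((\<lambda>j::int. b powi j) \<longlongrightarrow> 0) at_bot"
proof (rule tendstoI)
  fix e :: real assume "e > 0"
  then obtain k where k: "(1 / b) ^ k < e" using real_arch_pow_inv[of e "1 / b"] assms by auto
  have "dist (b powi j) 0 < e" if "j \<le> - int k" for j
  proof -
    have "b powi j \<le> b powi (- int k)" using that assms by (intro power_int_increasing) auto
    thus ?thesis using k assms by (simp add: power_int_minus power_one_over inverse_eq_divide)
  qed
  thus "\<forall>\<^sub>F j::int in at_bot. dist (b powi j) 0 < e"
    by (auto simp: eventually_at_bot_linorder)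
qed

lemma powi_minus_mult:
  fixes b :: real assumes "b > 0"
  shows "b powi (- 2 * j) = 1 / (b powi j) ^ 2" "b powi (- 3 * j) = 1 / (b powi j) ^ 3"
  using assms by (simp_all add: power_int_minus power_int_mult mult.commute[of 2] mult.commute[of 3] divide_inverse)

lemma filterlim_int_at_bot: "filterlim (\<lambda>i. m - int i) at_bot sequentially"
  unfolding filterlim_at_bot eventually_sequentially
proof
  fix Z show "\<exists>N. \<forall>n\<ge>N. m - int n \<le> Z" by (intro exI[of _ "nat (m - Z)"]) auto
qed

lemma filterlim_int_at_top: "filterlim (\<lambda>i. m + int i) at_top sequentially"
  unfolding filterlim_at_top eventually_sequentially
proof
  fix Z show "\<exists>N. \<forall>n\<ge>N. Z \<le> m + int n" by (intro exI[of _ "nat (Z - m)"]) auto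
qed

context
  fixes p :: nat
  assumes p: "prime p"
begin

text \<open>
  The sum over all spheres is cut at the exponent \<open>m\<close> into two series indexed by the naturals, both
  running away from \<open>m\<close>. At a point of norm \<open>p^m\<close> this is where the kernel of \<open>D\<^sup>2\<close> changes
  its form.
\<close>

lemma haar_radial_integral:
  fixes h :: "real \<Rightarrow> real"
  assumes low: "summable (\<lambda>i. \<bar>h (real p powi (m - int i)) * real p powi (m - int i)\<bar>)"
      "(\<lambda>i. h (real p powi (m - int i)) * real p powi (m - int i)) sums a"
    and high: "summable (\<lambda>i. \<bar>h (real p powi (m + 1 + int i)) * real p powi (m + 1 + int i)\<bar>)"
      "(\<lambda>i. h (real p powi (m + 1 + int i)) * real p powi (m + 1 + int i)) sums b"
  shows "integrable (padic_haar p) (\<lambda>x. h (padic_norm p x))"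
    and "integral\<^sup>L (padic_haar p) (\<lambda>x. h (padic_norm p x)) = (1 - 1 / real p) * (a + b)"
proof -
  let ?V = "norm_values p"
  define A B where "A = (\<lambda>i. real p powi (m - int i))" and "B = (\<lambda>i. real p powi (m + 1 + int i))"
  have powi_eq: "real p powi i = real p powi j \<longleftrightarrow> i = j" for i j
  proof
    assume e: "real p powi i = real p powi j"
    have "i \<le> j" "j \<le> i"
      unfolding powi_le_iff[OF p, symmetric] e by (rule order_refl)+
    thus "i = j" by (rule order_antisym)
  qed (rule arg_cong)
  have inj: "inj A" "inj B"
    by (simp_all add: A_def B_def inj_def powi_eq)
  have disj: "range A \<inter> range B = {}"
  proof -
    have "A i < B j" for i j by (simp add: A_def B_def powi_less_iff[OF p])
    hence "A i \<noteq> B j" for i j by (rule less_imp_neq)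
    thus ?thesis by blast
  qed
  have nz: "0 \<notin> range A \<union> range B" using p_gt_1[OF p] by (auto simp: A_def B_def)
  have cover: "?V = insert 0 (range A \<union> range B)"
  proof -
    have "real p powi j \<in> range A \<union> range B" for j
    proof (cases "j \<le> m")
      case True
      hence "real p powi j = A (nat (m - j))" by (simp add: A_def)
      thus ?thesis by blast
    next
      case False
      hence "real p powi j = B (nat (j - m - 1))" by (simp add: B_def)
      thus ?thesis by blast
    qed
    hence "range (\<lambda>j. real p powi j) \<subseteq> range A \<union> range B" by (intro image_subsetI)
    moreover have "range A \<subseteq> range (\<lambda>j. real p powi j)" "range B \<subseteq> range (\<lambda>j. real p powi j)"
      unfolding A_def B_def by (rule image_subsetI, rule rangeI)+
    ultimately have "range (\<lambda>j. real p powi j) = range A \<union> range B" by (intro subset_antisym Un_least)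
    thus ?thesis unfolding norm_values_def[OF p] by (rule arg_cong)
  qed
  have hs: "(f has_sum (s + t)) ?V"
    if "summable (\<lambda>i. \<bar>f (A i)\<bar>)" "(\<lambda>i. f (A i)) sums s" "summable (\<lambda>i. \<bar>f (B i)\<bar>)" "(\<lambda>i. f (B i)) sums t" "f 0 = 0"
    for f :: "real \<Rightarrow> real" and s t
  proof -
    have "(f has_sum s) (range A)" "(f has_sum t) (range B)"
      using that inj norm_summable_imp_has_sum[of "\<lambda>i. f (A i)" s] norm_summable_imp_has_sum[of "\<lambda>i. f (B i)" t]
      by (simp_all add: has_sum_reindex o_def)
    hence "(f has_sum (f 0 + (s + t))) (insert 0 (range A \<union> range B))"
      by (intro has_sum_insert nz has_sum_Un_disjoint disj)
    thus ?thesis using that(5) cover by simp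
  qed
  define G where "G = (\<lambda>t. h t * t)"
  have sumG: "(G has_sum (a + b)) ?V"
    using low high by (intro hs) (simp_all add: G_def A_def B_def)
  have "((\<lambda>t. \<bar>G t\<bar>) has_sum (suminf (\<lambda>i. \<bar>G (A i)\<bar>) + suminf (\<lambda>i. \<bar>G (B i)\<bar>))) ?V"
    using low high by (intro hs summable_sums) (simp_all add: G_def A_def B_def)
  hence "(\<lambda>t. norm (G t)) summable_on ?V" by (auto simp: summable_on_def)
  hence absG: "Infinite_Set_Sum.abs_summable_on G ?V" 
    unfolding abs_summable_equivalent .
  hence intG: "integrable (count_space ?V) G" by (simp add: abs_summable_on_def)
  have "integral\<^sup>L (count_space ?V) G = infsum G ?V"
    using infsetsum_infsum[OF absG] by (simp add: infsetsum_def)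
  also have "\<dots> = a + b" using sumG by (rule infsumI)
  finally have valG: "integral\<^sup>L (count_space ?V) G = a + b" .
  let ?w = "\<lambda>t. (1 - 1 / real p) * t"
  have w: "AE t in count_space ?V. 0 \<le> ?w t"
    using p_gt_1[OF p] powi_pos[OF p] by (auto simp: AE_count_space norm_values_def[OF p] less_imp_le)
  have wG: "(\<lambda>t. ?w t *\<^sub>R h t) = (\<lambda>t. (1 - 1 / real p) * G t)" by (simp add: G_def mult_ac)
  have "integrable (distr (padic_haar p) (count_space ?V) (padic_norm p)) h"
  proof -
    have "integrable (count_space ?V) (\<lambda>t. ?w t *\<^sub>R h t)" unfolding wG using intG by simp
    thus ?thesis unfolding distr_haar_norm[OF p] using w by (subst integrable_density) auto
  qed
  thus "integrable (padic_haar p) (\<lambda>x. h (padic_norm p x))"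
    by (subst (asm) integrable_distr_eq[OF padic_norm_measurable[OF p]]) auto
  have "integral\<^sup>L (padic_haar p) (\<lambda>x. h (padic_norm p x))
      = integral\<^sup>L (distr (padic_haar p) (count_space ?V) (padic_norm p)) h"
    by (rule integral_distr[symmetric, OF padic_norm_measurable[OF p]]) simp
  also have "\<dots> = integral\<^sup>L (count_space ?V) (\<lambda>t. ?w t *\<^sub>R h t)"
    unfolding distr_haar_norm[OF p] using w by (intro integral_density) auto
  also have "\<dots> = (1 - 1 / real p) * (a + b)" unfolding wG by (simp add: valG)
  finally show "integral\<^sup>L (padic_haar p) (\<lambda>x. h (padic_norm p x)) = (1 - 1 / real p) * (a + b)" .
qed

lemma vladimirov_const_Gamma: "1 / Gamma_p p (- 2) * (1 - 1 / real p) = - vladimirov_const (real p)"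
proof -
  define P where "P = real p"
  have P: "P > 1" using p_gt_1[OF p] by (simp add: P_def)
  have nz: "P^2 + P + 1 \<noteq> 0" using P by (smt (verit) zero_le_power2)
  have e: "P powr (- 3) = 1 / P^3" "P powr 2 = P^2" using P by (simp_all add: powr_minus_divide)
  have P1: "P \<noteq> 0" "P - 1 \<noteq> 0" "P + 1 \<noteq> 0" using P by auto
  have "1 - 1 / P^3 = (P - 1) * (P^2 + P + 1) / P^3" using P1 by (simp add: field_simps power2_eq_square power3_eq_cube)
  moreover have "1 - P^2 = - ((P - 1) * (P + 1))" "P^2 - 1 = (P - 1) * (P + 1)" by (simp_all add: algebra_simps power2_eq_square)
  ultimately have "1 / ((1 - 1 / P^3) / (1 - P^2)) * (1 - 1 / P) = - (P^2 * (P^2 - 1) / (P^2 + P + 1))"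
    using P1 nz by (simp add: divide_simps power2_eq_square power3_eq_cube) (simp add: algebra_simps)
  thus ?thesis by (simp add: Gamma_p_def vladimirov_const_def e P_def[symmetric])
qed

text \<open>
  For radial \<open>\<psi>\<close> the integrand is a function of \<open>|y|\<close> everywhere: where \<open>|y| = |x|\<close> its numerator is
  zero, whatever the kernel is, and elsewhere \<open>|x - y|\<close> is the maximum of the two norms.
\<close>

lemma vladimirov_radial:
  fixes U :: "real \<Rightarrow> real"
  assumes x: "x \<in> Qp p"
    and h: "h = (\<lambda>t. (U t - U (padic_norm p x)) / max (padic_norm p x) t ^ 3)"
    and low: "summable (\<lambda>i. \<bar>h (real p powi (m - int i)) * real p powi (m - int i)\<bar>)"
      "(\<lambda>i. h (real p powi (m - int i)) * real p powi (m - int i)) sums a"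
    and high: "summable (\<lambda>i. \<bar>h (real p powi (m + 1 + int i)) * real p powi (m + 1 + int i)\<bar>)"
      "(\<lambda>i. h (real p powi (m + 1 + int i)) * real p powi (m + 1 + int i)) sums b"
    and \<psi>: "\<And>y. y \<in> Qp p \<Longrightarrow> \<psi> y = complex_of_real (U (padic_norm p y))"
  shows "integrable (padic_haar p) (vladimirov_integrand p 2 \<psi> x)"
    and "vladimirov p 2 \<psi> x = complex_of_real (- vladimirov_const (real p) * (a + b))"
proof -
  have eq: "vladimirov_integrand p 2 \<psi> x y = complex_of_real (h (padic_norm p y))" if y: "y \<in> space (padic_haar p)" for y
  proof (cases "padic_norm p y = padic_norm p x")
    case True
    thus ?thesis using x y p by (simp add: vladimirov_integrand_def \<psi> h)
  next
    case False
    hence "padic_norm p (padic_diff p x y) = max (padic_norm p x) (padic_norm p y)"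
      using x y p by (intro padic_norm_diff) auto
    moreover have "max (padic_norm p x) (padic_norm p y) > 0"
      using False padic_norm_nonneg[OF p x] padic_norm_nonneg[OF p, of y] y p by (auto simp: max_def)
    ultimately show ?thesis using x y p by (simp add: vladimirov_integrand_def \<psi> h)
  qed
  note int = haar_radial_integral[OF low high]
  show "integrable (padic_haar p) (vladimirov_integrand p 2 \<psi> x)"
    using int(1) by (subst Bochner_Integration.integrable_cong[OF refl eq]) auto
  have "integral\<^sup>L (padic_haar p) (vladimirov_integrand p 2 \<psi> x)
      = integral\<^sup>L (padic_haar p) (\<lambda>y. complex_of_real (h (padic_norm p y)))"
    by (intro Bochner_Integration.integral_cong eq) auto
  also have "\<dots> = complex_of_real ((1 - 1 / real p) * (a + b))"
    by (simp only: integral_complex_of_real int(2))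
  finally have "vladimirov p 2 \<psi> x = complex_of_real (1 / Gamma_p p (- 2) * (1 - 1 / real p) * (a + b))"
    by (simp add: vladimirov_def)
  thus "vladimirov p 2 \<psi> x = complex_of_real (- vladimirov_const (real p) * (a + b))"
    by (simp only: vladimirov_const_Gamma)
qed

end

text \<open>
  \<open>I m\<close> is the sum of \<open>U(p^j) p^j\<close> over \<open>j \<le> m\<close> and \<open>T m\<close> is the sum of
  \<open>U(p^j) p^(-2j)\<close> over \<open>j > m\<close>. They are described by their differences and their limits, so that
  closed forms can be put in their place and the sums follow by telescoping.
\<close>

locale radial_profile =
  fixes p :: nat and U :: "real \<Rightarrow> real" and I T :: "int \<Rightarrow> real" and C :: real
  assumes prime: "prime p"
    and bounded: "\<And>m. \<bar>U (real p powi m)\<bar> \<le> C"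
    and I_step: "\<And>m. I m - I (m - 1) = U (real p powi m) * real p powi m"
    and T_step: "\<And>m. T (m - 1) - T m = U (real p powi m) * real p powi (- 2 * m)"
    and I_lim: "(I \<longlongrightarrow> 0) at_bot"
    and T_lim: "(T \<longlongrightarrow> 0) at_top"
begin

lemma P_gt_1: "real p > 1" using p_gt_1[OF prime] by simp

lemma P_pos: "real p > 0" using P_gt_1 by simp

lemma powi_diff_nat: "real p powi (m - int i) = real p powi m * (1 / real p) ^ i"
  using P_gt_1 by (simp add: power_int_diff power_int_add power_one_over divide_inverse power_inverse)

lemma powi_minus_double: "real p powi (- 2 * (m + 1 + int i)) = real p powi (- 2 * m) / real p ^ 2 * (1 / real p ^ 2) ^ i"
proof -
  have "real p powi (m + 1 + int i) = real p powi m * real p * real p ^ i"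
    using P_gt_1 by (simp add: power_int_add)
  thus ?thesis using P_gt_1
    by (simp only: powi_minus_mult[OF P_pos]) (simp add: power_mult_distrib power_one_over power_mult[symmetric] mult_ac)
qed

lemma geometric_low: "(\<lambda>i. real p powi (m - int i)) sums (real p powi m * (real p / (real p - 1)))"
proof -
  have "(\<lambda>i. (1 / real p) ^ i) sums (1 / (1 - 1 / real p))" using P_gt_1 by (intro geometric_sums) auto
  hence "(\<lambda>i. real p powi m * (1 / real p) ^ i) sums (real p powi m * (1 / (1 - 1 / real p)))" by (rule sums_mult)
  also have "1 / (1 - 1 / real p) = real p / (real p - 1)" using P_gt_1 by (simp add: field_simps)
  finally show ?thesis by (simp only: powi_diff_nat)
qed

lemma geometric_high:
  "(\<lambda>i. real p powi (- 2 * (m + 1 + int i))) sums (real p powi (- 2 * m) / (real p ^ 2 - 1))"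
proof -
  have P2: "real p ^ 2 > 1" using P_gt_1 by (simp add: one_less_power)
  have "(\<lambda>i. (1 / real p ^ 2) ^ i) sums (1 / (1 - 1 / real p ^ 2))" using P2 by (intro geometric_sums) (simp add: divide_simps)
  hence "(\<lambda>i. real p powi (- 2 * m) / real p ^ 2 * (1 / real p ^ 2) ^ i) sums
      (real p powi (- 2 * m) / real p ^ 2 * (1 / (1 - 1 / real p ^ 2)))" by (rule sums_mult)
  also have "real p powi (- 2 * m) / real p ^ 2 * (1 / (1 - 1 / real p ^ 2)) = real p powi (- 2 * m) / (real p ^ 2 - 1)"
    using P2 P_gt_1 by (simp add: divide_simps)
  finally show ?thesis by (simp only: powi_minus_double)
qed

lemma sums_low: "(\<lambda>i. U (real p powi (m - int i)) * real p powi (m - int i)) sums I m"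
proof -
  have "(\<lambda>i. I (m - int i)) \<longlonglongrightarrow> 0" using I_lim filterlim_int_at_bot by (rule filterlim_compose)
  from telescope_sums'[OF this] show ?thesis
    using I_step[of "m - int i" for i] by (simp add: algebra_simps)
qed

lemma sums_high: "(\<lambda>i. U (real p powi (m + 1 + int i)) * real p powi (- 2 * (m + 1 + int i))) sums T m"
proof -
  have "(\<lambda>i. T (m + int i)) \<longlonglongrightarrow> 0" using T_lim filterlim_int_at_top by (rule filterlim_compose)
  from telescope_sums'[OF this] show ?thesis
    using T_step[of "m + 1 + int i" for i] by (simp add: algebra_simps)
qed

lemma summable_bounded_mult:
  fixes f g :: "nat \<Rightarrow> real"
  assumes "summable g" "\<And>i. 0 \<le> g i" "\<And>i. \<bar>f i\<bar> \<le> K"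
  shows "summable (\<lambda>i. \<bar>f i * g i\<bar>)"
proof (rule summable_comparison_test'[of "\<lambda>i. K * g i" 0])
  show "summable (\<lambda>i. K * g i)" using assms(1) by (rule summable_mult)
  show "norm \<bar>f i * g i\<bar> \<le> K * g i" for i
    using mult_right_mono[OF assms(3)[of i] assms(2)[of i]] assms(2)[of i] by (simp add: abs_mult)
qed

text \<open>
  The coefficient of \<open>U(p^m)\<close> is \<open>P / (P - 1) + 1 / (P^2 - 1)\<close>, written as one fraction: the two
  geometric series that \<open>- f(x)\<close> contributes below and above the sphere of \<open>x\<close>. The sphere itself
  contributes zero and is counted in \<open>I m\<close> as well as in the first geometric series.
\<close>

lemma vladimirov_at_level:
  assumes x: "x \<in> Qp p" "padic_norm p x = real p powi m"
    and \<psi>: "\<And>y. y \<in> Qp p \<Longrightarrow> \<psi> y = complex_of_real (U (padic_norm p y))"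
  shows "integrable (padic_haar p) (vladimirov_integrand p 2 \<psi> x)"
    and "vladimirov p 2 \<psi> x = complex_of_real (vladimirov_const (real p) *
      ((real p ^ 2 + real p + 1) / (real p ^ 2 - 1) * (U (real p powi m) * real p powi (- 2 * m))
        - real p powi (- 3 * m) * I m - T m))"
proof -
  define h where "h = (\<lambda>t. (U t - U (padic_norm p x)) / max (padic_norm p x) t ^ 3)"
  let ?u = "U (real p powi m)"
  have pos: "real p powi j > 0" for j using powi_pos[OF prime] .
  have lowh: "h (real p powi (m - int i)) * real p powi (m - int i)
      = real p powi (- 3 * m) * (U (real p powi (m - int i)) - ?u) * real p powi (m - int i)" for i
  proof -
    have "max (real p powi m) (real p powi (m - int i)) = real p powi m"
      by (simp add: max_absorb1 powi_le_iff[OF prime])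
    thus ?thesis using pos[of m] by (simp only: h_def x powi_minus_mult[OF P_pos]) simp
  qed
  have highh: "h (real p powi (m + 1 + int i)) * real p powi (m + 1 + int i)
      = (U (real p powi (m + 1 + int i)) - ?u) * real p powi (- 2 * (m + 1 + int i))" for i
  proof -
    define j where "j = m + 1 + int i"
    have "max (real p powi m) (real p powi j) = real p powi j"
      by (simp add: max_absorb2 powi_le_iff[OF prime] j_def)
    thus ?thesis using pos[of j] unfolding j_def[symmetric]
      by (simp only: h_def x powi_minus_mult[OF P_pos]) (simp add: divide_simps power2_eq_square power3_eq_cube)
  qed
  have ub: "\<bar>U (real p powi j) - ?u\<bar> \<le> 2 * C" for j using bounded[of j] bounded[of m] by linarith
  have sl: "(\<lambda>i. h (real p powi (m - int i)) * real p powi (m - int i)) sums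
      (real p powi (- 3 * m) * (I m - ?u * (real p powi m * (real p / (real p - 1)))))"
    unfolding lowh using sums_mult[OF sums_diff[OF sums_low[of m] sums_mult[OF geometric_low[of m], of ?u]], of "real p powi (- 3 * m)"]
    by (simp add: algebra_simps)
  have sh: "(\<lambda>i. h (real p powi (m + 1 + int i)) * real p powi (m + 1 + int i)) sums
      (T m - ?u * (real p powi (- 2 * m) / (real p ^ 2 - 1)))"
    unfolding highh using sums_diff[OF sums_high[of m] sums_mult[OF geometric_high[of m], of ?u]]
    by (simp only: left_diff_distrib)
  have al: "summable (\<lambda>i. \<bar>h (real p powi (m - int i)) * real p powi (m - int i)\<bar>)"
    unfolding lowh
  proof (rule summable_bounded_mult[OF sums_summable[OF geometric_low]])
    show "\<bar>real p powi (- 3 * m) * (U (real p powi (m - int i)) - ?u)\<bar> \<le> real p powi (- 3 * m) * (2 * C)" for i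
      using mult_left_mono[OF ub less_imp_le[OF pos]] pos[of "- 3 * m"] by (simp add: abs_mult)
  qed (use pos in \<open>simp add: less_imp_le\<close>)
  have ah: "summable (\<lambda>i. \<bar>h (real p powi (m + 1 + int i)) * real p powi (m + 1 + int i)\<bar>)"
    unfolding highh
    by (rule summable_bounded_mult[OF sums_summable[OF geometric_high]]) (use ub pos in \<open>simp_all add: less_imp_le\<close>)
  note V = vladimirov_radial[OF prime x(1) h_def al sl ah sh \<psi>]
  show "integrable (padic_haar p) (vladimirov_integrand p 2 \<psi> x)" by (rule V(1))
  have "real p powi (- 3 * m) * real p powi m = real p powi (- 2 * m)"
    using P_gt_1 by (subst power_int_add[symmetric]) auto
  hence "real p powi (- 3 * m) * (I m - ?u * (real p powi m * (real p / (real p - 1)))) =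
     real p powi (- 3 * m) * I m - ?u * real p powi (- 2 * m) * (real p / (real p - 1))"
    by (simp add: algebra_simps)
  moreover have "(real p ^ 2 + real p + 1) / (real p ^ 2 - 1) = real p / (real p - 1) + 1 / (real p ^ 2 - 1)"
  proof -
    have "real p ^ 2 - 1 = (real p - 1) * (real p + 1)" by (simp add: algebra_simps power2_eq_square)
    thus ?thesis using P_gt_1 by (simp add: divide_simps) (simp add: algebra_simps power2_eq_square)
  qed
  ultimately have "- vladimirov_const (real p) * (real p powi (- 3 * m) * (I m - ?u * (real p powi m * (real p / (real p - 1))))
      + (T m - ?u * (real p powi (- 2 * m) / (real p ^ 2 - 1)))) =
    vladimirov_const (real p) * ((real p ^ 2 + real p + 1) / (real p ^ 2 - 1) * (?u * real p powi (- 2 * m))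
        - real p powi (- 3 * m) * I m - T m)"
    by (simp only:) (simp add: algebra_simps)
  thus "vladimirov p 2 \<psi> x = complex_of_real (vladimirov_const (real p) *
      ((real p ^ 2 + real p + 1) / (real p ^ 2 - 1) * (?u * real p powi (- 2 * m))
        - real p powi (- 3 * m) * I m - T m))" using V(2) by simp
qed

text \<open>
  At the origin the whole sum telescopes: \<open>T m\<close> minus the corresponding tail for the constant
  \<open>U 0\<close> has the terms of the sum as its differences and tends to zero at infinity, so only
  its limit at minus infinity remains. The flatness of \<open>U\<close> at 0 makes the integral converge
  absolutely there.
\<close>

lemma vladimirov_at_zero:
  assumes x: "x \<in> Qp p" "padic_norm p x = 0"
    and \<psi>: "\<And>y. y \<in> Qp p \<Longrightarrow> \<psi> y = complex_of_real (U (padic_norm p y))"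
    and flat: "\<And>m. m \<le> 0 \<Longrightarrow> \<bar>U (real p powi m) - U 0\<bar> \<le> K * real p powi (3 * m)"
    and lim: "((\<lambda>m. T m - U 0 * (real p powi (- 2 * m) / (real p ^ 2 - 1))) \<longlongrightarrow> - \<tau>) at_bot"
  shows "integrable (padic_haar p) (vladimirov_integrand p 2 \<psi> x)"
    and "vladimirov p 2 \<psi> x = complex_of_real (vladimirov_const (real p) * \<tau>)"
proof -
  define h where "h = (\<lambda>t. (U t - U (padic_norm p x)) / max (padic_norm p x) t ^ 3)"
  define Q where "Q = (\<lambda>m. T m - U 0 * (real p powi (- 2 * m) / (real p ^ 2 - 1)))"
  have pos: "real p powi j > 0" for j using powi_pos[OF prime] .
  have P2: "real p ^ 2 > 1" using P_gt_1 by (simp add: one_less_power)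
  have hj: "h (real p powi j) * real p powi j = (U (real p powi j) - U 0) * real p powi (- 2 * j)" for j
    using pos[of j] by (simp only: h_def x powi_minus_mult[OF P_pos])
      (simp add: max_absorb2 less_imp_le divide_simps power2_eq_square power3_eq_cube)
  have Q_step: "Q (j - 1) - Q j = (U (real p powi j) - U 0) * real p powi (- 2 * j)" for j
  proof -
    have "real p powi (j - 1) = real p powi j / real p"
      using P_gt_1 by (simp add: power_int_diff)
    hence "real p powi (- 2 * (j - 1)) = real p powi (- 2 * j) * real p ^ 2"
      by (simp only: powi_minus_mult[OF P_pos]) (simp add: power_divide)
    hence "real p powi (- 2 * (j - 1)) / (real p ^ 2 - 1) - real p powi (- 2 * j) / (real p ^ 2 - 1) = real p powi (- 2 * j)"
      using P2 nonzero_mult_div_cancel_right[of "real p ^ 2 - 1" "real p powi (- 2 * j)"]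
      by (simp only: right_diff_distrib diff_divide_distrib) simp
    hence "U 0 * (real p powi (- 2 * (j - 1)) / (real p ^ 2 - 1)) - U 0 * (real p powi (- 2 * j) / (real p ^ 2 - 1)) = U 0 * real p powi (- 2 * j)"
      by (metis right_diff_distrib)
    thus ?thesis using T_step[of j] unfolding Q_def by (simp only: left_diff_distrib)
  qed
  have "(\<lambda>i. Q (0 - int i)) \<longlonglongrightarrow> - \<tau>" using lim filterlim_int_at_bot unfolding Q_def by (rule filterlim_compose)
  have minus_int_Suc: "0 - int (Suc i) = 0 - int i - 1" for i by simp
  from telescope_sums[OF \<open>(\<lambda>i. Q (0 - int i)) \<longlonglongrightarrow> - \<tau>\<close>]
  have sl: "(\<lambda>i. h (real p powi (0 - int i)) * real p powi (0 - int i)) sums (- \<tau> - Q 0)"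
    unfolding hj Q_step[symmetric] minus_int_Suc by (simp only: of_nat_0 diff_zero)
  have sh: "(\<lambda>i. h (real p powi (0 + 1 + int i)) * real p powi (0 + 1 + int i)) sums Q 0"
    unfolding hj using sums_diff[OF sums_high[of 0] sums_mult[OF geometric_high[of 0], of "U 0"]]
    by (simp add: Q_def left_diff_distrib)
  have al: "summable (\<lambda>i. \<bar>h (real p powi (0 - int i)) * real p powi (0 - int i)\<bar>)"
  proof (rule summable_comparison_test'[of "\<lambda>i. K * real p powi (0 - int i)" 0])
    show "summable (\<lambda>i. K * real p powi (0 - int i))"
      using geometric_low[of 0] by (intro summable_mult) (rule sums_summable)
    fix i :: nat
    define j where "j = 0 - int i"
    have "\<bar>h (real p powi j) * real p powi j\<bar> = \<bar>U (real p powi j) - U 0\<bar> * real p powi (- 2 * j)"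
      unfolding hj using pos[of "- 2 * j"] by (simp add: abs_mult)
    also have "\<dots> \<le> K * real p powi (3 * j) * real p powi (- 2 * j)"
      using flat[of j] pos[of "- 2 * j"] by (intro mult_right_mono) (auto simp: j_def)
    also have "real p powi (3 * j) * real p powi (- 2 * j) = real p powi j"
      using P_gt_1 by (subst power_int_add[symmetric]) auto
    hence "K * real p powi (3 * j) * real p powi (- 2 * j) = K * real p powi j" by (simp only: mult.assoc)
    finally show "norm \<bar>h (real p powi (0 - int i)) * real p powi (0 - int i)\<bar> \<le> K * real p powi (0 - int i)"
      by (simp add: j_def)
  qed
  have ub: "\<bar>U (real p powi j) - U 0\<bar> \<le> C + \<bar>U 0\<bar>" for j using bounded[of j] by linarith
  have ah: "summable (\<lambda>i. \<bar>h (real p powi (0 + 1 + int i)) * real p powi (0 + 1 + int i)\<bar>)"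
    unfolding hj
    by (rule summable_bounded_mult[OF sums_summable[OF geometric_high]]) (use ub pos in \<open>simp_all add: less_imp_le\<close>)
  note V = vladimirov_radial[OF prime x(1) h_def al sl ah sh \<psi>]
  show "integrable (padic_haar p) (vladimirov_integrand p 2 \<psi> x)" by (rule V(1))
  show "vladimirov p 2 \<psi> x = complex_of_real (vladimirov_const (real p) * \<tau>)" using V(2) by simp
qed

end

section \<open>Coefficients and their series\<close>

definition even_series :: "(nat \<Rightarrow> real) \<Rightarrow> nat \<Rightarrow> real \<Rightarrow> real" where
  "even_series a d z = (\<Sum>n. a n * z ^ (2 * n + d))"

text \<open>
  Where everything converges absolutely, this is the sum of \<open>even_series a d (z / P^j)\<close> over all naturals \<open>j\<close>: each monomial
  contributes a geometric series. Its difference at \<open>z\<close> and \<open>z / P\<close> is accordingly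
  \<open>even_series a d z\<close> (\<open>sum_series_step\<close>).
\<close>

definition sum_series :: "real \<Rightarrow> (nat \<Rightarrow> real) \<Rightarrow> nat \<Rightarrow> real \<Rightarrow> real" where
  "sum_series P a d z = (\<Sum>n. a n * z ^ (2 * n + d) / (1 - 1 / P ^ (2 * n + d)))"

text \<open>
  The multipliers of \<open>D\<^sup>2\<close> on \<open>|x|^(2n+4)\<close> and on \<open>|x|^(-2n-5)\<close>, in the form in which summation
  over spheres produces them. They are quotients of p-adic gamma factors
  (\<open>inner_symbol_Gamma\<close>, \<open>outer_symbol_Gamma\<close>).
\<close>

definition inner_symbol :: "real \<Rightarrow> nat \<Rightarrow> real" where
  "inner_symbol P n = P ^ 2 + vladimirov_const P * (1 / (1 - 1 / P ^ (2 * n + 2)) - 1 / (1 - 1 / P ^ (2 * n + 5)))"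

definition outer_symbol :: "real \<Rightarrow> nat \<Rightarrow> real" where
  "outer_symbol P n = P ^ 2 + vladimirov_const P * (1 / (P ^ (2 * n + 4) - 1) - 1 / (P ^ (2 * n + 7) - 1))"

text \<open>
  The coefficients \<open>c\<^sub>2\<^sub>n\<^sub>+\<^sub>4\<close> for \<open>c\<^sub>0 = 1\<close>, and \<open>k\<^sub>2\<^sub>n\<^sub>+\<^sub>5 P^(-2n)\<close> for \<open>k\<^sub>5 = 1\<close>. The
  power of \<open>P\<close> gives the second sequence the same kind of geometric bound as the first.
\<close>

fun inner_coeff :: "real \<Rightarrow> real \<Rightarrow> nat \<Rightarrow> real" where
  "inner_coeff P E 0 = - 1 / inner_symbol P 0"
| "inner_coeff P E (Suc 0) = E * inner_coeff P E 0 / inner_symbol P 1"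
| "inner_coeff P E (Suc (Suc n)) =
     (E * inner_coeff P E (Suc n) - inner_coeff P E n) / inner_symbol P (Suc (Suc n))"

fun outer_coeff :: "real \<Rightarrow> real \<Rightarrow> nat \<Rightarrow> real" where
  "outer_coeff P E 0 = 1"
| "outer_coeff P E (Suc 0) = E / P ^ 2"
| "outer_coeff P E (Suc (Suc n)) =
     (E * P ^ 2 * outer_coeff P E (Suc n) - outer_symbol P n * outer_coeff P E n) / P ^ 4"

lemma geometric_half: "(\<lambda>n. M / 2 ^ n) sums (2 * M :: real)"
proof -
  have "(\<lambda>n. M * (1 / 2) ^ n) sums (M * (1 / (1 - 1 / 2)))"
    by (intro sums_mult geometric_sums) simp
  moreover have "M * (1 / 2) ^ n = M / 2 ^ n" for n by (simp add: power_one_over)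
  ultimately show ?thesis by (simp add: mult.commute)
qed

lemma dominated_halves:
  fixes f :: "nat \<Rightarrow> real"
  assumes "\<And>n. \<bar>f n\<bar> \<le> M / 2 ^ n"
  shows "summable f" "\<bar>suminf f\<bar> \<le> 2 * M"
proof -
  have s: "summable (\<lambda>n. \<bar>f n\<bar>)"
    by (rule summable_comparison_test'[OF sums_summable[OF geometric_half[of M]], of 0]) (simp add: assms)
  thus "summable f" by (rule summable_rabs_cancel)
  have "\<bar>suminf f\<bar> \<le> (\<Sum>n. \<bar>f n\<bar>)" using s by (rule summable_rabs)
  also have "\<dots> \<le> (\<Sum>n. M / 2 ^ n)" using assms s sums_summable[OF geometric_half[of M]] by (rule suminf_le)
  also have "\<dots> = 2 * M" using geometric_half by (rule sums_unique[symmetric])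
  finally show "\<bar>suminf f\<bar> \<le> 2 * M" .
qed

lemma inverse_one_minus_bounds:
  fixes P :: real assumes "P \<ge> 2" "d \<ge> 1"
  shows "1 \<le> 1 / (1 - 1 / P ^ d)" "1 / (1 - 1 / P ^ d) \<le> 2" "1 - 1 / P ^ d > 0"
proof -
  have "P ^ 1 \<le> P ^ d" using assms by (intro power_increasing) auto
  hence "P ^ d \<ge> 2" using assms by simp
  define y where "y = 1 / P ^ d"
  have y: "y \<le> 1 / 2" "0 \<le> y" using \<open>P ^ d \<ge> 2\<close> by (simp_all add: y_def)
  hence "1 \<le> 1 / (1 - y)" "1 / (1 - y) \<le> 2" "1 - y > 0" by (simp_all add: field_simps)
  thus "1 \<le> 1 / (1 - 1 / P ^ d)" "1 / (1 - 1 / P ^ d) \<le> 2" "1 - 1 / P ^ d > 0"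
    unfolding y_def .
qed

context
  fixes P M z :: real and a :: "nat \<Rightarrow> real" and d :: nat
  assumes P: "P \<ge> 2" and d: "d \<ge> 1" and a: "\<And>n. \<bar>a n\<bar> \<le> M / 2 ^ n" and z: "0 \<le> z" "z \<le> 1"
begin

lemma even_term_bound: "\<bar>a n * z ^ (2 * n + d)\<bar> \<le> M * z ^ d / 2 ^ n"
proof -
  have M: "0 \<le> M / 2 ^ n" using a[of n] by linarith
  have "\<bar>a n * z ^ (2 * n + d)\<bar> = \<bar>a n\<bar> * z ^ (2 * n + d)" using z by (simp add: abs_mult)
  also have "\<dots> \<le> M / 2 ^ n * z ^ d"
    using a[of n] z M by (intro mult_mono power_decreasing) auto
  finally show ?thesis by simp
qed

lemma sum_term_bound: "\<bar>a n * z ^ (2 * n + d) / (1 - 1 / P ^ (2 * n + d))\<bar> \<le> 2 * M * z ^ d / 2 ^ n"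
proof -
  note b = inverse_one_minus_bounds[OF P, of "2 * n + d"]
  have "\<bar>a n * z ^ (2 * n + d) / (1 - 1 / P ^ (2 * n + d))\<bar>
      = \<bar>a n * z ^ (2 * n + d)\<bar> * (1 / (1 - 1 / P ^ (2 * n + d)))"
    using b(3) d by (simp add: abs_mult)
  also have "\<dots> \<le> M * z ^ d / 2 ^ n * 2"
    using even_term_bound[of n] b d by (intro mult_mono) auto
  also have "\<dots> = 2 * M * z ^ d / 2 ^ n" by simp
  finally show ?thesis .
qed

lemma even_series_sums: "(\<lambda>n. a n * z ^ (2 * n + d)) sums even_series a d z"
  unfolding even_series_def using dominated_halves(1)[OF even_term_bound] by (rule summable_sums)

lemma even_series_bound: "\<bar>even_series a d z\<bar> \<le> 2 * (M * z ^ d)"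
  unfolding even_series_def using dominated_halves(2)[OF even_term_bound] by simp

lemma sum_series_sums: "(\<lambda>n. a n * z ^ (2 * n + d) / (1 - 1 / P ^ (2 * n + d))) sums sum_series P a d z"
  unfolding sum_series_def using dominated_halves(1)[OF sum_term_bound] by (rule summable_sums)

lemma sum_series_bound: "\<bar>sum_series P a d z\<bar> \<le> 4 * (M * z ^ d)"
  unfolding sum_series_def using dominated_halves(2)[OF sum_term_bound] by simp

end

lemma sum_series_step:
  assumes P: "P \<ge> 2" and d: "d \<ge> 1" and a: "\<And>n. \<bar>a n\<bar> \<le> M / 2 ^ n" and z: "0 \<le> z" "z \<le> 1"
  shows "sum_series P a d z - sum_series P a d (z / P) = even_series a d z"
proof -
  have cancel: "(y - y * (1 - q)) / q = y" if "q \<noteq> 0" for y q :: real using that by (simp add: right_diff_distrib)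
  have z': "0 \<le> z / P" "z / P \<le> 1" using z P by (simp_all add: divide_simps)
  have "(\<lambda>n. a n * z ^ (2 * n + d) / (1 - 1 / P ^ (2 * n + d)) - a n * (z / P) ^ (2 * n + d) / (1 - 1 / P ^ (2 * n + d)))
      sums (sum_series P a d z - sum_series P a d (z / P))"
    by (intro sums_diff sum_series_sums[OF P d a z] sum_series_sums[OF P d a z'])
  moreover have "a n * z ^ (2 * n + d) / (1 - 1 / P ^ (2 * n + d)) - a n * (z / P) ^ (2 * n + d) / (1 - 1 / P ^ (2 * n + d))
      = a n * z ^ (2 * n + d)" for n
  proof -
    let ?q = "1 - 1 / P ^ (2 * n + d)"
    have "?q > 0" by (rule inverse_one_minus_bounds(3)[OF P]) (use d in simp)
    hence "?q \<noteq> 0" by (rule less_imp_neq[THEN not_sym])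
    moreover have "a n * (z / P) ^ (2 * n + d) = a n * z ^ (2 * n + d) * (1 - ?q)" by (simp add: power_divide)
    ultimately show ?thesis using cancel[of ?q "a n * z ^ (2 * n + d)"]
      by (simp only: diff_divide_distrib not_False_eq_True simp_thms)
  qed
  ultimately have "(\<lambda>n. a n * z ^ (2 * n + d)) sums (sum_series P a d z - sum_series P a d (z / P))" by (simp only:)
  thus ?thesis using even_series_sums[OF P d a z] by (rule sums_unique2)
qed

lemma vladimirov_const_bounds:
  assumes "P \<ge> 2" shows "0 < vladimirov_const P" "vladimirov_const P \<le> P ^ 2" "vladimirov_const P / (P ^ 2 - 1) = P ^ 2 / (P ^ 2 + P + 1)"
proof -
  have "P ^ 2 \<ge> 2 * P" using assms by (simp add: power2_eq_square)
  hence P2: "P ^ 2 > 1" using assms by linarith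
  have D: "P ^ 2 + P + 1 > 0" using P2 assms by linarith
  show "0 < vladimirov_const P" using P2 D unfolding vladimirov_const_def by (intro divide_pos_pos mult_pos_pos) auto
  have "P ^ 2 * (P ^ 2 - 1) \<le> P ^ 2 * (P ^ 2 + P + 1)" using assms by (intro mult_left_mono) auto
  thus "vladimirov_const P \<le> P ^ 2" using D by (simp add: vladimirov_const_def pos_divide_le_eq)
  show "vladimirov_const P / (P ^ 2 - 1) = P ^ 2 / (P ^ 2 + P + 1)" using P2 by (simp add: vladimirov_const_def)
qed

text \<open>
  The two fractions in the symbol are ordered, so it exceeds \<open>P^2\<close>; dividing by it makes the
  recursion for the coefficients contract.
\<close>

lemma inner_symbol_ge: assumes P: "P \<ge> 2" shows "P ^ 2 \<le> inner_symbol P n"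
proof -
  have "P ^ (2 * n + 2) \<le> P ^ (2 * n + 5)" using P by (intro power_increasing) auto
  hence "1 / P ^ (2 * n + 5) \<le> 1 / P ^ (2 * n + 2)" using P by (intro divide_left_mono) auto
  hence "1 / (1 - 1 / P ^ (2 * n + 5)) \<le> 1 / (1 - 1 / P ^ (2 * n + 2))"
    using inverse_one_minus_bounds(3)[OF P, of "2 * n + 2"] inverse_one_minus_bounds(3)[OF P, of "2 * n + 5"]
    by (intro divide_left_mono mult_pos_pos) auto
  thus ?thesis unfolding inner_symbol_def using vladimirov_const_bounds(1)[OF P] by simp
qed

lemma inner_symbol_0_le: assumes P: "P \<ge> 2" shows "inner_symbol P 0 \<le> P ^ 2 + 1"
proof -
  have P2: "P ^ 2 \<ge> 4" using power_mono[OF P, of 2] by simp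
  have "1 / (1 - 1 / P ^ (2 * 0 + 2)) - 1 / (1 - 1 / P ^ (2 * 0 + 5)) \<le> 1 / (1 - 1 / P ^ 2) - 1"
    using inverse_one_minus_bounds(1)[OF P, of 5] by (simp add: power2_eq_square)
  also have "\<dots> = 1 / (P ^ 2 - 1)" using P P2 by (simp add: divide_simps)
  finally have "vladimirov_const P * (1 / (1 - 1 / P ^ (2 * 0 + 2)) - 1 / (1 - 1 / P ^ (2 * 0 + 5))) \<le> vladimirov_const P * (1 / (P ^ 2 - 1))"
    using vladimirov_const_bounds(1)[OF P] by (intro mult_left_mono) auto
  also have "\<dots> = P ^ 2 / (P ^ 2 + P + 1)" using vladimirov_const_bounds(3)[OF P] by simp
  also have "\<dots> \<le> 1" using P P2 by (simp add: divide_simps)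
  finally show ?thesis by (simp add: inner_symbol_def)
qed

lemma outer_symbol_bounds: assumes P: "P \<ge> 2" shows "0 \<le> outer_symbol P n" "outer_symbol P n \<le> 2 * P ^ 2"
proof -
  have P2: "P ^ 2 \<ge> 4" using power_mono[OF P, of 2] by simp
  have "P ^ (2 * n + 4) \<le> P ^ (2 * n + 7)" "P ^ 2 \<le> P ^ (2 * n + 4)"
    using P by (intro power_increasing; simp)+
  hence le: "1 < P ^ (2 * n + 4)" "P ^ (2 * n + 4) \<le> P ^ (2 * n + 7)" "P ^ 2 - 1 \<le> P ^ (2 * n + 4) - 1" using P2 by linarith+
  let ?D = "1 / (P ^ (2 * n + 4) - 1) - 1 / (P ^ (2 * n + 7) - 1)"
  have "1 / (P ^ (2 * n + 7) - 1) \<le> 1 / (P ^ (2 * n + 4) - 1)" "0 \<le> 1 / (P ^ (2 * n + 7) - 1)"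
    using le by (simp_all add: divide_simps)
  hence D: "0 \<le> ?D" "?D \<le> 1 / (P ^ (2 * n + 4) - 1)" by linarith+
  have "1 / (P ^ (2 * n + 4) - 1) \<le> 1" using le P2 by (simp add: divide_simps)
  hence "?D \<le> 1" using D by linarith
  hence "vladimirov_const P * ?D \<le> vladimirov_const P * 1" using vladimirov_const_bounds(1)[OF P] by (intro mult_left_mono) auto
  moreover have "0 \<le> vladimirov_const P * ?D" using vladimirov_const_bounds(1)[OF P] D by simp
  ultimately show "0 \<le> outer_symbol P n" "outer_symbol P n \<le> 2 * P ^ 2"
    unfolding outer_symbol_def using vladimirov_const_bounds(2)[OF P] P2 by linarith+
qed

text \<open>
  If the bound holds at \<open>n\<close> and \<open>n + 1\<close>, then the right-hand side at \<open>n\<close> is at most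
  \<open>M / 2^n\<close> times \<open>(3/2 + 2) / P^2\<close>, which is below \<open>1/4\<close> for \<open>P \<ge> 4\<close>. The constants 3 and 2
  are what \<open>E \<le> 3\<close> and the bounds for the symbols give.
\<close>

lemma three_term_bound:
  fixes a :: "nat \<Rightarrow> real"
  assumes P: "P \<ge> 4" and "\<bar>a 0\<bar> \<le> M" "\<bar>a 1\<bar> \<le> M / 2"
    and rec: "\<And>n. \<bar>a (Suc (Suc n))\<bar> \<le> (3 * \<bar>a (Suc n)\<bar> + 2 * \<bar>a n\<bar>) / P ^ 2"
  shows "\<bar>a n\<bar> \<le> M / 2 ^ n"
proof -
  have P2: "P ^ 2 \<ge> 16" using power_mono[OF P, of 2] by simp
  have "\<bar>a n\<bar> \<le> M / 2 ^ n \<and> \<bar>a (Suc n)\<bar> \<le> M / 2 ^ Suc n"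
  proof (induction n)
    case (Suc n)
    have "3 * \<bar>a (Suc n)\<bar> + 2 * \<bar>a n\<bar> \<le> 3 * (M / 2 ^ Suc n) + 2 * (M / 2 ^ n)" using Suc by linarith
    also have "\<dots> = M / 2 ^ n * (7 / 2)" by simp
    finally have "\<bar>a (Suc (Suc n))\<bar> \<le> M / 2 ^ n * (7 / 2) / P ^ 2"
      using rec[of n] P2 divide_right_mono[of _ "M / 2 ^ n * (7 / 2)" "P ^ 2"] by fastforce
    also have "\<dots> = M / 2 ^ n * (7 / 2 / P ^ 2)" by simp
    also have "\<dots> \<le> M / 2 ^ n * (1 / 4)"
    proof (rule mult_left_mono)
      have "7 / 2 / Q \<le> 1 / 4" if "Q \<ge> 16" for Q :: real using that by (simp add: field_simps)
      thus "7 / 2 / P ^ 2 \<le> 1 / 4" using P2 .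
      show "0 \<le> M / 2 ^ n" using order_trans[OF abs_ge_zero conjunct1[OF Suc]] .
    qed
    finally show ?case using Suc by simp
  qed (use assms in auto)
  thus ?thesis by blast
qed

context
  fixes P E :: real
  assumes P: "P \<ge> 4" and E: "1 \<le> E" "E \<le> 3"
begin

lemma P_square: "P ^ 2 \<ge> 16" using power_mono[OF P, of 2] by simp

lemma divide_inner_symbol:
  assumes "\<bar>x\<bar> \<le> y" shows "\<bar>x / inner_symbol P n\<bar> \<le> y / P ^ 2"
proof -
  have "P ^ 2 \<le> inner_symbol P n" using P by (intro inner_symbol_ge) simp
  moreover have "0 < P ^ 2" using P_square by linarith
  ultimately show ?thesis using assms unfolding abs_divide
    by (intro frac_le) auto
qed

lemma abs_E_mult: "\<bar>E * x - y\<bar> \<le> 3 * \<bar>x\<bar> + \<bar>y\<bar>"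
proof -
  have "\<bar>E * x\<bar> \<le> 3 * \<bar>x\<bar>" using E by (simp add: abs_mult mult_right_mono)
  thus ?thesis by linarith
qed

lemma inner_coeff_0: "\<bar>inner_coeff P E 0\<bar> \<le> 1 / P ^ 2"
  using divide_inner_symbol[of "- 1" 1 0] by simp

lemma inner_coeff_1: "\<bar>inner_coeff P E 1\<bar> \<le> 3 / P ^ 4"
proof -
  have "\<bar>E * inner_coeff P E 0\<bar> \<le> 3 / P ^ 2" using abs_E_mult[of "inner_coeff P E 0" 0] inner_coeff_0 by simp
  from divide_inner_symbol[OF this, of 1] show ?thesis by simp
qed

lemma inner_coeff_rec:
  "\<bar>inner_coeff P E (Suc (Suc n))\<bar> \<le> (3 * \<bar>inner_coeff P E (Suc n)\<bar> + \<bar>inner_coeff P E n\<bar>) / P ^ 2"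
  using divide_inner_symbol[OF abs_E_mult[of "inner_coeff P E (Suc n)" "inner_coeff P E n"], of "Suc (Suc n)"] by simp

lemma inner_coeff_rec':
  "\<bar>inner_coeff P E (Suc (Suc n))\<bar> \<le> (3 * \<bar>inner_coeff P E (Suc n)\<bar> + 2 * \<bar>inner_coeff P E n\<bar>) / P ^ 2"
  using inner_coeff_rec[of n] by (rule order_trans) (simp add: divide_right_mono)

lemma inverse_squares:
  "0 < 1 / P ^ 2" "16 * (1 / P ^ 2) ^ 2 \<le> 1 / P ^ 2" "c / P ^ 4 = c * (1 / P ^ 2) ^ 2"
proof -
  show pos: "0 < 1 / P ^ 2" using P by simp
  have "1 / Q \<le> 1 / 16" if "Q \<ge> 16" for Q :: real using that by (simp add: field_simps)
  hence "1 / P ^ 2 * (1 / P ^ 2) \<le> 1 / P ^ 2 * (1 / 16)" using P_square pos by (intro mult_left_mono) auto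
  thus "16 * (1 / P ^ 2) ^ 2 \<le> 1 / P ^ 2" by (simp add: power2_eq_square)
  have "(P ^ 2) ^ 2 = P ^ 4" by simp
  thus "c / P ^ 4 = c * (1 / P ^ 2) ^ 2" by (simp only: power_divide) simp
qed

lemma inner_coeff_bound: "\<bar>inner_coeff P E n\<bar> \<le> 1 / P ^ 2 / 2 ^ n"
proof (rule three_term_bound[where a = "inner_coeff P E", OF P _ _ inner_coeff_rec'])
  show "\<bar>inner_coeff P E 1\<bar> \<le> 1 / P ^ 2 / 2"
    using inner_coeff_1 inverse_squares(1,2)
    unfolding inverse_squares(3) le_divide_eq_numeral1(1) by linarith
qed (rule inner_coeff_0)

text \<open>
  All coefficients after \<open>c\<^sub>4\<close> are \<open>O(P^(-4))\<close>. Since \<open>D\<^sup>2\<close> carries a factor of size \<open>P^2\<close>, only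
  \<open>c\<^sub>4\<close>, of size \<open>P^(-2)\<close>, influences the energy to leading order.
\<close>

lemma inner_coeff_tail_bound: "\<bar>inner_coeff P E (Suc n)\<bar> \<le> 4 / P ^ 4 / 2 ^ n"
proof (rule three_term_bound[where a = "\<lambda>n. inner_coeff P E (Suc n)", OF P _ _ inner_coeff_rec'])
  have one: "\<bar>inner_coeff P E (Suc 0)\<bar> \<le> 3 * (1 / P ^ 2) ^ 2"
    using inner_coeff_1 unfolding inverse_squares(3) by simp
  thus "\<bar>inner_coeff P E (Suc 0)\<bar> \<le> 4 / P ^ 4"
    using zero_le_power2[of "1 / P ^ 2"] unfolding inverse_squares(3) by linarith
  have "3 * \<bar>inner_coeff P E (Suc 0)\<bar> + \<bar>inner_coeff P E 0\<bar> \<le> 2 * (1 / P ^ 2)"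
    using one inner_coeff_0 inverse_squares(1,2) by linarith
  hence "(3 * \<bar>inner_coeff P E (Suc 0)\<bar> + \<bar>inner_coeff P E 0\<bar>) / P ^ 2 \<le> 2 * (1 / P ^ 2) / P ^ 2"
    by (rule divide_right_mono) simp
  also have "2 * (1 / P ^ 2) / P ^ 2 = 2 * (1 / P ^ 2) ^ 2" by (simp add: power2_eq_square)
  finally show "\<bar>inner_coeff P E (Suc 1)\<bar> \<le> 4 / P ^ 4 / 2"
    using inner_coeff_rec[of 0] unfolding inverse_squares(3) One_nat_def by linarith
qed

lemma outer_coeff_bound: "\<bar>outer_coeff P E n\<bar> \<le> 1 / 2 ^ n"
proof (rule three_term_bound[OF P])
  show "\<bar>outer_coeff P E 1\<bar> \<le> 1 / 2" using E P_square by (simp add: divide_simps)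
  fix n
  have sym: "0 \<le> outer_symbol P n / P ^ 2" "outer_symbol P n / P ^ 2 \<le> 2"
    using outer_symbol_bounds[of P n] P P_square by (simp_all add: divide_simps)
  have "outer_coeff P E (Suc (Suc n))
      = (E * outer_coeff P E (Suc n) - outer_symbol P n / P ^ 2 * outer_coeff P E n) / P ^ 2"
    using P by (simp add: divide_simps power2_eq_square power4_eq_xxxx)
  moreover have "\<bar>E * outer_coeff P E (Suc n) - outer_symbol P n / P ^ 2 * outer_coeff P E n\<bar>
      \<le> 3 * \<bar>outer_coeff P E (Suc n)\<bar> + 2 * \<bar>outer_coeff P E n\<bar>"
  proof -
    have "\<bar>outer_symbol P n / P ^ 2 * outer_coeff P E n\<bar> \<le> 2 * \<bar>outer_coeff P E n\<bar>"
      unfolding abs_mult using sym by (intro mult_right_mono) auto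
    thus ?thesis using abs_E_mult[of "outer_coeff P E (Suc n)" "outer_symbol P n / P ^ 2 * outer_coeff P E n"] by linarith
  qed
  ultimately show "\<bar>outer_coeff P E (Suc (Suc n))\<bar> \<le> (3 * \<bar>outer_coeff P E (Suc n)\<bar> + 2 * \<bar>outer_coeff P E n\<bar>) / P ^ 2"
    by (simp only: abs_divide abs_power2 divide_right_mono zero_le_power2)
qed simp

end

text \<open>
  The coefficients are polynomials in \<open>E\<close>, and geometric bounds that are uniform in \<open>E\<close> carry
  continuity over to the series by the Weierstrass M-test.
\<close>

lemma continuous_inner_coeff:
  assumes "P \<ge> 2" shows "continuous_on A (\<lambda>E. inner_coeff P E n)"
proof -
  have nz: "inner_symbol P k \<noteq> 0" for k using inner_symbol_ge[OF assms, of k] power_mono[OF assms, of 2] by auto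
  have "continuous_on A (\<lambda>E. inner_coeff P E n) \<and> continuous_on A (\<lambda>E. inner_coeff P E (Suc n))"
    by (induction n) (auto intro!: continuous_intros simp: nz)
  thus ?thesis by blast
qed

lemma continuous_outer_coeff: "P \<ge> 2 \<Longrightarrow> continuous_on A (\<lambda>E. outer_coeff P E n)"
proof -
  assume "P \<ge> 2"
  hence "continuous_on A (\<lambda>E. outer_coeff P E n) \<and> continuous_on A (\<lambda>E. outer_coeff P E (Suc n))"
    by (induction n) (auto intro!: continuous_intros)
  thus ?thesis by blast
qed

lemma continuous_sum_series:
  assumes P: "P \<ge> 2" and d: "d \<ge> 1"
    and a: "\<And>x n. x \<in> A \<Longrightarrow> \<bar>a x n\<bar> \<le> M / 2 ^ n" "\<And>n. continuous_on A (\<lambda>x. a x n)"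
  shows "continuous_on A (\<lambda>x. sum_series P (a x) d 1)"
proof -
  have "uniform_limit A (\<lambda>n x. \<Sum>i<n. a x i * 1 ^ (2 * i + d) / (1 - 1 / P ^ (2 * i + d)))
          (\<lambda>x. \<Sum>i. a x i * 1 ^ (2 * i + d) / (1 - 1 / P ^ (2 * i + d))) sequentially"
  proof (rule Weierstrass_m_test)
    show "norm (a x n * 1 ^ (2 * n + d) / (1 - 1 / P ^ (2 * n + d))) \<le> 2 * M / 2 ^ n" if "x \<in> A" for n x
      using sum_term_bound[OF P d a(1)[OF that], of 1 n] by simp
    show "summable (\<lambda>n. 2 * M / 2 ^ n)" using geometric_half by (rule sums_summable)
  qed
  moreover have "continuous_on A (\<lambda>x. \<Sum>i<n. a x i * 1 ^ (2 * i + d) / (1 - 1 / P ^ (2 * i + d)))" for n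
    using inverse_one_minus_bounds(3)[OF P] d by (intro continuous_intros a(2)) (metis less_irrefl trans_le_add2)
  ultimately show ?thesis
    unfolding sum_series_def by (intro uniform_limit_theorem) auto
qed

section \<open>The energy as a fixed point\<close>

text \<open>
  Both symbols are one rational function, evaluated at \<open>A = P^(2n+2)\<close> and at \<open>A = P^(2n+4)\<close>; the
  factor \<open>P^3 - 1\<close> of the difference cancels the denominator of \<open>vladimirov_const\<close>, and what is left
  splits into the four factors of a quotient of gamma factors.
\<close>

lemma symbol_closed_form:
  fixes A P :: real
  assumes P: "P > 1" and A: "A > 1"
  shows "P ^ 2 + vladimirov_const P * (A / (A - 1) - A * P ^ 3 / (A * P ^ 3 - 1))
           = P ^ 2 * ((A * P ^ 2 - 1) * (A * P - 1)) / ((A - 1) * (A * P ^ 3 - 1))"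
proof -
  have "P ^ 3 > 1" using P by (simp add: one_less_power)
  hence "A * P ^ 3 > 1 * 1" using A by (intro mult_strict_mono) auto
  hence D: "A - 1 \<noteq> 0" "A * P ^ 3 - 1 \<noteq> 0" using A by auto
  have "P ^ 2 > 0" using P by simp
  hence Q: "P ^ 2 + P + 1 \<noteq> 0" using P by linarith
  define W where "W = (A - 1) * (A * P ^ 3 - 1)"
  have W: "W \<noteq> 0" using D by (simp add: W_def)
  have "A / (A - 1) - A * P ^ 3 / (A * P ^ 3 - 1) = A * (P ^ 3 - 1) / W"
    unfolding W_def diff_frac_eq[OF D] by (simp add: algebra_simps)
  also have "P ^ 3 - 1 = (P - 1) * (P ^ 2 + P + 1)" by (simp add: algebra_simps power2_eq_square power3_eq_cube)
  finally have "vladimirov_const P * (A / (A - 1) - A * P ^ 3 / (A * P ^ 3 - 1))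
      = P ^ 2 * (P ^ 2 - 1) / (P ^ 2 + P + 1) * (A * ((P - 1) * (P ^ 2 + P + 1)) / W)"
    by (simp only: vladimirov_const_def)
  also have "\<dots> = P ^ 2 * (A * (P ^ 2 - 1) * (P - 1)) / W"
  proof -
    have "a / y * (b * (c * y) / w) = a * (b * c) / w" if "y \<noteq> 0" for a b c w y :: real
      using that by simp
    from this[OF Q, of "P ^ 2 * (P ^ 2 - 1)" A "P - 1" W] show ?thesis by (simp add: mult_ac)
  qed
  also have "P ^ 2 + \<dots> = (P ^ 2 * W + P ^ 2 * (A * (P ^ 2 - 1) * (P - 1))) / W"
    using W by (simp add: add_divide_distrib)
  also have "P ^ 2 * W + P ^ 2 * (A * (P ^ 2 - 1) * (P - 1)) = P ^ 2 * ((A * P ^ 2 - 1) * (A * P - 1))"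
    unfolding W_def by (simp add: algebra_simps power2_eq_square power3_eq_cube)
  finally show ?thesis by (simp only: W_def)
qed

lemma one_minus_inverse:
  fixes x :: real assumes "x > 1" shows "1 - 1 / x = (x - 1) / x" "1 / (1 - 1 / x) = x / (x - 1)"
  using assms by (simp_all add: field_simps)

lemma inner_symbol_Gamma:
  assumes p: "p > 1"
  shows "Gamma_p p (2 * real n + 5) / Gamma_p p (2 * real n + 3) = inner_symbol (real p) n"
proof -
  define P A where "P = real p" and "A = P ^ (2 * n + 2)"
  have P: "P > 1" using p by (simp add: P_def)
  have A: "A > 1" using P by (simp add: A_def one_less_power del: power_Suc)
  have pos: "A * P > 1" "A * P ^ 3 > 1" "A * P ^ 2 > 1"
    using P A by (simp_all add: less_1_mult one_less_power)
  have pw: "P powr (2 * real n + 5 - 1) = A * P ^ 2" "P powr (- (2 * real n + 5)) = 1 / (A * P ^ 3)"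
    "P powr (2 * real n + 3 - 1) = A" "P powr (- (2 * real n + 3)) = 1 / (A * P)"
  proof -
    have e: "P powr real k = P ^ k" for k using P by (simp add: powr_realpow)
    have "2 * real n + 5 - 1 = real (2 * n + 2 + 2)" "2 * real n + 5 = real (2 * n + 2 + 3)"
      "2 * real n + 3 - 1 = real (2 * n + 2)" "2 * real n + 3 = real (2 * n + 2 + 1)" by simp_all
    thus "P powr (2 * real n + 5 - 1) = A * P ^ 2" "P powr (- (2 * real n + 5)) = 1 / (A * P ^ 3)"
      "P powr (2 * real n + 3 - 1) = A" "P powr (- (2 * real n + 3)) = 1 / (A * P)"
      by (simp_all only: powr_minus_divide e A_def power_add power_one_right)
  qed
  have "inner_symbol P n = P ^ 2 + vladimirov_const P * (A / (A - 1) - A * P ^ 3 / (A * P ^ 3 - 1))"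
  proof -
    have "2 * n + 5 = (2 * n + 2) + 3" by simp
    hence "P ^ (2 * n + 5) = A * P ^ 3" by (simp only: A_def power_add)
    thus ?thesis unfolding inner_symbol_def A_def[symmetric]
      by (simp only: one_minus_inverse(2)[OF A] one_minus_inverse(2)[OF pos(2)])
  qed
  also have "\<dots> = P ^ 2 * ((A * P ^ 2 - 1) * (A * P - 1)) / ((A - 1) * (A * P ^ 3 - 1))"
    by (rule symbol_closed_form[OF P A])
  also have "\<dots> = ((1 - A * P ^ 2) / ((A * P ^ 3 - 1) / (A * P ^ 3))) / ((1 - A) / ((A * P - 1) / (A * P)))"
  proof -
    have frac: "P ^ 2 * (b * c) / (a * d) = ((- b) / (d / (A * P ^ 3))) / ((- a) / (c / (A * P)))"
      if "a \<noteq> 0" "c \<noteq> 0" "d \<noteq> 0" for a b c d :: real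
      using that P A by (simp add: power2_eq_square power3_eq_cube mult_ac)
    have "A - 1 \<noteq> 0" "A * P - 1 \<noteq> 0" "A * P ^ 3 - 1 \<noteq> 0" using A pos by simp_all
    from frac[OF this, of "A * P ^ 2 - 1"] show ?thesis unfolding minus_diff_eq .
  qed
  finally show ?thesis
    unfolding Gamma_p_def P_def[symmetric] pw one_minus_inverse[OF pos(1)] one_minus_inverse[OF pos(2)] by simp
qed

lemma outer_symbol_Gamma:
  assumes p: "p > 1"
  shows "Gamma_p p (- 2 * real (n + 2)) / Gamma_p p (- 2 * real (n + 2) - 2) = outer_symbol (real p) n"
proof -
  define P A where "P = real p" and "A = P ^ (2 * n + 4)"
  have P: "P > 1" using p by (simp add: P_def)
  have A: "A > 1" using P by (simp add: A_def one_less_power del: power_Suc)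
  have pos: "A * P > 1" "A * P ^ 3 > 1" "A * P ^ 2 > 1"
    using P A by (simp_all add: less_1_mult one_less_power)
  have pw: "P powr (- 2 * real (n + 2) - 1) = 1 / (A * P)" "P powr (- (- 2 * real (n + 2))) = A"
    "P powr (- 2 * real (n + 2) - 2 - 1) = 1 / (A * P ^ 3)" "P powr (- (- 2 * real (n + 2) - 2)) = A * P ^ 2"
  proof -
    have e: "P powr real k = P ^ k" for k using P by (simp add: powr_realpow)
    have "- 2 * real (n + 2) - 1 = - real (2 * n + 4 + 1)" "- (- 2 * real (n + 2)) = real (2 * n + 4)"
      "- 2 * real (n + 2) - 2 - 1 = - real (2 * n + 4 + 3)" "- (- 2 * real (n + 2) - 2) = real (2 * n + 4 + 2)" by simp_all
    thus "P powr (- 2 * real (n + 2) - 1) = 1 / (A * P)" "P powr (- (- 2 * real (n + 2))) = A"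
      "P powr (- 2 * real (n + 2) - 2 - 1) = 1 / (A * P ^ 3)" "P powr (- (- 2 * real (n + 2) - 2)) = A * P ^ 2"
      by (simp_all only: powr_minus_divide e A_def power_add power_one_right)
  qed
  have "outer_symbol P n = P ^ 2 + vladimirov_const P * (A / (A - 1) - A * P ^ 3 / (A * P ^ 3 - 1))"
  proof -
    have "2 * n + 7 = (2 * n + 4) + 3" by simp
    hence "P ^ (2 * n + 7) = A * P ^ 3" by (simp only: A_def power_add)
    moreover have "1 / (x - 1) = x / (x - 1) - 1" if "x > 1" for x :: real using that by (simp add: field_simps)
    hence "1 / (A - 1) - 1 / (A * P ^ 3 - 1) = A / (A - 1) - A * P ^ 3 / (A * P ^ 3 - 1)" using A pos by simp
    ultimately show ?thesis unfolding outer_symbol_def A_def[symmetric] by (simp only:)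
  qed
  also have "\<dots> = P ^ 2 * ((A * P ^ 2 - 1) * (A * P - 1)) / ((A - 1) * (A * P ^ 3 - 1))"
    by (rule symbol_closed_form[OF P A])
  also have "\<dots> = (((A * P - 1) / (A * P)) / (1 - A)) / (((A * P ^ 3 - 1) / (A * P ^ 3)) / (1 - A * P ^ 2))"
  proof -
    have frac: "P ^ 2 * (b * c) / (a * d) = ((c / (A * P)) / (- a)) / ((d / (A * P ^ 3)) / (- b))"
      if "a \<noteq> 0" "c \<noteq> 0" "d \<noteq> 0" for a b c d :: real
      using that P A by (simp add: power2_eq_square power3_eq_cube mult_ac)
    have "A - 1 \<noteq> 0" "A * P - 1 \<noteq> 0" "A * P ^ 3 - 1 \<noteq> 0" using A pos by simp_all
    from frac[OF this, of "A * P ^ 2 - 1"] show ?thesis unfolding minus_diff_eq .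
  qed
  finally show ?thesis
    unfolding Gamma_p_def P_def[symmetric] pw one_minus_inverse[OF pos(1)] one_minus_inverse[OF pos(2)] by simp
qed

text \<open>
  The value of \<open>k\<^sub>5\<close> that removes the \<open>|x|^(-3)\<close> term outside the unit ball when \<open>c\<^sub>0 = 1\<close>. The
  condition is linear in \<open>k\<^sub>5\<close>, which also occurs in the term it has to compensate; hence the
  denominator.
\<close>

definition outer_amp :: "real \<Rightarrow> real \<Rightarrow> real" where
  "outer_amp P E = vladimirov_const P * (P / (P - 1) + sum_series P (inner_coeff P E) 5 1)
     / (1 - vladimirov_const P / P ^ 4 * sum_series P (outer_coeff P E) 4 1)"

text \<open>
  The value of \<open>D\<^sup>2 \<psi>\<close> at the origin, for the coefficients that belong to the parameter \<open>E\<close>: the sum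
  of \<open>1 - u\<^sub>j\<close> against \<open>P^(-2j)\<close>. As \<open>\<psi>(0) = 1\<close>, the equation at the origin reads
  \<open>level P E = E\<close>.
\<close>

definition level :: "real \<Rightarrow> real \<Rightarrow> real" where
  "level P E = vladimirov_const P * (1 / (P ^ 2 - 1) - sum_series P (inner_coeff P E) 2 1
     - outer_amp P E / P ^ 7 * sum_series P (outer_coeff P E) 7 1)"

context
  fixes P E :: real
  assumes P: "P \<ge> 4" and E: "1 \<le> E" "E \<le> 3"
begin

lemma inner_sum_bound: "d \<ge> 1 \<Longrightarrow> \<bar>sum_series P (inner_coeff P E) d 1\<bar> \<le> 4 / P ^ 2"
  using sum_series_bound[OF _ _ inner_coeff_bound[OF P E], of P d 1] P by simp

lemma outer_sum_bound: "d \<ge> 1 \<Longrightarrow> \<bar>sum_series P (outer_coeff P E) d 1\<bar> \<le> 4"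
  using sum_series_bound[OF _ _ outer_coeff_bound[OF P E], of P d 1] P by simp

lemma const_ratio: "vladimirov_const P / P ^ 4 \<le> 1 / P ^ 2" "0 \<le> vladimirov_const P / P ^ 4" "1 / P ^ 2 \<le> 1 / 16"
proof -
  have "vladimirov_const P / P ^ 4 \<le> P ^ 2 / P ^ 4"
    using vladimirov_const_bounds[of P] P by (intro divide_right_mono) auto
  also have "P ^ 2 / P ^ 4 = 1 / P ^ 2"
  proof -
    have e: "P ^ 4 = P ^ 2 * P ^ 2" by (simp flip: power_add)
    show ?thesis unfolding e by (rule nonzero_divide_mult_cancel_left) (use P in simp)
  qed
  finally show "vladimirov_const P / P ^ 4 \<le> 1 / P ^ 2" .
  show "0 \<le> vladimirov_const P / P ^ 4" using vladimirov_const_bounds[of P] P by simp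
  show "1 / P ^ 2 \<le> 1 / 16" using P_square[OF P E] by (intro divide_left_mono) auto
qed

lemma outer_amp_denominator: "1 / 2 \<le> 1 - vladimirov_const P / P ^ 4 * sum_series P (outer_coeff P E) 4 1"
proof -
  have "\<bar>vladimirov_const P / P ^ 4\<bar> \<le> 1 / 16" using const_ratio by linarith
  from mult_mono[OF this outer_sum_bound[of 4]]
  have "\<bar>vladimirov_const P / P ^ 4 * sum_series P (outer_coeff P E) 4 1\<bar> \<le> 1 / 16 * 4"
    unfolding abs_mult by simp
  thus ?thesis by linarith
qed

lemma outer_amp_bound: "\<bar>outer_amp P E\<bar> \<le> 4 * P ^ 2"
proof -
  have "P / (P - 1) \<le> 4 / 3" "0 \<le> P / (P - 1)" using P by (simp_all add: field_simps)
  moreover have "\<bar>sum_series P (inner_coeff P E) 5 1\<bar> \<le> 1 / 4"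
    using inner_sum_bound[of 5] const_ratio(3) by simp
  ultimately have "\<bar>P / (P - 1) + sum_series P (inner_coeff P E) 5 1\<bar> \<le> 2" by linarith
  hence "\<bar>vladimirov_const P * (P / (P - 1) + sum_series P (inner_coeff P E) 5 1)\<bar> \<le> P ^ 2 * 2"
    unfolding abs_mult using vladimirov_const_bounds[of P] P by (intro mult_mono) auto
  moreover have "1 / 2 \<le> \<bar>1 - vladimirov_const P / P ^ 4 * sum_series P (outer_coeff P E) 4 1\<bar>"
    using outer_amp_denominator by linarith
  ultimately have "\<bar>outer_amp P E\<bar> \<le> P ^ 2 * 2 / (1 / 2)"
    unfolding outer_amp_def abs_divide by (intro frac_le[rotated 3]) simp_all
  thus ?thesis by simp
qed

text \<open>
  With \<open>A = P^2 / (P^2 + P + 1)\<close> the constant term gives \<open>A\<close>, and the term of \<open>c\<^sub>4\<close> gives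
  \<open>A P^2 / inner_symbol P 0\<close>; both agree with \<open>1 - 1/P\<close> up to a few multiples of \<open>P^(-2)\<close>. The
  remaining inner coefficients contribute at most \<open>16 P^(-2)\<close>, and the outer series is damped by
  \<open>P^(-7)\<close> against an amplitude of size at most \<open>4 P^2\<close>.
\<close>

lemma level_estimate: "\<bar>level P E - (2 - 2 / P)\<bar> \<le> 30 / P ^ 2"
proof -
  let ?K = "vladimirov_const P" and ?v = "inner_coeff P E"
  define q where "q = 1 / P ^ 2"
  have q: "0 < q" "q \<le> 1 / 16" using P const_ratio(3) by (simp_all add: q_def)
  have D: "P ^ 2 + P + 1 > 0" using P P_square[OF P E] by linarith
  define A where "A = P ^ 2 / (P ^ 2 + P + 1)"
  have A: "0 \<le> A" "A \<le> 1" "?K / (P ^ 2 - 1) = A"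
    using P P_square[OF P E] D vladimirov_const_bounds(3)[of P] by (simp_all add: A_def divide_simps)
  have "A - (1 - 1 / P) = 1 / (P * (P ^ 2 + P + 1))"
    using P D by (simp add: A_def divide_simps) (simp add: algebra_simps power2_eq_square)
  moreover have "0 \<le> 1 / (P * (P ^ 2 + P + 1))" using P D by simp
  moreover have "1 / (P * (P ^ 2 + P + 1)) \<le> 1 / P ^ 2"
  proof (intro divide_left_mono)
    have "P ^ 2 + P + 1 \<ge> P" using P_square[OF P E] by linarith
    thus "P ^ 2 \<le> P * (P ^ 2 + P + 1)" unfolding power2_eq_square using P by (intro mult_left_mono) auto
  qed (use P D in auto)
  ultimately have A': "\<bar>A - (1 - 1 / P)\<bar> \<le> q" by (simp add: q_def)
  have split: "sum_series P ?v 2 1 = ?v 0 / (1 - 1 / P ^ 2) + sum_series P (\<lambda>n. ?v (Suc n)) 4 1"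
  proof -
    have s: "summable (\<lambda>n. ?v n * 1 ^ (2 * n + 2) / (1 - 1 / P ^ (2 * n + 2)))"
      using sum_series_sums[OF _ _ inner_coeff_bound[OF P E], of P 2 1] P by (intro sums_summable) simp_all
    have e: "2 * Suc n + 2 = 2 * n + 4" for n by simp
    show ?thesis using suminf_split_head[OF s] unfolding sum_series_def e
      by (simp only: mult_0_right add_0 power_one mult_1_right)
  qed
  have "\<bar>sum_series P (\<lambda>n. ?v (Suc n)) 4 1\<bar> \<le> 4 * (4 / P ^ 4)"
    using sum_series_bound[OF _ _ inner_coeff_tail_bound[OF P E], of P 4 1] P by simp
  moreover have "0 < ?K" using vladimirov_const_bounds(1)[of P] P by simp
  ultimately have "\<bar>?K * sum_series P (\<lambda>n. ?v (Suc n)) 4 1\<bar> \<le> ?K * (4 * (4 / P ^ 4))"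
    unfolding abs_mult by (simp only: abs_of_pos mult_left_mono less_imp_le)
  also have "\<dots> = 16 * (?K / P ^ 4)" by simp
  also have "\<dots> \<le> 16 * q" using const_ratio(1) by (simp add: q_def)
  finally have tail: "\<bar>?K * sum_series P (\<lambda>n. ?v (Suc n)) 4 1\<bar> \<le> 16 * q" .
  have head: "- (?K * (?v 0 / (1 - 1 / P ^ 2))) = A * (P ^ 2 / inner_symbol P 0)"
  proof -
    have "1 - 1 / P ^ 2 = (P ^ 2 - 1) / P ^ 2" using P by (simp add: field_simps)
    thus ?thesis unfolding A(3)[symmetric] by simp
  qed
  have ratio: "1 - q \<le> P ^ 2 / inner_symbol P 0" "P ^ 2 / inner_symbol P 0 \<le> 1"
  proof -
    have sym: "P ^ 2 \<le> inner_symbol P 0" "inner_symbol P 0 \<le> P ^ 2 + 1"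
      using inner_symbol_ge[of P 0] inner_symbol_0_le[of P] P by simp_all
    thus "P ^ 2 / inner_symbol P 0 \<le> 1" using P_square[OF P E] by (simp add: divide_le_eq_1)
    have "(1 - q) * inner_symbol P 0 \<le> (1 - q) * (P ^ 2 + 1)" using sym q by (intro mult_left_mono) auto
    also have "\<dots> = P ^ 2 - q"
    proof -
      have "q * P ^ 2 = 1" using P by (simp add: q_def)
      thus ?thesis by (simp add: algebra_simps)
    qed
    also have "\<dots> \<le> P ^ 2" using q by simp
    finally show "1 - q \<le> P ^ 2 / inner_symbol P 0" using sym P_square[OF P E] by (simp add: pos_le_divide_eq)
  qed
  have head': "\<bar>A * (P ^ 2 / inner_symbol P 0) - A\<bar> \<le> q"
  proof -
    have "\<bar>A * (P ^ 2 / inner_symbol P 0) - A\<bar> = A * \<bar>P ^ 2 / inner_symbol P 0 - 1\<bar>"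
      using abs_mult[of A "P ^ 2 / inner_symbol P 0 - 1"] A(1) by (simp only: right_diff_distrib mult_1_right abs_of_nonneg)
    also have "\<dots> \<le> 1 * q" using A ratio by (intro mult_mono) auto
    finally show ?thesis by simp
  qed
  have "\<bar>?K * (outer_amp P E / P ^ 7 * sum_series P (outer_coeff P E) 7 1)\<bar> \<le> P ^ 2 * (4 * P ^ 2 / P ^ 7 * 4)"
  proof -
    have "\<bar>outer_amp P E\<bar> / P ^ 7 \<le> 4 * P ^ 2 / P ^ 7" using outer_amp_bound by (rule divide_right_mono) (use P in simp)
    hence "\<bar>outer_amp P E / P ^ 7\<bar> \<le> 4 * P ^ 2 / P ^ 7" using P by (simp add: abs_divide)
    moreover have "\<bar>?K\<bar> \<le> P ^ 2" using vladimirov_const_bounds[of P] P by simp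
    ultimately show ?thesis unfolding abs_mult using outer_sum_bound[of 7] P
      by (intro mult_mono) simp_all
  qed
  also have "\<dots> = 16 * (1 / P ^ 3)"
  proof -
    have e: "P ^ 7 = P ^ 2 * P ^ 2 * P ^ 3" by (simp flip: power_add)
    have cancel: "x * (4 * x / (x * x * y) * 4) = 16 * (1 / y)" if "x \<noteq> 0" for x y :: real using that by simp
    show ?thesis unfolding e by (rule cancel) (use P in simp)
  qed
  also have "\<dots> \<le> 16 * (q / 4)"
  proof -
    have "1 / P ^ 3 = q * (1 / P)" using P by (simp add: q_def power2_eq_square power3_eq_cube)
    also have "\<dots> \<le> q * (1 / 4)" using P q by (intro mult_left_mono divide_left_mono) auto
    finally show ?thesis by simp
  qed
  finally have outer: "\<bar>?K * (outer_amp P E / P ^ 7 * sum_series P (outer_coeff P E) 7 1)\<bar> \<le> 4 * q" by simp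
  have "level P E = A - ?K * (?v 0 / (1 - 1 / P ^ 2)) - ?K * sum_series P (\<lambda>n. ?v (Suc n)) 4 1
      - ?K * (outer_amp P E / P ^ 7 * sum_series P (outer_coeff P E) 7 1)"
    unfolding level_def split A(3)[symmetric] by (simp only: right_diff_distrib distrib_left times_divide_eq_right mult_1_right)
  hence "level P E = A + A * (P ^ 2 / inner_symbol P 0) - ?K * sum_series P (\<lambda>n. ?v (Suc n)) 4 1
      - ?K * (outer_amp P E / P ^ 7 * sum_series P (outer_coeff P E) 7 1)"
    using head by linarith
  hence "\<bar>level P E - (2 - 2 * (1 / P))\<bar> \<le> 30 * q"
    using A' head' tail outer q by linarith
  thus ?thesis by (simp add: q_def)
qed

end

lemma continuous_level:
  assumes P: "P \<ge> 4" shows "continuous_on {1..3} (level P)"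
proof -
  have P': "P \<ge> 2" using P by simp
  have i: "continuous_on {1..3} (\<lambda>E. sum_series P (inner_coeff P E) d 1)" if "d \<ge> 1" for d
    by (rule continuous_sum_series[OF P' that inner_coeff_bound[OF P] continuous_inner_coeff[OF P']]) auto
  have o: "continuous_on {1..3} (\<lambda>E. sum_series P (outer_coeff P E) d 1)" if "d \<ge> 1" for d
    by (rule continuous_sum_series[OF P' that outer_coeff_bound[OF P] continuous_outer_coeff[OF P']]) auto
  have "continuous_on {1..3} (outer_amp P)"
    unfolding outer_amp_def using outer_amp_denominator[OF P]
    by (intro continuous_intros i o) fastforce+
  thus ?thesis unfolding level_def using P
    by (intro continuous_intros i o) auto
qed

text \<open>
  For \<open>P \<ge> 8\<close> the estimate keeps \<open>level P E\<close> between 1 and 3, so the intermediate value theorem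
  gives a fixed point, and there the estimate speaks about \<open>E\<close> itself.
\<close>

lemma level_fixed_point:
  assumes P: "P \<ge> 8"
  obtains E where "1 \<le> E" "E \<le> 3" "level P E = E" "\<bar>E - (2 - 2 / P)\<bar> \<le> 30 / P ^ 2"
proof -
  have P4: "P \<ge> 4" using P by simp
  have P2: "P ^ 2 \<ge> 64" using power_mono[OF P, of 2] by simp
  have "30 / P ^ 2 \<le> 30 / 64" using P2 by (intro divide_left_mono) auto
  moreover have "2 / P \<le> 2 / 8" "0 \<le> 2 / P" using P by (simp_all add: divide_simps)
  ultimately have range: "1 \<le> level P E" "level P E \<le> 3" if "1 \<le> E" "E \<le> 3" for E
    using level_estimate[OF P4 that] by linarith+
  have "continuous_on {1..3} (\<lambda>E. level P E - E)"
    by (intro continuous_intros continuous_level P4)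
  then obtain E where "1 \<le> E" "E \<le> 3" "level P E - E = 0"
    using IVT2'[of "\<lambda>E. level P E - E" 3 0 1] range[of 1] range[of 3] by auto
  thus ?thesis using that level_estimate[OF P4, of E] by simp
qed

section \<open>The equation inside and outside the unit ball\<close>

lemma even_series_shift:
  assumes d: "d \<ge> 1" and a: "\<And>n. \<bar>a n\<bar> \<le> M / 2 ^ n" and z: "0 \<le> z" "z \<le> 1"
  shows "even_series a (d + k) z = z ^ k * even_series a d z"
proof -
  have "(\<lambda>n. z ^ k * (a n * z ^ (2 * n + d))) sums (z ^ k * even_series a d z)"
    by (intro sums_mult even_series_sums[of 2, OF _ d a z]) simp
  moreover have "z ^ k * (a n * z ^ (2 * n + d)) = a n * z ^ (2 * n + (d + k))" for n
    by (simp only: power_add mult_ac)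
  ultimately show ?thesis unfolding even_series_def by (simp only: sums_iff)
qed

context
  fixes P E :: real
  assumes P: "P \<ge> 4" and E: "1 \<le> E" "E \<le> 3"
begin

lemma P_ge_2: "P \<ge> 2" using P by simp

lemma K_pos: "vladimirov_const P > 0" using vladimirov_const_bounds(1)[OF P_ge_2] .

lemma inner_symbol_pos: "inner_symbol P n > 0"
  using inner_symbol_ge[OF P_ge_2, of n] P_square[OF P E] by linarith

lemma K_symbol:
  "vladimirov_const P * ((P ^ 2 + P + 1) / (P ^ 2 - 1)) = P ^ 2"
  "(P ^ 2 + P + 1) / (P ^ 2 - 1) = P / (P - 1) + 1 / (P ^ 2 - 1)"
proof -
  have "P ^ 2 - 1 \<noteq> 0" "P ^ 2 + P + 1 \<noteq> 0" using P P_square[OF P E] by linarith+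
  thus "vladimirov_const P * ((P ^ 2 + P + 1) / (P ^ 2 - 1)) = P ^ 2"
    by (simp add: vladimirov_const_def)
  have f: "P ^ 2 - 1 = (P - 1) * (P + 1)" by (simp add: algebra_simps power2_eq_square)
  have "P / (P - 1) = P * (P + 1) / (P ^ 2 - 1)" unfolding f using P by simp
  thus "(P ^ 2 + P + 1) / (P ^ 2 - 1) = P / (P - 1) + 1 / (P ^ 2 - 1)"
    by (simp add: add_divide_distrib[symmetric] algebra_simps power2_eq_square)
qed

text \<open>
  The left-hand side is the series with coefficients \<open>inner_symbol\<close> times \<open>inner_coeff\<close>, summed
  term by term; the right-hand side is what the recursion makes of these products. The first term
  of the recursion sees \<open>c\<^sub>0 = 1\<close>, which gives \<open>- z^2\<close>, and the second sees \<open>c\<^sub>2 = 0\<close>.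
\<close>

lemma inner_series_equation:
  assumes z: "0 < z" "z \<le> 1"
  defines "e \<equiv> even_series (inner_coeff P E) 4 z"
  shows "P ^ 2 * (e / z ^ 2) - vladimirov_const P * (sum_series P (inner_coeff P E) 5 z / z ^ 3)
      + vladimirov_const P * sum_series P (inner_coeff P E) 2 z = - (z ^ 2) + E * e - z ^ 2 * e"
proof -
  let ?v = "inner_coeff P E" and ?K = "vladimirov_const P"
  have z': "0 \<le> z" using z by simp
  note b = inner_coeff_bound[OF P E]
  have se: "(\<lambda>n. ?v n * z ^ (2 * n + 4)) sums e"
    unfolding e_def by (rule even_series_sums[OF P_ge_2 _ b z' z(2)]) simp
  have s5: "(\<lambda>n. ?v n * z ^ (2 * n + 5) / (1 - 1 / P ^ (2 * n + 5))) sums sum_series P ?v 5 z"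
    by (rule sum_series_sums[OF P_ge_2 _ b z' z(2)]) simp
  have s2: "(\<lambda>n. ?v n * z ^ (2 * n + 2) / (1 - 1 / P ^ (2 * n + 2))) sums sum_series P ?v 2 z"
    by (rule sum_series_sums[OF P_ge_2 _ b z' z(2)]) simp
  define f where "f = (\<lambda>n. inner_symbol P n * ?v n * z ^ (2 * n + 2))"
  have "(\<lambda>n. P ^ 2 * (?v n * z ^ (2 * n + 4) / z ^ 2)
        - ?K * (?v n * z ^ (2 * n + 5) / (1 - 1 / P ^ (2 * n + 5)) / z ^ 3)
        + ?K * (?v n * z ^ (2 * n + 2) / (1 - 1 / P ^ (2 * n + 2))))
      sums (P ^ 2 * (e / z ^ 2) - ?K * (sum_series P ?v 5 z / z ^ 3) + ?K * sum_series P ?v 2 z)"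
    by (intro sums_add sums_diff sums_mult sums_divide se s5 s2)
  moreover have "P ^ 2 * (?v n * z ^ (2 * n + 4) / z ^ 2)
        - ?K * (?v n * z ^ (2 * n + 5) / (1 - 1 / P ^ (2 * n + 5)) / z ^ 3)
        + ?K * (?v n * z ^ (2 * n + 2) / (1 - 1 / P ^ (2 * n + 2))) = f n" for n
  proof -
    have "2 * n + 4 = (2 * n + 2) + 2" "2 * n + 5 = (2 * n + 2) + 3" by simp_all
    hence e: "z ^ (2 * n + 4) = z ^ (2 * n + 2) * z ^ 2" "z ^ (2 * n + 5) = z ^ (2 * n + 2) * z ^ 3"
      by (simp_all only: power_add)
    have regroup: "c * (v * (x * s) / s) - k * (v * (x * t) / A / t) + k * (v * x / B) = (c + k * (1 / B - 1 / A)) * v * x"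
      if "s \<noteq> 0" "t \<noteq> 0" for c v x s t k A B :: real
      using that by (simp add: algebra_simps)
    show ?thesis unfolding e f_def inner_symbol_def by (rule regroup) (use z in simp_all)
  qed
  ultimately have lhs: "f sums (P ^ 2 * (e / z ^ 2) - ?K * (sum_series P ?v 5 z / z ^ 3) + ?K * sum_series P ?v 2 z)"
    by (simp only:)
  (* The coefficients shifted by one place, with the zero that stands for c_2 in front. *)
  define v' where "v' = (\<lambda>n. if n = 0 then 0 else ?v (n - 1))"
  have "(\<lambda>n. v' (Suc n) * z ^ (2 * Suc n + 4)) sums (z ^ 2 * e)"
  proof -
    have "v' (Suc n) * z ^ (2 * Suc n + 4) = z ^ 2 * (?v n * z ^ (2 * n + 4))" for n
    proof -
      have "2 * Suc n + 4 = 2 + (2 * n + 4)" by simp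
      hence "z ^ (2 * Suc n + 4) = z ^ 2 * z ^ (2 * n + 4)" by (simp only: power_add)
      thus ?thesis by (simp add: v'_def)
    qed
    thus ?thesis using sums_mult[OF se, of "z ^ 2"] by (simp only:)
  qed
  from sums_Suc[OF this] have sv': "(\<lambda>n. v' n * z ^ (2 * n + 4)) sums (z ^ 2 * e)" by (simp add: v'_def)
  have rec: "inner_symbol P (Suc n) * ?v (Suc n) = E * ?v n - v' n" for n
    using inner_symbol_pos[of "Suc n"] by (cases n) (simp_all add: v'_def)
  have e: "2 * Suc n + 2 = 2 * n + 4" for n by simp
  have "f (Suc n) = E * (?v n * z ^ (2 * n + 4)) - v' n * z ^ (2 * n + 4)" for n
    unfolding f_def rec e by (simp only: left_diff_distrib mult.assoc)
  hence "(\<lambda>n. f (Suc n)) sums (E * e - z ^ 2 * e)"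
    using sums_diff[OF sums_mult[OF se, of E] sv'] by (simp only:)
  from sums_Suc[OF this] have "f sums (E * e - z ^ 2 * e + f 0)" .
  moreover have "f 0 = - (z ^ 2)" using inner_symbol_pos[of 0] by (simp add: f_def power2_eq_square)
  ultimately have "f sums (- (z ^ 2) + E * e - z ^ 2 * e)" by (simp add: algebra_simps)
  with lhs show ?thesis by (rule sums_unique2)
qed

text \<open>
  The expressions for \<open>I\<close> and \<open>T\<close> are those of \<open>mass_below\<close> and \<open>mass_above\<close> below. The multiples
  of \<open>1 / z^2\<close> cancel because \<open>D\<^sup>2\<close> annihilates constants; the constant \<open>- E / K\<close> in \<open>T\<close> supplies
  the term \<open>E\<close> that belongs to \<open>c\<^sub>0 = 1\<close>.
\<close>

lemma inner_equation:
  assumes z: "0 < z" "z \<le> 1"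
  defines "u \<equiv> 1 + even_series (inner_coeff P E) 4 z"
  shows "vladimirov_const P * ((P ^ 2 + P + 1) / (P ^ 2 - 1) * (u * (1 / z ^ 2))
      - 1 / z ^ 3 * (z * (P / (P - 1)) + sum_series P (inner_coeff P E) 5 z)
      - (1 / z ^ 2 / (P ^ 2 - 1) - sum_series P (inner_coeff P E) 2 z - E / vladimirov_const P)) + z ^ 2 * u = E * u"
proof -
  define e where "e = even_series (inner_coeff P E) 4 z"
  let ?K = "vladimirov_const P" and ?S5 = "sum_series P (inner_coeff P E) 5 z" and ?S2 = "sum_series P (inner_coeff P E) 2 z"
  define k where "k = (P ^ 2 + P + 1) / (P ^ 2 - 1)"
  have k: "?K * k = P ^ 2" "k = P / (P - 1) + 1 / (P ^ 2 - 1)" using K_symbol by (simp_all add: k_def)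
  have "1 / z ^ 3 * (z * (P / (P - 1)) + ?S5) = 1 / z ^ 2 * (P / (P - 1)) + ?S5 / z ^ 3"
    using z by (simp add: distrib_left power2_eq_square power3_eq_cube)
  hence "k * (u * (1 / z ^ 2)) - 1 / z ^ 3 * (z * (P / (P - 1)) + ?S5) - (1 / z ^ 2 / (P ^ 2 - 1) - ?S2 - E / ?K)
      = k * (e / z ^ 2) + (k - P / (P - 1) - 1 / (P ^ 2 - 1)) * (1 / z ^ 2) - ?S5 / z ^ 3 + ?S2 + E / ?K"
    unfolding u_def e_def[symmetric] by (simp add: algebra_simps add_divide_distrib)
  also have "\<dots> = k * (e / z ^ 2) - ?S5 / z ^ 3 + ?S2 + E / ?K" using k(2) by simp
  finally have "?K * (k * (u * (1 / z ^ 2)) - 1 / z ^ 3 * (z * (P / (P - 1)) + ?S5) - (1 / z ^ 2 / (P ^ 2 - 1) - ?S2 - E / ?K))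
      = ?K * k * (e / z ^ 2) - ?K * (?S5 / z ^ 3) + ?K * ?S2 + ?K * (E / ?K)"
    by (simp only: distrib_left right_diff_distrib mult.assoc)
  also have "\<dots> = (- (z ^ 2) + E * e - z ^ 2 * e) + E"
    unfolding k(1) using inner_series_equation[OF z] K_pos by (simp add: e_def)
  finally show ?thesis unfolding k_def[symmetric] u_def e_def[symmetric] by (simp add: algebra_simps)
qed

text \<open>
  The counterpart outside the unit ball, where \<open>y = 1 / |x|\<close>. The series in \<open>t = P y\<close> has bounded
  coefficients because of the normalisation of \<open>outer_coeff\<close>. The term \<open>P^4 t^3\<close> stems from
  \<open>k\<^sub>5\<close>: the recursion starts one step too late to balance it against \<open>k\<^sub>1\<close> and \<open>k\<^sub>3\<close>.
\<close>

lemma outer_series_equation: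
  assumes y: "0 < y" "P * y \<le> 1"
  defines "t \<equiv> P * y" and "e \<equiv> even_series (outer_coeff P E) 5 (P * y)"
  shows "P ^ 2 * (t ^ 2 * e) + vladimirov_const P * (P ^ 3 * y ^ 3 * sum_series P (outer_coeff P E) 4 y)
      - vladimirov_const P * sum_series P (outer_coeff P E) 7 y = E * P ^ 2 * e - P ^ 4 * (e / t ^ 2) + P ^ 4 * t ^ 3"
proof -
  let ?w = "outer_coeff P E" and ?K = "vladimirov_const P"
  have t: "0 < t" "0 \<le> t" "t \<le> 1" using y P by (simp_all add: t_def)
  have "y \<le> P * y" using y P by simp
  hence y': "0 \<le> y" "y \<le> 1" using y by linarith+
  note b = outer_coeff_bound[OF P E]
  have se: "(\<lambda>n. ?w n * t ^ (2 * n + 5)) sums e"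
    unfolding e_def t_def[symmetric] by (rule even_series_sums[OF P_ge_2 _ b t(2,3)]) simp
  have s4: "(\<lambda>n. ?w n * y ^ (2 * n + 4) / (1 - 1 / P ^ (2 * n + 4))) sums sum_series P ?w 4 y"
    by (rule sum_series_sums[OF P_ge_2 _ b y']) simp
  have s7: "(\<lambda>n. ?w n * y ^ (2 * n + 7) / (1 - 1 / P ^ (2 * n + 7))) sums sum_series P ?w 7 y"
    by (rule sum_series_sums[OF P_ge_2 _ b y']) simp
  define f where "f = (\<lambda>n. outer_symbol P n * ?w n * t ^ (2 * n + 7))"
  have "(\<lambda>n. P ^ 2 * (t ^ 2 * (?w n * t ^ (2 * n + 5)))
        + ?K * (P ^ 3 * y ^ 3 * (?w n * y ^ (2 * n + 4) / (1 - 1 / P ^ (2 * n + 4))))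
        - ?K * (?w n * y ^ (2 * n + 7) / (1 - 1 / P ^ (2 * n + 7))))
      sums (P ^ 2 * (t ^ 2 * e) + ?K * (P ^ 3 * y ^ 3 * sum_series P ?w 4 y) - ?K * sum_series P ?w 7 y)"
    by (intro sums_add sums_diff sums_mult se s4 s7)
  moreover have "P ^ 2 * (t ^ 2 * (?w n * t ^ (2 * n + 5)))
        + ?K * (P ^ 3 * y ^ 3 * (?w n * y ^ (2 * n + 4) / (1 - 1 / P ^ (2 * n + 4))))
        - ?K * (?w n * y ^ (2 * n + 7) / (1 - 1 / P ^ (2 * n + 7))) = f n" for n
  proof -
    have ratio: "y ^ m / (1 - 1 / P ^ m) = t ^ m * (1 / (P ^ m - 1))" if "m > 0" for m
    proof -
      have "P ^ m > 1" using P that by (simp add: one_less_power)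
      from one_minus_inverse(1)[OF this] show ?thesis by (simp add: t_def power_mult_distrib)
    qed
    have e: "t ^ (2 * n + 7) = t ^ 2 * t ^ (2 * n + 5)" "t ^ (2 * n + 7) = t ^ 3 * t ^ (2 * n + 4)"
      unfolding power_add[symmetric] by (rule arg_cong[of _ _ "power t"], simp)+
    have "P ^ 2 * (t ^ 2 * (?w n * t ^ (2 * n + 5))) = P ^ 2 * ?w n * t ^ (2 * n + 7)"
      unfolding e(1) by (simp only: mult_ac)
    moreover have "P ^ 3 * y ^ 3 * (?w n * y ^ (2 * n + 4) / (1 - 1 / P ^ (2 * n + 4)))
        = ?w n * t ^ (2 * n + 7) * (1 / (P ^ (2 * n + 4) - 1))"
    proof -
      have "P ^ 3 * y ^ 3 * (?w n * y ^ (2 * n + 4) / (1 - 1 / P ^ (2 * n + 4)))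
          = t ^ 3 * ?w n * (y ^ (2 * n + 4) / (1 - 1 / P ^ (2 * n + 4)))"
        by (simp add: t_def power_mult_distrib)
      also have "\<dots> = t ^ 3 * ?w n * (t ^ (2 * n + 4) * (1 / (P ^ (2 * n + 4) - 1)))" by (subst ratio) simp_all
      finally show ?thesis unfolding e(2) by (simp only: mult_ac)
    qed
    moreover have "?w n * y ^ (2 * n + 7) / (1 - 1 / P ^ (2 * n + 7)) = ?w n * t ^ (2 * n + 7) * (1 / (P ^ (2 * n + 7) - 1))"
      using ratio[of "2 * n + 7"] by (simp only: times_divide_eq_right[symmetric] mult.assoc)
    ultimately show ?thesis unfolding f_def outer_symbol_def
      by (simp only: distrib_right right_diff_distrib distrib_left left_diff_distrib mult_ac)
  qed
  ultimately have lhs: "f sums (P ^ 2 * (t ^ 2 * e) + ?K * (P ^ 3 * y ^ 3 * sum_series P ?w 4 y) - ?K * sum_series P ?w 7 y)"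
    by (simp only:)
  have s1: "(\<lambda>n. ?w (Suc n) * t ^ (2 * Suc n + 5)) sums (e - t ^ 5)"
    using se sums_Suc_iff[of "\<lambda>n. ?w n * t ^ (2 * n + 5)" "e - t ^ 5"] by simp
  hence s2: "(\<lambda>n. ?w (Suc (Suc n)) * t ^ (2 * Suc (Suc n) + 5)) sums (e - t ^ 5 - E / P ^ 2 * t ^ 7)"
    using sums_Suc_iff[of "\<lambda>n. ?w (Suc n) * t ^ (2 * Suc n + 5)" "e - t ^ 5 - E / P ^ 2 * t ^ 7"] by simp
  have rec: "outer_symbol P n * ?w n = E * P ^ 2 * ?w (Suc n) - P ^ 4 * ?w (Suc (Suc n))" for n
    using P by simp
  have "E * P ^ 2 * (?w (Suc n) * t ^ (2 * Suc n + 5))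
      - P ^ 4 * (?w (Suc (Suc n)) * t ^ (2 * Suc (Suc n) + 5) / t ^ 2) = f n" for n
  proof -
    have "2 * Suc n + 5 = 2 * n + 7" "2 * Suc (Suc n) + 5 = (2 * n + 7) + 2" by simp_all
    hence "t ^ (2 * Suc n + 5) = t ^ (2 * n + 7)" "t ^ (2 * Suc (Suc n) + 5) = t ^ (2 * n + 7) * t ^ 2"
      by (simp_all only: power_add)
    moreover have "t ^ 2 \<noteq> 0" using t by simp
    ultimately show ?thesis unfolding f_def rec by (simp add: left_diff_distrib del: outer_coeff.simps)
  qed
  hence "f sums (E * P ^ 2 * (e - t ^ 5) - P ^ 4 * ((e - t ^ 5 - E / P ^ 2 * t ^ 7) / t ^ 2))"
    using sums_diff[OF sums_mult[OF s1, of "E * P ^ 2"] sums_mult[OF sums_divide[OF s2, of "t ^ 2"], of "P ^ 4"]]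
    by (simp only:)
  also have "E * P ^ 2 * (e - t ^ 5) - P ^ 4 * ((e - t ^ 5 - E / P ^ 2 * t ^ 7) / t ^ 2)
      = E * P ^ 2 * e - P ^ 4 * (e / t ^ 2) + P ^ 4 * t ^ 3"
  proof -
    have "t ^ 5 = t ^ 2 * t ^ 3" "t ^ 7 = t ^ 2 * t ^ 5" by (simp_all flip: power_add)
    hence "(e - t ^ 5 - E / P ^ 2 * t ^ 7) / t ^ 2 = (e - t ^ 2 * t ^ 3 - E / P ^ 2 * (t ^ 2 * t ^ 5)) / t ^ 2"
      by (simp only:)
    also have "\<dots> = e / t ^ 2 - t ^ 3 - E / P ^ 2 * t ^ 5"
    proof -
      have regroup: "(a - s * b - k * (s * d)) / s = a / s - b - k * d" if "s \<noteq> 0" for a b d k s :: real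
        using that by (simp add: diff_divide_distrib)
      show ?thesis by (rule regroup) (use t in simp)
    qed
    finally have "(e - t ^ 5 - E / P ^ 2 * t ^ 7) / t ^ 2 = e / t ^ 2 - t ^ 3 - E / P ^ 2 * t ^ 5" .
    moreover have "P ^ 4 * (E / P ^ 2) = E * P ^ 2"
    proof -
      have e: "P ^ 4 = P ^ 2 * P ^ 2" by (simp flip: power_add)
      have cancel: "x * x * (E / x) = E * x" if "x \<noteq> 0" for x using that by simp
      show ?thesis unfolding e by (rule cancel) (use P in simp)
    qed
    hence "P ^ 4 * (E / P ^ 2 * t ^ 5) = E * P ^ 2 * t ^ 5" by (simp only: mult.assoc[symmetric])
    ultimately show ?thesis by (simp only: right_diff_distrib)
  qed
  finally have "f sums (E * P ^ 2 * e - P ^ 4 * (e / t ^ 2) + P ^ 4 * t ^ 3)" .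
  with lhs show ?thesis by (rule sums_unique2)
qed

text \<open>
  The constant \<open>c / K\<close> in \<open>I\<close> produces exactly the multiple of \<open>|x|^(-3)\<close> that cancels the term
  of \<open>k\<^sub>5\<close> left over in \<open>outer_series_equation\<close>.
\<close>

lemma outer_equation:
  fixes c :: real
  assumes y: "0 < y" "P * y \<le> 1"
  defines "u \<equiv> c / P ^ 5 * even_series (outer_coeff P E) 5 (P * y)"
  shows "vladimirov_const P * ((P ^ 2 + P + 1) / (P ^ 2 - 1) * (u * y ^ 2)
      - y ^ 3 * (c / vladimirov_const P - c / P ^ 4 * sum_series P (outer_coeff P E) 4 y)
      - c / P ^ 7 * sum_series P (outer_coeff P E) 7 y) + 1 / y ^ 2 * u = E * u"
proof -
  define e where "e = even_series (outer_coeff P E) 5 (P * y)"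
  let ?K = "vladimirov_const P" and ?S4 = "sum_series P (outer_coeff P E) 4 y" and ?S7 = "sum_series P (outer_coeff P E) 7 y"
  define k where "k = (P ^ 2 + P + 1) / (P ^ 2 - 1)"
  have k: "?K * k = P ^ 2" using K_symbol by (simp add: k_def)
  have pw: "P ^ 4 = P ^ 2 * P ^ 2" "P ^ 5 = P ^ 2 * P ^ 3" "P ^ 7 = P ^ 4 * P ^ 3" "P ^ 7 = P ^ 2 * P ^ 5" by (simp_all flip: power_add)
  have nz: "P \<noteq> 0" "y \<noteq> 0" "?K \<noteq> 0" using P y K_pos by auto
  have "?K * (k * (u * y ^ 2) - y ^ 3 * (c / ?K - c / P ^ 4 * ?S4) - c / P ^ 7 * ?S7)
      = ?K * k * (u * y ^ 2) - c * y ^ 3 + c * ?K * y ^ 3 * ?S4 / P ^ 4 - c * ?K * ?S7 / P ^ 7"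
    using nz by (simp add: algebra_simps)
  also have "\<dots> = c / P ^ 7 * (P ^ 2 * ((P * y) ^ 2 * e) + ?K * (P ^ 3 * y ^ 3 * ?S4) - ?K * ?S7) - c * y ^ 3"
  proof -
    have "x * (c / q * e * s) = c / (x * q) * (x * (x * s * e))" if "x \<noteq> 0" "q \<noteq> 0" for x q s
      using that by simp
    hence "P ^ 2 * (u * y ^ 2) = c / P ^ 7 * (P ^ 2 * ((P * y) ^ 2 * e))"
      unfolding u_def e_def[symmetric] pw(4) power_mult_distrib using nz by (simp only: power_not_zero not_False_eq_True)
    moreover have regroup: "c * ?K * y ^ 3 * ?S4 / x = c / (x * q) * (?K * (q * y ^ 3 * ?S4))" if "x \<noteq> 0" "q \<noteq> 0" for x q
      using that by simp
    have "c * ?K * y ^ 3 * ?S4 / P ^ 4 = c / P ^ 7 * (?K * (P ^ 3 * y ^ 3 * ?S4))"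
      unfolding pw(3) by (rule regroup) (use nz in simp_all)
    ultimately show ?thesis unfolding k by (simp add: algebra_simps)
  qed
  also have "P ^ 2 * ((P * y) ^ 2 * e) + ?K * (P ^ 3 * y ^ 3 * ?S4) - ?K * ?S7
      = E * P ^ 2 * e - P ^ 4 * (e / (P * y) ^ 2) + P ^ 4 * (P * y) ^ 3"
    using outer_series_equation[OF y] by (simp only: e_def)
  also have "c / P ^ 7 * (E * P ^ 2 * e - P ^ 4 * (e / (P * y) ^ 2) + P ^ 4 * (P * y) ^ 3)
      = E * (c / P ^ 5 * e) - 1 / y ^ 2 * (c / P ^ 5 * e) + c * y ^ 3"
  proof -
    have cancel: "c / (x * q) * (E * x * e) = E * (c / q * e)"
      "c / (x * q) * (x * (e / (r * s))) = 1 / s * (c / (r * q) * e)"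
      "c / (x * q) * (x * (q * s)) = c * s" if "x \<noteq> 0" "q \<noteq> 0" for x q r s
      using that by simp_all
    have "c / P ^ 7 * (E * P ^ 2 * e) = E * (c / P ^ 5 * e)"
      unfolding pw(4) by (rule cancel(1)) (use nz in simp_all)
    moreover have "c / P ^ 7 * (P ^ 4 * (e / (P * y) ^ 2)) = 1 / y ^ 2 * (c / P ^ 5 * e)"
      unfolding pw(2,3) power_mult_distrib by (rule cancel(2)) (use nz in simp_all)
    moreover have "c / P ^ 7 * (P ^ 4 * (P * y) ^ 3) = c * y ^ 3"
      unfolding pw(3) power_mult_distrib by (rule cancel(3)) (use nz in simp_all)
    ultimately show ?thesis by (simp only: distrib_left right_diff_distrib)
  qed
  finally show ?thesis unfolding k_def[symmetric] u_def e_def[symmetric] by simp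
qed

end

section \<open>The eigenfunction\<close>

lemma filterlim_uminus_int_at_bot: "filterlim uminus at_bot (at_top :: int filter)"
  unfolding filterlim_at_bot eventually_at_top_linorder
proof
  fix Z :: int show "\<exists>N. \<forall>n\<ge>N. - n \<le> Z" by (intro exI[of _ "- Z"]) auto
qed

text \<open>
  The values of \<open>\<psi>\<^sub>0\<close> as a function of the norm, and the closed forms of the sums \<open>I\<close> and \<open>T\<close> of
  \<open>radial_profile\<close>. On either side of the unit sphere such a sum is determined by \<open>profile\<close> up to an
  additive constant. A limit condition fixes the constant on one side; on the other side the equation
  demands \<open>c / K\<close> and \<open>- E / K\<close>.
\<close>

definition profile :: "real \<Rightarrow> real \<Rightarrow> real \<Rightarrow> real" where
  "profile P E t = (if t \<le> 1 then 1 + even_series (inner_coeff P E) 4 t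
     else outer_amp P E / P ^ 5 * even_series (outer_coeff P E) 5 (P / t))"

definition mass_below :: "real \<Rightarrow> real \<Rightarrow> int \<Rightarrow> real" where
  "mass_below P E m = (if m \<le> 0
     then P powi m * (P / (P - 1)) + sum_series P (inner_coeff P E) 5 (P powi m)
     else outer_amp P E / vladimirov_const P
            - outer_amp P E / P ^ 4 * sum_series P (outer_coeff P E) 4 (P powi (- m)))"

definition mass_above :: "real \<Rightarrow> real \<Rightarrow> int \<Rightarrow> real" where
  "mass_above P E m = (if m < 0
     then 1 / (P powi m) ^ 2 / (P ^ 2 - 1) - sum_series P (inner_coeff P E) 2 (P powi m) - E / vladimirov_const P
     else outer_amp P E / P ^ 7 * sum_series P (outer_coeff P E) 7 (P powi (- m)))"

text \<open>
  A parameter \<open>E\<close> at which the matching condition at the unit sphere holds. The bounds on \<open>p\<close> and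
  \<open>E\<close> are those under which the series are dominated by geometric ones.
\<close>

locale oscillator_level =
  fixes p :: nat and E :: real
  assumes p: "prime p" and P: "real p \<ge> 4" and E: "1 \<le> E" "E \<le> 3" and fixed: "level (real p) E = E"
begin

abbreviation (input) "P \<equiv> real p"
abbreviation (input) "K \<equiv> vladimirov_const P"
abbreviation (input) "c \<equiv> outer_amp P E"
abbreviation (input) "v \<equiv> inner_coeff P E"
abbreviation (input) "w \<equiv> outer_coeff P E"

lemmas v_bound = inner_coeff_bound[OF P E]
lemmas w_bound = outer_coeff_bound[OF P E]

lemma P_at_least_2: "P \<ge> 2" and P_positive: "P > 0" using P by simp_all

lemma powi_range:
  shows "m \<le> 0 \<Longrightarrow> 0 < P powi m \<and> P powi m \<le> 1"
    and "m \<ge> 0 \<Longrightarrow> 0 < P powi (- m) \<and> P powi (- m) \<le> 1"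
    and "m > 0 \<Longrightarrow> P * P powi (- m) \<le> 1"
    and "m > 0 \<Longrightarrow> P powi m > 1"
    and "P powi m = 1 / P powi (- m)"
    and "P powi (m - 1) = P powi m / P"
    and "P powi (- (m - 1)) = P * P powi (- m)"
proof -
  have le: "P powi i \<le> P powi j" if "i \<le> j" for i j using that powi_le_iff[OF p, of i j] by simp
  show "m \<le> 0 \<Longrightarrow> 0 < P powi m \<and> P powi m \<le> 1" using le[of m 0] powi_pos[OF p, of m] by simp
  show "m \<ge> 0 \<Longrightarrow> 0 < P powi (- m) \<and> P powi (- m) \<le> 1" using le[of "- m" 0] powi_pos[OF p, of "- m"] by simp
  show m1: "P powi (m - 1) = P powi m / P" using P_positive by (simp add: power_int_diff)
  have "P powi (1 + - m) = P powi 1 * P powi (- m)" using P_positive by (intro power_int_add) simp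
  thus m2: "P powi (- (m - 1)) = P * P powi (- m)" by simp
  show "m > 0 \<Longrightarrow> P * P powi (- m) \<le> 1" using le[of "- (m - 1)" 0] unfolding m2 by simp
  show "m > 0 \<Longrightarrow> P powi m > 1" using powi_less_iff[OF p, of 0 m] by simp
  show "P powi m = 1 / P powi (- m)" using P_positive by (simp add: power_int_minus divide_inverse)
qed

lemma profile_inner: "m \<le> 0 \<Longrightarrow> profile P E (P powi m) = 1 + even_series v 4 (P powi m)"
  using powi_range(1)[of m] by (simp add: profile_def)

lemma profile_outer: "m > 0 \<Longrightarrow> profile P E (P powi m) = c / P ^ 5 * even_series w 5 (P * P powi (- m))"
  using powi_range(4)[of m] by (simp add: profile_def power_int_minus divide_inverse)

text \<open>
  The two formulas for \<open>mass_below\<close>, and those for \<open>mass_above\<close>, have to agree at \<open>m = 0\<close>. The first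
  agreement is the equation solved by \<open>outer_amp\<close>, the second is the fixed point equation for \<open>E\<close>.
\<close>

lemma matching_below: "P / (P - 1) + sum_series P v 5 1 = c / K - c / P ^ 4 * sum_series P w 4 1"
proof -
  have D: "1 - K / P ^ 4 * sum_series P w 4 1 \<noteq> 0" using outer_amp_denominator[OF P E] by linarith
  have K: "K \<noteq> 0" using K_pos[OF P E] by simp
  have "c * (1 - K / P ^ 4 * sum_series P w 4 1) = K * (P / (P - 1) + sum_series P v 5 1)"
    unfolding outer_amp_def using D by simp
  hence "K * (P / (P - 1) + sum_series P v 5 1) / K = (c - c * (K / P ^ 4 * sum_series P w 4 1)) / K"
    by (simp only: right_diff_distrib mult_1_right)
  thus ?thesis using K by (simp add: diff_divide_distrib)
qed

lemma matching_above: "1 / (P ^ 2 - 1) - sum_series P v 2 1 - E / K = c / P ^ 7 * sum_series P w 7 1"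
proof -
  have K: "K \<noteq> 0" using K_pos[OF P E] by simp
  have "E / K = 1 / (P ^ 2 - 1) - sum_series P v 2 1 - c / P ^ 7 * sum_series P w 7 1"
    using fixed K unfolding level_def by (metis nonzero_mult_div_cancel_left)
  thus ?thesis by linarith
qed

lemma mass_below_inner: "m \<le> 0 \<Longrightarrow> mass_below P E m = P powi m * (P / (P - 1)) + sum_series P v 5 (P powi m)"
  by (simp add: mass_below_def)

lemma mass_below_outer: "m \<ge> 0 \<Longrightarrow> mass_below P E m = c / K - c / P ^ 4 * sum_series P w 4 (P powi (- m))"
  using matching_below by (cases "m = 0") (simp_all add: mass_below_def)

lemma mass_above_inner: "m \<le> 0 \<Longrightarrow> mass_above P E m = 1 / (P powi m) ^ 2 / (P ^ 2 - 1) - sum_series P v 2 (P powi m) - E / K"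
  using matching_above by (cases "m = 0") (simp_all add: mass_above_def)

lemma mass_above_outer: "m \<ge> 0 \<Longrightarrow> mass_above P E m = c / P ^ 7 * sum_series P w 7 (P powi (- m))"
  by (simp add: mass_above_def)

lemma profile_bounded: "\<bar>profile P E (P powi m)\<bar> \<le> 3 + \<bar>c / P ^ 5\<bar> * 2"
proof (cases "m \<le> 0")
  case True
  define z where "z = P powi m"
  have z: "0 \<le> z" "z \<le> 1" using powi_range(1)[OF True] by (simp_all add: z_def)
  have "\<bar>even_series v 4 z\<bar> \<le> 2 * (1 / P ^ 2 * z ^ 4)" by (rule even_series_bound[OF P_at_least_2 _ v_bound z]) simp
  also have "\<dots> \<le> 2 * (1 * 1)"
    using z const_ratio(3)[OF P E] power_le_one[OF z, of 4] by (intro mult_left_mono mult_mono) auto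
  finally show ?thesis unfolding profile_inner[OF True] z_def by (smt (verit) abs_ge_zero mult_nonneg_nonneg)
next
  case False
  define t where "t = P * P powi (- m)"
  have t: "0 \<le> t" "t \<le> 1" using False powi_range(2)[of m] powi_range(3)[of m] P_positive by (simp_all add: t_def)
  have "\<bar>even_series w 5 t\<bar> \<le> 2 * (1 * t ^ 5)" by (rule even_series_bound[OF P_at_least_2 _ w_bound t]) simp
  also have "\<dots> \<le> 2" using power_le_one[OF t, of 5] by simp
  finally have "\<bar>c / P ^ 5\<bar> * \<bar>even_series w 5 t\<bar> \<le> \<bar>c / P ^ 5\<bar> * 2" by (intro mult_left_mono) auto
  thus ?thesis using False unfolding t_def by (simp add: profile_outer abs_mult)
qed

lemma mass_below_step: "mass_below P E m - mass_below P E (m - 1) = profile P E (P powi m) * P powi m"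
proof (cases "m \<le> 0")
  case True
  define z where "z = P powi m"
  have z: "0 \<le> z" "z \<le> 1" using powi_range(1)[OF True] by (simp_all add: z_def)
  have "sum_series P v 5 z - sum_series P v 5 (z / P) = even_series v (4 + 1) z"
    using sum_series_step[OF P_at_least_2 _ v_bound z, of 5] by simp
  also have "\<dots> = z ^ 1 * even_series v 4 z" by (rule even_series_shift[OF _ v_bound z]) simp
  finally have S: "sum_series P v 5 z - sum_series P v 5 (z / P) = z * even_series v 4 z" by simp
  have "z * k - z / P * k = z * ((1 - 1 / P) * k)" for k by (simp add: algebra_simps)
  hence "z * (P / (P - 1)) - z / P * (P / (P - 1)) = z * ((1 - 1 / P) * (P / (P - 1)))" .
  also have "(1 - 1 / P) * (P / (P - 1)) = 1" using P by (simp add: field_simps)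
  finally have "z * (P / (P - 1)) - z / P * (P / (P - 1)) = z" by simp
  thus ?thesis using True S mass_below_inner[of m] mass_below_inner[of "m - 1"] profile_inner[OF True]
    by (simp add: z_def[symmetric] powi_range(6) algebra_simps)
next
  case False
  define y where "y = P powi (- m)"
  have y: "0 < y" "P * y \<le> 1" using False powi_range(2)[of m] powi_range(3)[of m] by (simp_all add: y_def)
  have t: "0 \<le> P * y" using y P_positive by simp
  have "sum_series P w 4 (P * y) - sum_series P w 4 (P * y / P) = even_series w 4 (P * y)"
    using sum_series_step[OF P_at_least_2 _ w_bound t y(2), of 4] by simp
  hence S: "sum_series P w 4 (P * y) - sum_series P w 4 y = even_series w 4 (P * y)" using P_positive by simp
  have "mass_below P E m - mass_below P E (m - 1) = c / P ^ 4 * (sum_series P w 4 (P * y) - sum_series P w 4 y)"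
    using False mass_below_outer[of m] mass_below_outer[of "m - 1"]
    unfolding powi_range(7) y_def by (simp add: right_diff_distrib)
  also have "\<dots> = c / P ^ 4 * even_series w 4 (P * y)" by (simp only: S)
  also have "\<dots> = c / P ^ 5 * even_series w 5 (P * y) * (1 / y)"
  proof -
    have "even_series w (4 + 1) (P * y) = (P * y) ^ 1 * even_series w 4 (P * y)"
      by (rule even_series_shift[OF _ w_bound t y(2)]) simp
    moreover have "P ^ 5 = P * P ^ 4" by (simp flip: power_Suc)
    ultimately show ?thesis using y P_positive by simp
  qed
  finally show ?thesis using False profile_outer[of m] powi_range(5)[of m] by (simp add: y_def)
qed

lemma mass_above_step: "mass_above P E (m - 1) - mass_above P E m = profile P E (P powi m) * P powi (- 2 * m)"
proof (cases "m \<le> 0")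
  case True
  define z where "z = P powi m"
  have z: "0 < z" "0 \<le> z" "z \<le> 1" using powi_range(1)[OF True] by (simp_all add: z_def)
  have "sum_series P v 2 z - sum_series P v 2 (z / P) = even_series v 2 z"
    using sum_series_step[OF P_at_least_2 _ v_bound z(2,3), of 2] by simp
  also have "\<dots> = even_series v 4 z / z ^ 2"
    using even_series_shift[OF _ v_bound z(2,3), of 2 2] z by simp
  finally have S: "sum_series P v 2 z - sum_series P v 2 (z / P) = even_series v 4 z / z ^ 2" .
  have D: "P ^ 2 - 1 \<noteq> 0" using P_square[OF P E] by simp
  have "1 / (z / P) ^ 2 / (P ^ 2 - 1) - 1 / z ^ 2 / (P ^ 2 - 1) = 1 / z ^ 2 * ((P ^ 2 - 1) / (P ^ 2 - 1))"
  proof -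
    have e: "1 / (z / P) ^ 2 = P ^ 2 / z ^ 2" by (simp add: power_divide)
    have "P ^ 2 / z ^ 2 / D - 1 / z ^ 2 / D = 1 / z ^ 2 * ((P ^ 2 - 1) / D)" for D
      by (simp add: diff_divide_distrib mult.commute)
    thus ?thesis unfolding e .
  qed
  hence "1 / (z / P) ^ 2 / (P ^ 2 - 1) - 1 / z ^ 2 / (P ^ 2 - 1) = 1 / z ^ 2" using D by simp
  hence "mass_above P E (m - 1) - mass_above P E m = 1 / z ^ 2 + even_series v 4 z / z ^ 2"
    using True S mass_above_inner[of m] mass_above_inner[of "m - 1"]
    by (simp add: z_def[symmetric] powi_range(6))
  also have "\<dots> = (1 + even_series v 4 z) * (1 / z ^ 2)" by (simp add: add_divide_distrib)
  finally show ?thesis unfolding profile_inner[OF True] powi_minus_mult(1)[OF P_positive] z_def .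
next
  case False
  define y where "y = P powi (- m)"
  have y: "0 < y" "P * y \<le> 1" using False powi_range(2)[of m] powi_range(3)[of m] by (simp_all add: y_def)
  have t: "0 \<le> P * y" using y P_positive by simp
  have "sum_series P w 7 (P * y) - sum_series P w 7 (P * y / P) = even_series w (5 + 2) (P * y)"
    using sum_series_step[OF P_at_least_2 _ w_bound t y(2), of 7] by simp
  also have "\<dots> = (P * y) ^ 2 * even_series w 5 (P * y)" by (rule even_series_shift[OF _ w_bound t y(2)]) simp
  finally have S: "sum_series P w 7 (P * y) - sum_series P w 7 y = (P * y) ^ 2 * even_series w 5 (P * y)" using P_positive by simp
  have "mass_above P E (m - 1) - mass_above P E m = c / P ^ 7 * (sum_series P w 7 (P * y) - sum_series P w 7 y)"
    using False mass_above_outer[of m] mass_above_outer[of "m - 1"]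
    unfolding powi_range(7) y_def by (simp add: right_diff_distrib)
  also have "\<dots> = c / P ^ 5 * even_series w 5 (P * y) * y ^ 2"
  proof -
    have e: "P ^ 7 = P ^ 2 * P ^ 5" by (simp flip: power_add)
    have cancel: "c / (a * b) * (a * s * r) = c / b * r * s" if "a \<noteq> 0" for a b r s :: real using that by simp
    show ?thesis unfolding S e power_mult_distrib by (rule cancel) (use P_positive in simp)
  qed
  finally show ?thesis using False profile_outer[of m] powi_range(5)[of m]
    unfolding powi_minus_mult(1)[OF P_positive] by (simp add: y_def power_divide)
qed

lemma mass_below_tendsto: "(mass_below P E \<longlongrightarrow> 0) at_bot"
proof (rule Lim_null_comparison)
  show "((\<lambda>m. P powi m * (P / (P - 1) + 4 * (1 / P ^ 2))) \<longlongrightarrow> 0) at_bot"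
    using tendsto_mult_right[OF tendsto_powi_at_bot, of P "P / (P - 1) + 4 * (1 / P ^ 2)"] P by simp
  have "norm (mass_below P E m) \<le> P powi m * (P / (P - 1) + 4 * (1 / P ^ 2))" if "m \<le> 0" for m
  proof -
    define z where "z = P powi m"
    have z: "0 \<le> z" "z \<le> 1" using powi_range(1)[OF that] by (simp_all add: z_def)
    have "\<bar>sum_series P v 5 z\<bar> \<le> 4 * (1 / P ^ 2 * z ^ 5)" by (rule sum_series_bound[OF P_at_least_2 _ v_bound z]) simp
    also have "\<dots> \<le> 4 * (1 / P ^ 2 * z ^ 1)" using z by (intro mult_left_mono power_decreasing) auto
    finally have "\<bar>sum_series P v 5 z\<bar> \<le> 4 * (1 / P ^ 2 * z)" by simp
    moreover have "0 \<le> z * (P / (P - 1))" using z P by simp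
    ultimately have "\<bar>z * (P / (P - 1)) + sum_series P v 5 z\<bar> \<le> z * (P / (P - 1)) + 4 * (1 / P ^ 2 * z)"
      by linarith
    also have "\<dots> = z * (P / (P - 1) + 4 * (1 / P ^ 2))" by (simp add: algebra_simps)
    finally show ?thesis unfolding mass_below_inner[OF that] z_def by simp
  qed
  thus "\<forall>\<^sub>F m in at_bot. norm (mass_below P E m) \<le> P powi m * (P / (P - 1) + 4 * (1 / P ^ 2))"
    unfolding eventually_at_bot_linorder by blast
qed

lemma mass_above_tendsto: "(mass_above P E \<longlongrightarrow> 0) at_top"
proof (rule Lim_null_comparison)
  have "((\<lambda>m. P powi (- m)) \<longlongrightarrow> 0) at_top"
    by (rule filterlim_compose[OF tendsto_powi_at_bot filterlim_uminus_int_at_bot]) (use P in simp)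
  from tendsto_mult_right[OF this, of "\<bar>c / P ^ 7\<bar> * 4"]
  show "((\<lambda>m. P powi (- m) * (\<bar>c / P ^ 7\<bar> * 4)) \<longlongrightarrow> 0) at_top" by simp
  have "norm (mass_above P E m) \<le> P powi (- m) * (\<bar>c / P ^ 7\<bar> * 4)" if "m \<ge> 0" for m
  proof -
    define y where "y = P powi (- m)"
    have y: "0 \<le> y" "y \<le> 1" using powi_range(2)[OF that] by (simp_all add: y_def)
    have "\<bar>sum_series P w 7 y\<bar> \<le> 4 * (1 * y ^ 7)" by (rule sum_series_bound[OF P_at_least_2 _ w_bound y]) simp
    also have "\<dots> \<le> 4 * (1 * y ^ 1)" using y by (intro mult_left_mono power_decreasing) auto
    finally have "\<bar>c / P ^ 7\<bar> * \<bar>sum_series P w 7 y\<bar> \<le> \<bar>c / P ^ 7\<bar> * (4 * (1 * y ^ 1))" by (intro mult_left_mono) auto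
    thus ?thesis unfolding mass_above_outer[OF that] y_def by (simp add: abs_mult mult_ac)
  qed
  thus "\<forall>\<^sub>F m in at_top. norm (mass_above P E m) \<le> P powi (- m) * (\<bar>c / P ^ 7\<bar> * 4)"
    unfolding eventually_at_top_linorder by blast
qed

lemma radial_profile_profile: "radial_profile p (profile P E) (mass_below P E) (mass_above P E) (3 + \<bar>c / P ^ 5\<bar> * 2)"
  by unfold_locales
     (rule p profile_bounded mass_below_step mass_above_step mass_below_tendsto mass_above_tendsto)+

lemma profile_0: "profile P E 0 = 1"
  using even_series_bound[OF P_at_least_2 _ v_bound, of 4 0] by (simp add: profile_def)

lemma profile_flat: "m \<le> 0 \<Longrightarrow> \<bar>profile P E (P powi m) - profile P E 0\<bar> \<le> 2 * P powi (3 * m)"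
proof -
  assume m: "m \<le> 0"
  define z where "z = P powi m"
  have z: "0 \<le> z" "z \<le> 1" using powi_range(1)[OF m] by (simp_all add: z_def)
  have "\<bar>even_series v 4 z\<bar> \<le> 2 * (1 / P ^ 2 * z ^ 4)" by (rule even_series_bound[OF P_at_least_2 _ v_bound z]) simp
  also have "\<dots> \<le> 2 * (1 * z ^ 3)"
    using z const_ratio(3)[OF P E] by (intro mult_left_mono mult_mono power_decreasing) auto
  also have "z ^ 3 = P powi (3 * m)" by (simp add: z_def power_int_mult mult.commute[of 3])
  finally show ?thesis unfolding profile_inner[OF m] profile_0 z_def by simp
qed

text \<open>
  Near the origin \<open>T\<close> differs from the tail of the constant function 1 by \<open>- E / K\<close> plus a series
  that vanishes with \<open>|x|\<close>; by \<open>vladimirov_at_zero\<close> this gives \<open>D\<^sup>2 \<psi>(0) = E\<close>.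
\<close>

lemma mass_above_limit:
  "((\<lambda>m. mass_above P E m - profile P E 0 * (P powi (- 2 * m) / (P ^ 2 - 1))) \<longlongrightarrow> - (E / K)) at_bot"
proof -
  have "((\<lambda>m. mass_above P E m - profile P E 0 * (P powi (- 2 * m) / (P ^ 2 - 1)) + E / K) \<longlongrightarrow> 0) at_bot"
  proof (rule Lim_null_comparison)
    show "((\<lambda>m. P powi m * (4 * (1 / P ^ 2))) \<longlongrightarrow> 0) at_bot"
      using tendsto_mult_right[OF tendsto_powi_at_bot, of P "4 * (1 / P ^ 2)"] P by simp
    have "norm (mass_above P E m - profile P E 0 * (P powi (- 2 * m) / (P ^ 2 - 1)) + E / K) \<le> P powi m * (4 * (1 / P ^ 2))"
      if "m \<le> 0" for m
    proof -
      define z where "z = P powi m"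
      have z: "0 \<le> z" "z \<le> 1" using powi_range(1)[OF that] by (simp_all add: z_def)
      have "\<bar>sum_series P v 2 z\<bar> \<le> 4 * (1 / P ^ 2 * z ^ 2)" by (rule sum_series_bound[OF P_at_least_2 _ v_bound z]) simp
      also have "\<dots> \<le> 4 * (1 / P ^ 2 * z ^ 1)" using z by (intro mult_left_mono power_decreasing) auto
      finally show ?thesis unfolding mass_above_inner[OF that] profile_0 powi_minus_mult(1)[OF P_positive] z_def
        by (simp add: mult_ac)
    qed
    thus "\<forall>\<^sub>F m in at_bot. norm (mass_above P E m - profile P E 0 * (P powi (- 2 * m) / (P ^ 2 - 1)) + E / K)
        \<le> P powi m * (4 * (1 / P ^ 2))" unfolding eventually_at_bot_linorder by blast
  qed
  from tendsto_diff[OF this tendsto_const[of "E / K"]] show ?thesis by simp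
qed

text \<open>
  The three cases \<open>x = 0\<close>, \<open>0 < |x| \<le> 1\<close> and \<open>|x| > 1\<close> are settled by \<open>mass_above_limit\<close>,
  \<open>inner_equation\<close> and \<open>outer_equation\<close>.
\<close>

lemma eigenfunction:
  assumes \<psi>: "\<And>y. y \<in> Qp p \<Longrightarrow> \<psi> y = complex_of_real (profile P E (padic_norm p y))"
  shows "solves_padic_oscillator p 1 E \<psi>"
  unfolding solves_padic_oscillator_def
proof (intro ballI conjI)
  fix x assume x: "x \<in> Qp p"
  interpret radial_profile p "profile P E" "mass_below P E" "mass_above P E" "3 + \<bar>c / P ^ 5\<bar> * 2"
    by (rule radial_profile_profile)
  have K: "K > 0" using K_pos[OF P E] .
  have eq: "vladimirov p 2 \<psi> x = complex_of_real d \<Longrightarrow> d + padic_norm p x ^ 2 * profile P E (padic_norm p x) = E * profile P E (padic_norm p x)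
    \<Longrightarrow> vladimirov p 2 \<psi> x + of_real 1 * of_real (padic_norm p x ^ 2) * \<psi> x = of_real E * \<psi> x" for d
  proof -
    assume a: "vladimirov p 2 \<psi> x = complex_of_real d" "d + padic_norm p x ^ 2 * profile P E (padic_norm p x) = E * profile P E (padic_norm p x)"
    have "vladimirov p 2 \<psi> x + of_real 1 * of_real (padic_norm p x ^ 2) * \<psi> x
        = complex_of_real (d + padic_norm p x ^ 2 * profile P E (padic_norm p x))"
      unfolding a(1) \<psi>[OF x] by simp
    also have "\<dots> = of_real E * \<psi> x" unfolding a(2) \<psi>[OF x] by simp
    finally show ?thesis .
  qed
  have norm: "padic_norm p x = 0 \<or> (\<exists>m. padic_norm p x = P powi m)" using padic_norm_cases[OF p x] by blast
  then consider "padic_norm p x = 0" | m where "padic_norm p x = P powi m" by blast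
  thus "integrable (padic_haar p) (vladimirov_integrand p 2 \<psi> x)"
  proof cases
    case 1
    show ?thesis by (rule vladimirov_at_zero(1)[OF x 1 \<psi> profile_flat mass_above_limit])
  next
    case (2 m)
    show ?thesis by (rule vladimirov_at_level(1)[OF x 2 \<psi>])
  qed
  from norm consider "padic_norm p x = 0" | m where "padic_norm p x = P powi m" by blast
  thus "vladimirov p 2 \<psi> x + of_real 1 * of_real (padic_norm p x ^ 2) * \<psi> x = of_real E * \<psi> x"
  proof cases
    case 1
    have "vladimirov p 2 \<psi> x = complex_of_real (K * (E / K))"
      by (rule vladimirov_at_zero(2)[OF x 1 \<psi> profile_flat mass_above_limit])
    thus ?thesis by (rule eq) (use K 1 profile_0 in simp)
  next
    case (2 m)
    show ?thesis
    proof (rule eq[OF vladimirov_at_level(2)[OF x 2 \<psi>]], unfold 2)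
      show "K * ((P ^ 2 + P + 1) / (P ^ 2 - 1) * (profile P E (P powi m) * P powi (- 2 * m))
          - P powi (- 3 * m) * mass_below P E m - mass_above P E m) + (P powi m) ^ 2 * profile P E (P powi m)
        = E * profile P E (P powi m)"
      proof (cases "m \<le> 0")
        case True
        show ?thesis
          unfolding profile_inner[OF True] mass_below_inner[OF True] mass_above_inner[OF True] powi_minus_mult[OF P_positive]
          using powi_range(1)[OF True] by (intro inner_equation[OF P E]) auto
      next
        case False
        define y where "y = P powi (- m)"
        have y: "0 < y" "P * y \<le> 1" using False powi_range(2)[of m] powi_range(3)[of m] by (simp_all add: y_def)
        have z: "P powi m = 1 / y" "1 / (P powi m) ^ 2 = y ^ 2" "1 / (P powi m) ^ 3 = y ^ 3" "(P powi m) ^ 2 = 1 / y ^ 2"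
          unfolding powi_range(5)[of m] y_def by (simp_all add: power_divide)
        have u: "profile P E (P powi m) = c / P ^ 5 * even_series w 5 (P * y)"
          using False profile_outer[of m] by (simp add: y_def)
        have I: "mass_below P E m = c / K - c / P ^ 4 * sum_series P w 4 y"
          and T: "mass_above P E m = c / P ^ 7 * sum_series P w 7 y"
          using False mass_below_outer[of m] mass_above_outer[of m] by (simp_all add: y_def)
        show ?thesis unfolding u I T powi_minus_mult[OF P_positive] z(2,3) unfolding z(4) by (rule outer_equation[OF P E y])
      qed
    qed
  qed
qed

definition c_seq :: "nat \<Rightarrow> real" where
  "c_seq n = (if n = 0 then 1 else if even n \<and> n \<ge> 4 then v ((n - 4) div 2) else 0)"

definition k_seq :: "nat \<Rightarrow> real" where
  "k_seq n = (if odd n \<and> n \<ge> 5 then c * (w ((n - 5) div 2) * P ^ (n - 5)) else 0)"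

lemma c_recursion_c_seq: "c_recursion p 1 E 1 c_seq"
  unfolding c_recursion_def
proof (intro conjI allI)
  fix n :: nat
  have G: "Gamma_p p (2 * real n + 5) / Gamma_p p (2 * real n + 3) = inner_symbol P n"
    using inner_symbol_Gamma p_gt_1[OF p] by simp
  have s: "c_seq (2 * n + 4) = v n" for n by (simp add: c_seq_def)
  have nz: "inner_symbol P n \<noteq> 0" for n using inner_symbol_pos[OF P E, of n] by simp
  consider "n = 0" | "n = 1" | m where "n = Suc (Suc m)" by (metis One_nat_def not0_implies_Suc)
  thus "c_seq (2 * n + 4) * (Gamma_p p (2 * real n + 5) / Gamma_p p (2 * real n + 3)) + 1 * c_seq (2 * n) = E * c_seq (2 * n + 2)"
  proof cases
    case 1
    thus ?thesis unfolding G s using nz[of 0] by (simp add: c_seq_def)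
  next
    case 2
    have "c_seq (2 * n + 2) = v 0" "c_seq (2 * n) = 0" by (simp_all add: c_seq_def 2)
    thus ?thesis unfolding G s using nz[of 1] 2 by simp
  next
    case (3 m)
    have "c_seq (2 * n) = v m" "c_seq (2 * n + 2) = v (Suc m)" by (simp_all add: c_seq_def 3)
    thus ?thesis unfolding G s using nz[of n] 3 by simp
  qed
qed (simp_all add: c_seq_def)

lemma k_recursion_k_seq: "k_recursion p 1 E c k_seq"
  unfolding k_recursion_def
proof (intro conjI allI impI)
  fix n :: nat assume n: "n \<ge> 1"
  have s: "k_seq (2 * n + 5) = c * (w n * P ^ (2 * n))" for n by (simp add: k_seq_def)
  show "k_seq (2 * n + 1) * (Gamma_p p (- 2 * real n) / Gamma_p p (- 2 * real n - 2)) + 1 * k_seq (2 * n + 5) = E * k_seq (2 * n + 3)"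
  proof (cases "n = 1")
    case True
    have "k_seq (2 * n + 1) = 0" "k_seq (2 * n + 3) = c" by (simp_all add: k_seq_def True)
    thus ?thesis unfolding s using True P_positive by (simp add: power2_eq_square)
  next
    case False
    then obtain m where m: "n = m + 2" using n by (metis add_2_eq_Suc' One_nat_def Suc_le_D Suc_le_mono le_antisym not0_implies_Suc not_less_eq_eq)
    have G: "Gamma_p p (- 2 * real n) / Gamma_p p (- 2 * real n - 2) = outer_symbol P m"
      unfolding m using p_gt_1[OF p] by (intro outer_symbol_Gamma) simp
    have idx: "2 * n + 1 = 2 * m + 5" "2 * n + 3 = 2 * Suc m + 5" "2 * n + 5 = 2 * Suc (Suc m) + 5" using m by simp_all
    have pw: "P ^ (2 * Suc m) = P ^ (2 * m) * P ^ 2" "P ^ (2 * Suc (Suc m)) = P ^ (2 * m) * P ^ 4"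
    proof -
      have "2 * Suc m = 2 * m + 2" "2 * Suc (Suc m) = 2 * m + 4" by simp_all
      thus "P ^ (2 * Suc m) = P ^ (2 * m) * P ^ 2" "P ^ (2 * Suc (Suc m)) = P ^ (2 * m) * P ^ 4"
        by (simp_all only: power_add)
    qed
    have "P ^ 4 * w (Suc (Suc m)) = E * P ^ 2 * w (Suc m) - outer_symbol P m * w m" using P_positive by simp
    hence "outer_symbol P m * w m + P ^ 4 * w (Suc (Suc m)) = E * P ^ 2 * w (Suc m)" by linarith
    hence "c * P ^ (2 * m) * (outer_symbol P m * w m + P ^ 4 * w (Suc (Suc m))) = c * P ^ (2 * m) * (E * P ^ 2 * w (Suc m))"
      by (rule arg_cong)
    thus ?thesis unfolding G unfolding idx s pw by (simp add: algebra_simps del: outer_coeff.simps)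
  qed
qed (auto simp: k_seq_def)

lemma c_seq_sums:
  assumes t: "0 \<le> t" "t \<le> 1"
  shows "(\<lambda>n. c_seq n * t ^ n) sums profile P E t"
proof -
  have "(\<lambda>n. v n * t ^ (2 * n + 4)) sums even_series v 4 t"
    by (rule even_series_sums[OF P_at_least_2 _ v_bound t]) simp
  moreover have "v n * t ^ (2 * n + 4) = (\<lambda>n. c_seq (n + 4) * t ^ (n + 4)) (2 * n)" for n by (simp add: c_seq_def)
  ultimately have "(\<lambda>n. (\<lambda>n. c_seq (n + 4) * t ^ (n + 4)) (2 * n)) sums even_series v 4 t" by (simp only:)
  moreover have "strict_mono (\<lambda>n::nat. 2 * n)" by (simp add: strict_mono_def)
  moreover have "c_seq (n + 4) * t ^ (n + 4) = 0" if "n \<notin> range (\<lambda>n. 2 * n)" for n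
  proof -
    have "odd n" using that by (auto elim!: evenE)
    thus ?thesis by (simp add: c_seq_def)
  qed
  ultimately have "(\<lambda>n. c_seq (n + 4) * t ^ (n + 4)) sums even_series v 4 t"
    using sums_mono_reindex[of "\<lambda>n. 2 * n" "\<lambda>n. c_seq (n + 4) * t ^ (n + 4)"] by blast
  hence "(\<lambda>n. c_seq n * t ^ n) sums (even_series v 4 t + (\<Sum>i<4. c_seq i * t ^ i))"
    by (subst (asm) sums_iff_shift)
  moreover have "(\<Sum>i<4. c_seq i * t ^ i) = 1" by (simp add: c_seq_def eval_nat_numeral)
  ultimately show ?thesis using t by (simp add: profile_def add.commute)
qed

lemma k_seq_sums:
  assumes t: "t \<ge> P"
  shows "(\<lambda>n. k_seq (Suc n) * t powi (- int (Suc n))) sums profile P E t"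
proof -
  have t0: "t > 0" "t > 1" using t P by simp_all
  have r: "0 \<le> P / t" "P / t \<le> 1" using t t0 P_positive by simp_all
  have "(\<lambda>n. c / P ^ 5 * (w n * (P / t) ^ (2 * n + 5))) sums (c / P ^ 5 * even_series w 5 (P / t))"
    by (intro sums_mult even_series_sums[OF P_at_least_2 _ w_bound r]) simp
  moreover have "c / P ^ 5 * (w n * (P / t) ^ (2 * n + 5))
      = (\<lambda>n. k_seq (Suc n) * t powi (- int (Suc n))) (2 * n + 4)" for n
  proof -
    have k: "k_seq (Suc (2 * n + 4)) = c * (w n * P ^ (2 * n))" by (simp add: k_seq_def)
    have e: "Suc (2 * n + 4) = 2 * n + 5" by simp
    have q: "t powi (- int (2 * n + 5)) = 1 / t ^ (2 * n + 5)" by (simp only: power_int_minus power_int_of_nat inverse_eq_divide)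
    have "P ^ (2 * n + 5) = P ^ 5 * P ^ (2 * n)" by (simp only: power_add mult.commute)
    moreover have "c / a * (x * (a * b / s)) = c * (x * b) * (1 / s)" if "a \<noteq> 0" for a b s x :: real using that by simp
    ultimately show ?thesis unfolding k unfolding e q power_divide using P_positive by simp
  qed
  ultimately have "(\<lambda>n. (\<lambda>n. k_seq (Suc n) * t powi (- int (Suc n))) (2 * n + 4)) sums (c / P ^ 5 * even_series w 5 (P / t))"
    by (simp only:)
  moreover have "strict_mono (\<lambda>n::nat. 2 * n + 4)" by (simp add: strict_mono_def)
  moreover have "k_seq (Suc n) * t powi (- int (Suc n)) = 0" if "n \<notin> range (\<lambda>n. 2 * n + 4)" for n
  proof -
    have "\<not> (odd (Suc n) \<and> Suc n \<ge> 5)"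
    proof
      assume "odd (Suc n) \<and> Suc n \<ge> 5"
      hence "n = 2 * ((n - 4) div 2) + 4" by auto
      thus False using that by blast
    qed
    thus ?thesis by (simp only: k_seq_def if_False mult_zero_left)
  qed
  ultimately have "(\<lambda>n. k_seq (Suc n) * t powi (- int (Suc n))) sums (c / P ^ 5 * even_series w 5 (P / t))"
    using sums_mono_reindex[of "\<lambda>n. 2 * n + 4" "\<lambda>n. k_seq (Suc n) * t powi (- int (Suc n))"] by blast
  thus ?thesis using t0 by (simp add: profile_def)
qed

lemma norm_in_Zp: "x \<in> Zp p \<Longrightarrow> x \<in> Qp p \<and> 0 \<le> padic_norm p x \<and> padic_norm p x \<le> 1"
  using padic_norm_nonneg[OF p] by (auto simp: Zp_def)

text \<open>
  No norm lies strictly between 1 and \<open>p\<close>. Hence \<open>P / |x| \<le> 1\<close> outside the ring of integers, which is where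
  the outer series is dominated.
\<close>

lemma norm_notin_Zp:
  assumes "x \<in> Qp p - Zp p" shows "P \<le> padic_norm p x"
proof -
  have x: "x \<in> Qp p" "padic_norm p x > 1" using assms by (auto simp: Zp_def)
  consider "padic_norm p x = 0" | m where "padic_norm p x = P powi m" using padic_norm_cases[OF p x(1)] by blast
  thus ?thesis
  proof cases
    case (2 m)
    hence "P powi 0 < P powi m" using x(2) by simp
    hence "0 < m" by (simp only: powi_less_iff[OF p])
    hence "P powi 1 \<le> P powi m" unfolding powi_le_iff[OF p] by simp
    thus ?thesis using 2 by simp
  qed (use x in simp)
qed

lemma psi0_converges_seqs: "psi0_converges p c_seq k_seq"
  unfolding psi0_converges_def
proof (intro conjI ballI)
  fix x assume "x \<in> Zp p"
  hence "0 \<le> padic_norm p x" "padic_norm p x \<le> 1" using norm_in_Zp by auto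
  from c_seq_sums[OF this] show "summable (\<lambda>n. c_seq n * padic_norm p x ^ n)" by (rule sums_summable)
next
  fix x assume "x \<in> Qp p - Zp p"
  from k_seq_sums[OF norm_notin_Zp[OF this]]
  show "summable (\<lambda>n. k_seq (Suc n) * padic_norm p x powi (- int (Suc n)))" by (rule sums_summable)
qed

lemma psi0_eq_profile: "x \<in> Qp p \<Longrightarrow> psi0 p c_seq k_seq x = complex_of_real (profile P E (padic_norm p x))"
  using c_seq_sums[THEN sums_unique] k_seq_sums[THEN sums_unique] norm_in_Zp[of x] norm_notin_Zp[of x]
  by (simp add: psi0_def)

lemma oscillator_solution:
  "\<exists>(c0 :: real) (k5 :: real) (c :: nat \<Rightarrow> real) (k :: nat \<Rightarrow> real).
     (c0 \<noteq> 0 \<or> k5 \<noteq> 0) \<and> c_recursion p 1 E c0 c \<and> k_recursion p 1 E k5 k \<and>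
     psi0_converges p c k \<and> solves_padic_oscillator p 1 E (psi0 p c k)"
  using c_recursion_c_seq k_recursion_k_seq psi0_converges_seqs eigenfunction[OF psi0_eq_profile]
  by (intro exI[of _ 1] exI[of _ "outer_amp P E"] exI[of _ c_seq] exI[of _ k_seq] conjI) simp_all

end

theorem corollary5:
  shows "\<exists>E :: nat \<Rightarrow> real.
    (\<lambda>p. E p - (2 - 2 / real p)) \<in> O[inf sequentially (principal {p. prime p})](\<lambda>p. 1 / real p ^ 2) \<and>
    (\<forall>\<^sub>F p in sequentially. prime p \<longrightarrow>
      (\<exists>(c0 :: real) (k5 :: real) (c :: nat \<Rightarrow> real) (k :: nat \<Rightarrow> real).
         (c0 \<noteq> 0 \<or> k5 \<noteq> 0) \<and>
         c_recursion p 1 (E p) c0 c \<and> k_recursion p 1 (E p) k5 k \<and>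
         psi0_converges p c k \<and>
         solves_padic_oscillator p 1 (E p) (psi0 p c k)))"
proof -
  have "\<exists>E. 1 \<le> E \<and> E \<le> 3 \<and> level (real p) E = E \<and> \<bar>E - (2 - 2 / real p)\<bar> \<le> 30 / real p ^ 2" if "p \<ge> 8" for p
    using level_fixed_point[of "real p"] that by (metis of_nat_le_iff of_nat_numeral)
  then obtain E where E: "\<And>p. p \<ge> 8 \<Longrightarrow> 1 \<le> E p \<and> E p \<le> 3 \<and> level (real p) (E p) = E p
      \<and> \<bar>E p - (2 - 2 / real p)\<bar> \<le> 30 / real p ^ 2" by metis
  show ?thesis
  proof (intro exI[of _ E] conjI)
    have "\<forall>\<^sub>F p in sequentially. norm (E p - (2 - 2 / real p)) \<le> 30 * norm (1 / real p ^ 2)"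
      using eventually_ge_at_top[of 8] by eventually_elim (use E in simp)
    hence "(\<lambda>p. E p - (2 - 2 / real p)) \<in> O[sequentially](\<lambda>p. 1 / real p ^ 2)" by (rule bigoI)
    thus "(\<lambda>p. E p - (2 - 2 / real p)) \<in> O[inf sequentially (principal {p. prime p})](\<lambda>p. 1 / real p ^ 2)"
      by (rule landau_o.big.filter_mono[rotated]) simp
    show "\<forall>\<^sub>F p in sequentially. prime p \<longrightarrow>
      (\<exists>(c0 :: real) (k5 :: real) (c :: nat \<Rightarrow> real) (k :: nat \<Rightarrow> real).
         (c0 \<noteq> 0 \<or> k5 \<noteq> 0) \<and>
         c_recursion p 1 (E p) c0 c \<and> k_recursion p 1 (E p) k5 k \<and>
         psi0_converges p c k \<and>
         solves_padic_oscillator p 1 (E p) (psi0 p c k))"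
      using eventually_ge_at_top[of 8]
    proof eventually_elim
      case (elim p)
      have "real p \<ge> 4" using elim by simp
      thus ?case using oscillator_level.oscillator_solution[of p "E p"] E[OF elim]
        by (auto simp: oscillator_level_def)
    qed
  qed
qed

end
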